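(* Assume that (i) there exists $(n_1,\dots,n_p)\in(\mathbb{N}\setminus\{0\})^p$ such that $\mathbb{P}(|f(G,(n_1,\dots,n_p))|>0)>0$; (ii) there exists $\gamma>0$ such that $\mathbb{E}[|f(G,N^\mu)|^{2+\gamma}]<\infty$. Then the pair $(\vartheta_n^{A,B},\ell_n^{A,B})$ converges almost surely to $(\vartheta_\star^{A,B},\ell_\star^{A,B})$ as $n\to+\infty$. Moreover, if in addition there exists $\delta>0$ such that $\mathbb{E}[|f(G,N^\mu)|^{4+\delta}]<\infty$, then $$\sqrt{n}\left((\vartheta_n^{A,B},\ell_n^{A,B})-(\vartheta_\star^{A,B},\ell_\star^{A,B})\right)$$ converges in law, as $n\to+\infty$, to the normal distribution $\mathcal{N}_{d'+p'}(0,\Gamma)$, where $$\Gamma=\left(\nabla^2v^{A,B}(\vartheta_\star^{A,B},\ell_\star^{A,B})\right)^{-1}\operatorname{Cov}\left(\nabla F(G,A\vartheta_\star^{A,B},N^\mu,B\ell_\star^{A,B})\right)\left(\nabla^2v^{A,B}(\vartheta_\star^{A,B},\ell_\star^{A,B})\right)^{-1},$$ and $\nabla F(G,A\vartheta_\star^{A,B},N^\mu,B\ell_\star^{A,B})$ denotes the gradient of $(\vartheta,\ell)\mapsto F(G,A\vartheta,N^\mu,B\ell)$ with respect to the reduced parameters $(\vartheta,\ell)$, evaluated at $(\vartheta_\star^{A,B},\ell_\star^{A,B})$.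
   Context: $\mathbb{N}=\{0,1,2,\dots\}$. $G$ is a standard normal random vector in $\mathbb{R}^d$; $\mu\in(0,\infty)^p$ is fixed; $N^\mu=(N_1^{\mu_1},\dots,N_p^{\mu_p})$ is a vector of independent Poisson random variables with parameters $\mu_1,\dots,\mu_p$, independent of $G$. $f:\mathbb{R}^d\times\mathbb{N}^p\to\mathbb{R}$ is measurable with $\mathbb{E}[|f(G,N^\mu)|]<\infty$. For $g,\theta\in\mathbb{R}^d$, $n\in\mathbb{N}^p$, $\lambda\in(0,\infty)^p$, $$F(g,\theta,n,\lambda)=f(g,n)^2\,e^{-\theta\cdot g+\frac{|\theta|^2}{2}}\prod_{i=1}^p e^{\lambda_i-\mu_i}\left(\frac{\mu_i}{\lambda_i}\right)^{n_i}.$$ Let $0<d'\le d$, $0<p'\le p$, let $A\in\mathbb{R}^{d\times d'}$ have rank $d'$, and let $B\in\mathbb{R}^{p\times p'}$ have rank $p'$, nonnegative entries, and map $(0,\infty)^{p'}$ into $(0,\infty)^p$. For $(\vartheta,\ell)\in\mathbb{R}^{d'}\times(0,\infty)^{p'}$ put $v^{A,B}(\vartheta,\ell)=\mathbb{E}[F(G,A\vartheta,N^\mu,B\ell)]$. Standing assumption: $v^{A,B}$ admits a unique minimizer over $\mathbb{R}^{d'}\times(0,\infty)^{p'}$, denoted $(\vartheta_\star^{A,B},\ell_\star^{A,B})$. Let $(G^j,N^{\mu,j})_{j\ge1}$ be i.i.d. copies of $(G,N^\mu)$ and $$v_n^{A,B}(\vartheta,\ell)=\frac1n\sum_{j=1}^nF(G^j,A\vartheta,N^{\mu,j},B\ell).$$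 $(\vartheta_n^{A,B},\ell_n^{A,B})$ is an $\mathbb{R}^{d'}\times(0,\infty)^{p'}$-valued random vector, a measurable function of $(G^j,N^{\mu,j})_{1\le j\le n}$, equal to the unique minimizer of $v_n^{A,B}$ over $\mathbb{R}^{d'}\times(0,\infty)^{p'}$ whenever this exists (it is arbitrary otherwise; the paper works with $n$ large enough for the unique minimizer to exist). *)

theory Defs
  imports "HOL-Probability.Probability"
begin

definition gradient :: "(real ^ 'k \<Rightarrow> real) \<Rightarrow> real ^ 'k \<Rightarrow> real ^ 'k" where
  "gradient h x = (\<chi> i. frechet_derivative h (at x) (axis i 1))"

definition hessian :: "(real ^ 'k \<Rightarrow> real) \<Rightarrow> real ^ 'k \<Rightarrow> real ^ 'k ^ 'k" where
  "hessian h x = jacobian (gradient h) (at x)"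

definition twice_differentiable_at :: "(real ^ 'k \<Rightarrow> real) \<Rightarrow> real ^ 'k \<Rightarrow> bool" where
  "twice_differentiable_at h x \<longleftrightarrow>
     (\<forall>\<^sub>F y in nhds x. h differentiable (at y)) \<and> gradient h differentiable (at x)"

definition covariance_matrix :: "'a measure \<Rightarrow> ('a \<Rightarrow> real ^ 'k) \<Rightarrow> real ^ 'k ^ 'k" where
  "covariance_matrix M X = (\<chi> i j.
     \<integral>\<omega>. (X \<omega> $ i - (\<integral>\<omega>'. X \<omega>' $ i \<partial>M)) * (X \<omega> $ j - (\<integral>\<omega>'. X \<omega>' $ j \<partial>M)) \<partial>M)"

definition std_normal_vec :: "(real ^ 'k) measure" where
  "std_normal_vec = density lborel (\<lambda>x. ennreal (\<Prod>i\<in>UNIV. std_normal_density (x $ i)))"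

text \<open>The normal law with mean \<open>m\<close> and covariance matrix \<open>S\<close> is the image of the standard normal
  law under \<open>z \<mapsto> m + L z\<close> for any \<open>L\<close> with \<open>L L\<^sup>T = S\<close>; it depends on \<open>L\<close> only through \<open>S\<close>.
  It is a predicate rather than a function because it exists only for positive semidefinite
  symmetric \<open>S\<close> (possibly singular).\<close>

definition normal_law :: "real ^ 'k \<Rightarrow> real ^ 'k ^ 'k \<Rightarrow> (real ^ 'k) measure \<Rightarrow> bool" where
  "normal_law m S \<nu> \<longleftrightarrow>
     (\<exists>L :: real ^ 'k ^ 'k. L ** transpose L = S \<and> \<nu> = distr std_normal_vec borel (\<lambda>z. m + L *v z))"

text \<open>\<open>weak_conv_m\<close> of the library is restricted to measures on the real line.\<close>

definition converges_weakly :: "(nat \<Rightarrow> 'b::topological_space measure) \<Rightarrow> 'b measure \<Rightarrow> bool" where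
  "converges_weakly \<nu>s \<nu> \<longleftrightarrow>
     (\<forall>h :: 'b \<Rightarrow> real. continuous_on UNIV h \<longrightarrow> bounded (range h) \<longrightarrow>
        (\<lambda>n. \<integral>x. h x \<partial>\<nu>s n) \<longlonglongrightarrow> (\<integral>x. h x \<partial>\<nu>))"

definition unique_minimizer :: "('b \<Rightarrow> real) \<Rightarrow> 'b set \<Rightarrow> 'b \<Rightarrow> bool" where
  "unique_minimizer h D x \<longleftrightarrow>
     is_arg_min h (\<lambda>y. y \<in> D) x \<and> (\<forall>y. is_arg_min h (\<lambda>y. y \<in> D) y \<longrightarrow> y = x)"

abbreviation sample_space :: "((real ^ 'd) \<times> (nat ^ 'p)) measure" where
  "sample_space \<equiv> borel \<Otimes>\<^sub>M count_space UNIV"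

definition weighted_square ::
  "(real ^ 'd \<Rightarrow> nat ^ 'p \<Rightarrow> real) \<Rightarrow> real ^ 'p \<Rightarrow>
   real ^ 'd \<Rightarrow> real ^ 'd \<Rightarrow> nat ^ 'p \<Rightarrow> real ^ 'p \<Rightarrow> real" where
  "weighted_square f \<mu> g \<theta> n \<kappa> =
     (f g n)\<^sup>2 * exp (- (\<theta> \<bullet> g) + (norm \<theta>)\<^sup>2 / 2) *
     (\<Prod>i\<in>UNIV. exp (\<kappa> $ i - \<mu> $ i) * (\<mu> $ i / \<kappa> $ i) ^ (n $ i))"

text \<open>\<open>(\<theta>, l) \<mapsto> F(g, A \<theta>, n, B l)\<close>, where \<open>F = weighted_square f \<mu>\<close>\<close>

definition reduced_weighted_square ::
  "(real ^ 'd \<Rightarrow> nat ^ 'p \<Rightarrow> real) \<Rightarrow> real ^ 'p \<Rightarrow> real ^ 'd1 ^ 'd \<Rightarrow> real ^ 'p1 ^ 'p \<Rightarrow>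
   real ^ 'd \<Rightarrow> nat ^ 'p \<Rightarrow> (real ^ 'd1) \<times> (real ^ 'p1) \<Rightarrow> real" where
  "reduced_weighted_square f \<mu> A B g n = (\<lambda>(\<theta>, l). weighted_square f \<mu> g (A *v \<theta>) n (B *v l))"

definition reduced_variance ::
  "'a measure \<Rightarrow> ('a \<Rightarrow> real ^ 'd) \<Rightarrow> ('a \<Rightarrow> nat ^ 'p) \<Rightarrow>
   (real ^ 'd \<Rightarrow> nat ^ 'p \<Rightarrow> real) \<Rightarrow> real ^ 'p \<Rightarrow> real ^ 'd1 ^ 'd \<Rightarrow> real ^ 'p1 ^ 'p \<Rightarrow>
   (real ^ 'd1) \<times> (real ^ 'p1) \<Rightarrow> real" where
  "reduced_variance M G N f \<mu> A B x = (\<integral>\<omega>. reduced_weighted_square f \<mu> A B (G \<omega>) (N \<omega>) x \<partial>M)"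

definition empirical_variance ::
  "(nat \<Rightarrow> 'a \<Rightarrow> real ^ 'd) \<Rightarrow> (nat \<Rightarrow> 'a \<Rightarrow> nat ^ 'p) \<Rightarrow>
   (real ^ 'd \<Rightarrow> nat ^ 'p \<Rightarrow> real) \<Rightarrow> real ^ 'p \<Rightarrow> real ^ 'd1 ^ 'd \<Rightarrow> real ^ 'p1 ^ 'p \<Rightarrow>
   nat \<Rightarrow> 'a \<Rightarrow> (real ^ 'd1) \<times> (real ^ 'p1) \<Rightarrow> real" where
  "empirical_variance Gs Ns f \<mu> A B n \<omega> x =
     1 / real n * (\<Sum>j=1..n. reduced_weighted_square f \<mu> A B (Gs j \<omega>) (Ns j \<omega>) x)"

definition param_domain :: "((real ^ 'd1) \<times> (real ^ 'p1)) set" where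
  "param_domain = {(\<theta>, l). \<forall>k. 0 < l $ k}"

text \<open>Gradients, Hessians and normal laws of pairs refer to the identification of
  \<open>\<real>\<^sup>m \<times> \<real>\<^sup>n\<close> with \<open>\<real>\<^sup>m\<^sup>+\<^sup>n\<close>, the latter being indexed by the sum of the two index types.\<close>

definition stack :: "(real ^ 'a) \<times> (real ^ 'b) \<Rightarrow> real ^ ('a::finite + 'b::finite)" where
  "stack x = (\<chi> i. case i of Inl a \<Rightarrow> fst x $ a | Inr b \<Rightarrow> snd x $ b)"

definition unstack :: "real ^ ('a::finite + 'b::finite) \<Rightarrow> (real ^ 'a) \<times> (real ^ 'b)" where
  "unstack y = (\<chi> a. y $ Inl a, \<chi> b. y $ Inr b)"

end

theory Submission
  imports Defs
begin

text \<open>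
  In the reduced parameter the reweighted squared payoff has the form
  \<open>f(g, n)\<^sup>2 exp (\<Sum>i. \<rho>\<^sub>i (c\<^sub>i \<bullet> y))\<close>: the exponent is a sum of convex functions of one variable,
  evaluated at linear forms \<open>c\<^sub>i\<close> that are the rows of the block diagonal matrix with blocks \<open>A\<close> and \<open>B\<close>.
  Everything follows from three features of this form.

  Convexity. The payoff is convex in \<open>y\<close>, and strictly convex as soon as \<open>f(g, n) \<noteq> 0\<close> and no
  \<open>n\<^sub>i\<close> vanishes, because the rows span the dual space; hypothesis (i) and the independence of \<open>G\<close> and
  \<open>N\<close> give this event positive probability. On a small sphere around the minimiser \<open>x\<^sub>0\<close> of the
  limit the empirical means eventually exceed their value at \<open>x\<^sub>0\<close>, by the strong law at finitely
  many points and a Lipschitz bound. Convexity then traps every empirical minimiser inside the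
  sphere, which is consistency (\<open>minimizer_consistent\<close>).

  Domination. Near \<open>x\<^sub>0\<close> the payoff, its gradient and Hessian, and the constants in their Taylor
  expansions are all bounded by one random variable
  \<open>K = C f(g, n)\<^sup>2 exp (c (\<Sum>\<bar>g\<^sub>i\<bar> + \<Sum>n\<^sub>i))\<close> (\<open>loss_envelope\<close>). Normal and Poisson variables have all
  exponential moments, so Young's inequality trades them for the excess moment of \<open>f\<close>: the moment
  \<open>2 + \<gamma>\<close> makes \<open>K\<close> integrable and the moment \<open>4 + \<delta>\<close> makes it square integrable. The expansions
  integrate, and this differentiates the variance twice without any limit theorem.

  Linearisation. The gradient of the empirical mean vanishes at its minimiser; expanding it at
  \<open>x\<^sub>0\<close> with remainder \<open>K \<bar>h\<bar>\<^sup>2\<close> shows that the error \<open>h\<close> equals \<open>- H\<^sup>-\<^sup>1\<close> times the empirical mean of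
  the gradients at \<open>x\<^sub>0\<close>, up to a relatively negligible term (\<open>minimizer_linearization\<close>). The
  Hessian \<open>H\<close> of the limit is positive definite for the same reason as strict convexity. The central
  limit theorem in several dimensions and a perturbation lemma for weak limits finish the proof.

  The strong law comes from the maximal inequality behind the ergodic theorem, and the
  multivariate central limit theorem from the scalar one, applied to all linear forms, and from a
  continuity theorem for characteristic functions.
\<close>

section \<open>The strong law of large numbers\<close>

text \<open>The maximum of \<open>0\<close> and the first \<open>n\<close> partial sums. Peeling off the first term instead of the last
expresses it through the shifted sequence, which has the same law and is independent of the first
term when the terms are independent and identically distributed.\<close>

primrec running_max :: "nat \<Rightarrow> (nat \<Rightarrow> real) \<Rightarrow> real" where
  "running_max 0 s = 0"
| "running_max (Suc n) s = max 0 (s 0 + running_max n (\<lambda>i. s (Suc i)))"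

lemma running_max_nonneg: "0 \<le> running_max n s"
  by (cases n) auto

lemma running_max_mono_Suc: "running_max n s \<le> running_max (Suc n) s"
proof (induction n arbitrary: s)
  case (Suc n)
  from Suc[of "\<lambda>i. s (Suc i)"] show ?case by (simp add: max_def)
qed auto

lemma running_max_mono: "m \<le> n \<Longrightarrow> running_max m s \<le> running_max n s"
  using lift_Suc_mono_le[of "\<lambda>n. running_max n s", OF running_max_mono_Suc] .

lemma partial_sum_le_running_max: "(\<Sum>i<n. s i) \<le> running_max n s"
proof (induction n arbitrary: s)
  case (Suc n)
  have "(\<Sum>i<Suc n. s i) = s 0 + (\<Sum>i<n. s (Suc i))" by (rule sum.lessThan_Suc_shift)
  with Suc[of "\<lambda>i. s (Suc i)"] show ?case by simp
qed auto

lemma running_max_le_sum_abs: "running_max n s \<le> (\<Sum>i<n. \<bar>s i\<bar>)"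
proof (induction n arbitrary: s)
  case (Suc n)
  have "(\<Sum>i<Suc n. \<bar>s i\<bar>) = \<bar>s 0\<bar> + (\<Sum>i<n. \<bar>s (Suc i)\<bar>)" by (rule sum.lessThan_Suc_shift)
  with Suc[of "\<lambda>i. s (Suc i)"] show ?case by (simp add: sum_nonneg) 
qed auto

lemma running_max_measurable [measurable]:
  "running_max n \<in> borel_measurable (\<Pi>\<^sub>M i\<in>UNIV. borel)"
proof (induction n)
  case (Suc n)
  note Suc[measurable]
  have "(\<lambda>s. \<lambda>i\<in>UNIV. s (Suc i)) \<in> measurable (\<Pi>\<^sub>M i\<in>UNIV. (borel::real measure)) (\<Pi>\<^sub>M i\<in>UNIV. borel)"
    by (rule measurable_restrict) auto
  then have [measurable]: "(\<lambda>s i. s (Suc i)) \<in> measurable (\<Pi>\<^sub>M i\<in>UNIV. (borel::real measure)) (\<Pi>\<^sub>M i\<in>UNIV. borel)"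
    by (simp only: restrict_UNIV)
  show ?case by (simp, measurable)
qed auto

text \<open>The maximal inequality behind the ergodic theorem. Let \<open>T\<^sub>n\<close> be the running maximum, \<open>T'\<^sub>n\<close> that of
the shifted sequence and \<open>U\<close> the shift invariant event that \<open>T\<^sub>n\<close> is unbounded. Since \<open>T\<^sub>n\<close> increases
and \<open>T'\<^sub>n\<close> has the same law, \<open>E[(T\<^sub>n\<^sub>+\<^sub>1 - T'\<^sub>n) 1\<^sub>U] \<ge> 0\<close>, and \<open>T\<^sub>n\<^sub>+\<^sub>1 - T'\<^sub>n = max (- T'\<^sub>n) x\<close> tends to
the first term \<open>x\<close> on \<open>U\<close>. As \<open>x\<close> is independent of \<open>U\<close> this yields \<open>E[x] P(U) \<ge> 0\<close>, and a negative
mean forces \<open>P(U) = 0\<close>.\<close>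

lemma partial_sums_bounded_above_PiM:
  fixes L :: "real measure"
  assumes "prob_space L" and sets_L [measurable_cong]: "sets L = sets borel"
    and int: "integrable L (\<lambda>x. x)" and neg: "(\<integral>x. x \<partial>L) < 0"
  shows "AE s in (\<Pi>\<^sub>M i\<in>UNIV. L). \<exists>C. \<forall>n. running_max n s \<le> C"
proof -
  interpret L: prob_space L by fact
  interpret sequence_space L
    by unfold_locales
  interpret LS: pair_prob_space L S ..
  have sets_S [measurable_cong]: "sets S = sets (\<Pi>\<^sub>M i\<in>UNIV. borel)"
    by (rule sets_PiM_cong) (auto simp: sets_L)
  let ?T = running_max
  define U where "U = {s. \<forall>C::nat. \<exists>n. real C < ?T n s}"
  have [measurable]: "?T n \<in> borel_measurable S" for n
    using running_max_measurable measurable_cong_sets[OF sets_S refl] by blast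
  have spS: "space S = UNIV"
    using sets_eq_imp_space_eq[OF sets_S] by (simp add: space_PiM)
  have spL: "space L = UNIV"
    using sets_eq_imp_space_eq[OF sets_L] by simp
  have U_meas [measurable]: "U \<in> sets S"
  proof -
    have "{s \<in> space S. \<forall>C::nat. \<exists>n. real C < ?T n s} \<in> sets S" by measurable
    then show ?thesis by (simp add: U_def spS)
  qed
  have U_shift: "case_nat x s \<in> U \<longleftrightarrow> s \<in> U" for x s
  proof
    assume a: "case_nat x s \<in> U"
    show "s \<in> U" unfolding U_def
    proof safe
      fix C :: nat
      from a obtain n where n: "real (C + nat \<lceil>\<bar>x\<bar>\<rceil>) < ?T n (case_nat x s)" unfolding U_def by blast
      then obtain m where "n = Suc m" by (cases n) (auto, linarith)
      with n have "real C + real (nat \<lceil>\<bar>x\<bar>\<rceil>) < max 0 (x + ?T m s)" by simp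
      moreover have "\<bar>x\<bar> \<le> real (nat \<lceil>\<bar>x\<bar>\<rceil>)" by linarith
      ultimately have "real C < ?T m s" using of_nat_0_le_iff[of C, where 'a=real] by linarith
      then show "\<exists>n. real C < ?T n s" by blast
    qed
  next
    assume a: "s \<in> U"
    show "case_nat x s \<in> U" unfolding U_def
    proof safe
      fix C :: nat
      from a obtain n where n: "real (C + nat \<lceil>\<bar>x\<bar>\<rceil>) < ?T n s" unfolding U_def by blast
      moreover have "\<bar>x\<bar> \<le> real (nat \<lceil>\<bar>x\<bar>\<rceil>)" by linarith
      ultimately have "real C < x + ?T n s" by linarith
      then have "real C < ?T (Suc n) (case_nat x s)" by simp
      then show "\<exists>n. real C < ?T n (case_nat x s)" by blast
    qed
  qed
  let ?shift = "\<lambda>(x, s). case_nat x s :: nat \<Rightarrow> real"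
  have shift_meas [measurable]: "?shift \<in> measurable (L \<Otimes>\<^sub>M S) S"
    by measurable
  have int_T: "integrable S (?T n)" for n
  proof (rule Bochner_Integration.integrable_bound[of S "\<lambda>s. \<Sum>i<n. \<bar>s i\<bar>"])
    have "integrable S (\<lambda>s. s i)" for i
    proof -
      have "distr S L (\<lambda>\<omega>. \<omega> i) = L"
        by (rule distr_PiM_component) (auto intro: L.prob_space_axioms)
      with int have "integrable (distr S L (\<lambda>\<omega>. \<omega> i)) (\<lambda>x. x)" by simp
      then show ?thesis by (subst (asm) integrable_distr_eq) auto
    qed
    then show "integrable S (\<lambda>s. \<Sum>i<n. \<bar>s i\<bar>)" by auto
    have "0 \<le> (\<Sum>i<n. \<bar>s i\<bar>)" for s :: "nat \<Rightarrow> real" by (auto intro: sum_nonneg)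
    then show "AE s in S. norm (?T n s) \<le> norm (\<Sum>i<n. \<bar>s i\<bar>)"
      using running_max_nonneg running_max_le_sum_abs by auto
  qed auto
  have int_TU: "integrable S (\<lambda>s. ?T n s * indicator U s)" for n
    using int_T by (intro integrable_real_mult_indicator) auto
  \<comment> \<open>invariance of \<open>S\<close> under prepending an independent coordinate\<close>
  have iter: "(\<integral>s. ?T (Suc n) s * indicator U s \<partial>S) =
      (\<integral>z. max 0 (fst z + ?T n (snd z)) * indicator U (snd z) \<partial>(L \<Otimes>\<^sub>M S))" for n
  proof -
    have "(\<integral>s. ?T (Suc n) s * indicator U s \<partial>S) =
        (\<integral>s. ?T (Suc n) s * indicator U s \<partial>distr (L \<Otimes>\<^sub>M S) S ?shift)"
      by (simp only: PiM_iter)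
    also have "\<dots> = (\<integral>z. ?T (Suc n) (?shift z) * indicator U (?shift z) \<partial>(L \<Otimes>\<^sub>M S))"
      by (rule integral_distr[OF shift_meas borel_measurable_integrable[OF int_TU]])
    also have "\<dots> = (\<integral>z. max 0 (fst z + ?T n (snd z)) * indicator U (snd z) \<partial>(L \<Otimes>\<^sub>M S))"
      by (intro Bochner_Integration.integral_cong) (auto simp: U_shift indicator_def split_beta')
    finally show ?thesis .
  qed
  have marg_S: "distr (L \<Otimes>\<^sub>M S) S snd = S"
  proof (rule measure_eqI)
    fix A assume A: "A \<in> sets (distr (L \<Otimes>\<^sub>M S) S snd)"
    then have "snd -` A \<inter> space (L \<Otimes>\<^sub>M S) = space L \<times> A"
      using sets.sets_into_space[of A S] by (auto simp: space_pair_measure)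
    with A show "emeasure (distr (L \<Otimes>\<^sub>M S) S snd) A = emeasure S A"
      by (simp add: emeasure_distr P.emeasure_pair_measure_Times L.emeasure_space_1)
  qed simp
  have snd_int: "integrable (L \<Otimes>\<^sub>M S) (\<lambda>z. ?T n (snd z) * indicator U (snd z))"
    and snd_eq: "(\<integral>s. ?T n s * indicator U s \<partial>S) =
      (\<integral>z. ?T n (snd z) * indicator U (snd z) \<partial>(L \<Otimes>\<^sub>M S))" for n
  proof -
    have "integrable (distr (L \<Otimes>\<^sub>M S) S snd) (\<lambda>s. ?T n s * indicator U s)"
      using int_TU by (simp only: marg_S)
    then show "integrable (L \<Otimes>\<^sub>M S) (\<lambda>z. ?T n (snd z) * indicator U (snd z))"
      by (subst (asm) integrable_distr_eq) auto
    have "(\<integral>s. ?T n s * indicator U s \<partial>S) = (\<integral>s. ?T n s * indicator U s \<partial>distr (L \<Otimes>\<^sub>M S) S snd)"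
      by (simp only: marg_S)
    also have "\<dots> = (\<integral>z. ?T n (snd z) * indicator U (snd z) \<partial>(L \<Otimes>\<^sub>M S))"
      by (rule integral_distr) auto
    finally show "(\<integral>s. ?T n s * indicator U s \<partial>S) =
      (\<integral>z. ?T n (snd z) * indicator U (snd z) \<partial>(L \<Otimes>\<^sub>M S))" .
  qed
  have fst_int: "integrable (L \<Otimes>\<^sub>M S) (\<lambda>z. fst z)"
  proof -
    have "integrable (distr (L \<Otimes>\<^sub>M S) L fst) (\<lambda>x. x)"
      using int by (simp only: P.distr_pair_fst)
    then show ?thesis by (subst (asm) integrable_distr_eq) auto
  qed
  have int2: "integrable (L \<Otimes>\<^sub>M S) (\<lambda>z. max 0 (fst z + ?T n (snd z)) * indicator U (snd z))" for n
  proof -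
    have "integrable (distr (L \<Otimes>\<^sub>M S) S ?shift) (\<lambda>s. ?T (Suc n) s * indicator U s)"
      using int_TU[of "Suc n"] by (simp only: PiM_iter)
    then have "integrable (L \<Otimes>\<^sub>M S) (\<lambda>z. ?T (Suc n) (?shift z) * indicator U (?shift z))"
      by (subst (asm) integrable_distr_eq[OF shift_meas borel_measurable_integrable[OF int_TU]])
    also have "?this \<longleftrightarrow> ?thesis"
      by (intro Bochner_Integration.integrable_cong) (auto simp: U_shift indicator_def split_beta')
    finally show ?thesis .
  qed
  \<comment> \<open>Monotonicity of the running maximum, with both expectations carried over to the product space.\<close>
  have nonneg: "0 \<le> (\<integral>z. max (- ?T n (snd z)) (fst z) * indicator U (snd z) \<partial>(L \<Otimes>\<^sub>M S))" for n
  proof -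
    have "(\<integral>s. ?T n s * indicator U s \<partial>S) \<le> (\<integral>s. ?T (Suc n) s * indicator U s \<partial>S)"
      by (intro integral_mono int_TU mult_right_mono running_max_mono_Suc) auto
    then have "0 \<le> (\<integral>z. max 0 (fst z + ?T n (snd z)) * indicator U (snd z) -
        ?T n (snd z) * indicator U (snd z) \<partial>(L \<Otimes>\<^sub>M S))"
      by (simp del: running_max.simps add: iter snd_eq Bochner_Integration.integral_diff[OF int2 snd_int])
    also have "\<dots> = (\<integral>z. max (- ?T n (snd z)) (fst z) * indicator U (snd z) \<partial>(L \<Otimes>\<^sub>M S))"
      by (intro Bochner_Integration.integral_cong) (auto simp: indicator_def max_def)
    finally show ?thesis .
  qed
  have "(\<lambda>n. \<integral>z. max (- ?T n (snd z)) (fst z) * indicator U (snd z) \<partial>(L \<Otimes>\<^sub>M S))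
      \<longlonglongrightarrow> (\<integral>z. fst z * indicator U (snd z) \<partial>(L \<Otimes>\<^sub>M S))"
  proof (rule integral_dominated_convergence[where w="\<lambda>z. \<bar>fst z\<bar>"])
    show "AE z in L \<Otimes>\<^sub>M S. (\<lambda>n. max (- ?T n (snd z)) (fst z) * indicator U (snd z))
        \<longlonglongrightarrow> fst z * indicator U (snd z)"
    proof (rule AE_I2)
      fix z
      show "(\<lambda>n. max (- ?T n (snd z)) (fst z) * indicator U (snd z)) \<longlonglongrightarrow> fst z * indicator U (snd z)"
      proof (cases "snd z \<in> U")
        case True
        then obtain m where m: "real (nat \<lceil>\<bar>fst z\<bar>\<rceil>) < ?T m (snd z)" unfolding U_def by blast
        have "\<forall>\<^sub>F n in sequentially. max (- ?T n (snd z)) (fst z) * indicator U (snd z) = fst z * indicator U (snd z)"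
          using eventually_ge_at_top[of m]
        proof eventually_elim
          case (elim n)
          from running_max_mono[OF elim, of "snd z"] m have "- ?T n (snd z) \<le> fst z" by linarith
          then show ?case by (simp add: max_def)
        qed
        then show ?thesis by (rule tendsto_eventually)
      qed simp
    qed
    show "AE z in L \<Otimes>\<^sub>M S. norm (max (- ?T n (snd z)) (fst z) * indicator U (snd z)) \<le> \<bar>fst z\<bar>" for n
      using running_max_nonneg by (auto intro!: AE_I2 simp: indicator_def max_def)
  qed (use fst_int in auto)
  then have "0 \<le> (\<integral>z. fst z * indicator U (snd z) \<partial>(L \<Otimes>\<^sub>M S))"
    by (rule LIMSEQ_le_const) (use nonneg in auto)
  also have "(\<integral>z. fst z * indicator U (snd z) \<partial>(L \<Otimes>\<^sub>M S)) = (\<integral>x. \<integral>s. x * indicator U s \<partial>S \<partial>L)"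
  proof -
    have "integrable (L \<Otimes>\<^sub>M S) (\<lambda>z. fst z * indicator U (snd z))"
      by (rule Bochner_Integration.integrable_bound[OF fst_int]) (auto simp: indicator_def)
    then show ?thesis by (subst LS.integral_fst'[symmetric]) auto
  qed
  also have "\<dots> = (\<integral>x. x \<partial>L) * measure S U"
    by simp
  finally have "measure S U = 0"
    using neg measure_nonneg[of S U] by (simp add: zero_le_mult_iff)
  then have "AE s in S. s \<notin> U"
    using U_meas by (simp add: AE_iff_measurable[OF U_meas, of "\<lambda>s. s \<notin> U"] P.emeasure_eq_measure spS)
  then show ?thesis
    by eventually_elim (auto simp: U_def not_less)
qed

text \<open>After subtracting a number between the mean and \<open>a\<close> the mean is negative, so the partial sums
are bounded above and their quotient by \<open>n\<close> has nonpositive upper limit.\<close>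

lemma (in prob_space) strong_law_upper:
  fixes X :: "nat \<Rightarrow> 'a \<Rightarrow> real"
  assumes ind: "indep_vars (\<lambda>_. borel) X UNIV"
    and law: "\<And>i. distr M borel (X i) = distr M borel (X 0)"
    and int: "integrable M (X 0)" and a: "expectation (X 0) < a"
  shows "AE \<omega> in M. \<forall>\<^sub>F n in sequentially. (\<Sum>i<n. X i \<omega>) / n \<le> a"
proof -
  obtain b where b: "expectation (X 0) < b" "b < a" using dense[OF a] by blast
  have X [measurable]: "random_variable borel (X i)" for i
    using ind unfolding indep_vars_def2 by simp
  let ?Y = "\<lambda>i \<omega>. X i \<omega> - b"
  let ?L = "distr M borel (?Y 0)"
  have Lc: "distr M borel (?Y i) = distr (distr M borel (X i)) borel (\<lambda>x. x - b)" for i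
    by (subst distr_distr) (auto simp: comp_def)
  have L: "distr M borel (?Y i) = ?L" for i
    using Lc[of i] Lc[of 0] law[of i] by simp
  have indY: "indep_vars (\<lambda>_. borel) ?Y UNIV"
    using indep_vars_compose2[OF ind, where Y="\<lambda>_ x. x - b" and N="\<lambda>_. borel"] by simp
  have PL: "prob_space ?L" by (rule prob_space_distr) auto
  have D: "distr M (\<Pi>\<^sub>M i\<in>UNIV. borel) (\<lambda>\<omega> i. ?Y i \<omega>) = (\<Pi>\<^sub>M i\<in>UNIV. ?L)"
  proof -
    have "(\<Pi>\<^sub>M i\<in>UNIV. distr M borel (?Y i)) = (\<Pi>\<^sub>M i\<in>UNIV. ?L)"
      by (rule PiM_cong[OF refl]) (rule L)
    moreover have "distr M (\<Pi>\<^sub>M i\<in>UNIV. borel) (\<lambda>\<omega>. \<lambda>i\<in>UNIV. ?Y i \<omega>) =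
        (\<Pi>\<^sub>M i\<in>UNIV. distr M borel (?Y i))"
      using indY by (subst (asm) indep_vars_iff_distr_eq_PiM) auto
    ultimately show ?thesis by (simp only: restrict_UNIV)
  qed
  have "AE s in (\<Pi>\<^sub>M i\<in>UNIV. ?L). \<exists>C. \<forall>n. running_max n s \<le> C"
  proof (rule partial_sums_bounded_above_PiM[OF PL])
    show "integrable ?L (\<lambda>x. x)" using int by (simp add: integrable_distr_eq)
    show "(\<integral>x. x \<partial>?L) < 0" using int b by (simp add: integral_distr prob_space)
  qed simp
  moreover have "(\<lambda>\<omega> i. ?Y i \<omega>) \<in> measurable M (\<Pi>\<^sub>M i\<in>UNIV. borel)"
    using measurable_restrict[of UNIV ?Y M "\<lambda>_. borel"] by (simp add: restrict_UNIV)
  ultimately have "AE \<omega> in M. \<exists>C. \<forall>n. running_max n (\<lambda>i. ?Y i \<omega>) \<le> C"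
    unfolding D[symmetric] by (rule AE_distrD[rotated])
  then show ?thesis
  proof eventually_elim
    case (elim \<omega>)
    then obtain C where C: "\<And>n. running_max n (\<lambda>i. ?Y i \<omega>) \<le> C" by blast
    have "\<forall>\<^sub>F n in sequentially. n \<ge> 1 \<and> real n \<ge> C / (a - b)"
      by (intro eventually_conj eventually_ge_at_top filterlim_at_top[THEN iffD1, rule_format, OF filterlim_real_sequentially])
    then show ?case
    proof eventually_elim
      case (elim n)
      then have "C \<le> (a - b) * n" using b by (simp add: field_simps)
      moreover have "(\<Sum>i<n. X i \<omega> - b) \<le> C"
        using partial_sum_le_running_max[of "\<lambda>i. ?Y i \<omega>" n] C[of n] by linarith
      ultimately have "(\<Sum>i<n. X i \<omega>) \<le> a * n"
        by (simp add: sum_subtractf algebra_simps)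
      then show ?case using elim by (simp add: field_simps)
    qed
  qed
qed

theorem (in prob_space) strong_law_of_large_numbers:
  fixes X :: "nat \<Rightarrow> 'a \<Rightarrow> real"
  assumes ind: "indep_vars (\<lambda>_. borel) X UNIV"
    and law: "\<And>i. distr M borel (X i) = distr M borel (X 0)"
    and int: "integrable M (X 0)"
  shows "AE \<omega> in M. (\<lambda>n. (\<Sum>i<n. X i \<omega>) / n) \<longlonglongrightarrow> expectation (X 0)"
proof -
  have X [measurable]: "random_variable borel (X i)" for i
    using ind unfolding indep_vars_def2 by simp
  let ?m = "expectation (X 0)"
  have up: "AE \<omega> in M. \<forall>k. \<forall>\<^sub>F n in sequentially. (\<Sum>i<n. X i \<omega>) / n \<le> ?m + 1 / Suc k"
    unfolding AE_all_countable by (intro allI strong_law_upper assms) auto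
  have "AE \<omega> in M. \<forall>k. \<forall>\<^sub>F n in sequentially. (\<Sum>i<n. - X i \<omega>) / n \<le> - ?m + 1 / Suc k"
    unfolding AE_all_countable
  proof (intro allI strong_law_upper)
    show "indep_vars (\<lambda>_. borel) (\<lambda>i \<omega>. - X i \<omega>) UNIV"
      using indep_vars_compose2[OF ind, where Y="\<lambda>_ x. - x" and N="\<lambda>_. borel"] by simp
    have Lc: "distr M borel (\<lambda>\<omega>. - X i \<omega>) = distr (distr M borel (X i)) borel (\<lambda>x. - x)" for i
      by (subst distr_distr) (auto simp: comp_def)
    show "distr M borel (\<lambda>\<omega>. - X i \<omega>) = distr M borel (\<lambda>\<omega>. - X 0 \<omega>)" for i
      using Lc[of i] Lc[of 0] law[of i] by simp
  qed (use int in auto)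
  with up show ?thesis
  proof eventually_elim
    case (elim \<omega>)
    show ?case
    proof (rule tendstoI)
      fix e :: real assume "0 < e"
      then obtain k where k: "1 / Suc k < e" using nat_approx_posE by (metis inverse_eq_divide)
      from elim(1)[rule_format, of k] elim(2)[rule_format, of k]
      show "\<forall>\<^sub>F n in sequentially. dist ((\<Sum>i<n. X i \<omega>) / n) ?m < e"
      proof eventually_elim
        case (elim n)
        with k show ?case by (simp add: dist_real_def sum_negf)
      qed
    qed
  qed
qed

section \<open>The standard normal vector\<close>

lemma prod_Basis_vec: "(\<Prod>b\<in>(Basis :: (real^'k) set). g b) = (\<Prod>i\<in>UNIV. g (axis i 1))"
proof -
  have B: "(Basis :: (real^'k) set) = range (\<lambda>i. axis i 1)"
    by (auto simp: Basis_vec_def)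
  have I: "inj (\<lambda>i. axis i (1::real) :: real^'k)"
    by (auto simp: inj_on_def axis_eq_axis)
  show ?thesis unfolding B by (subst prod.reindex[OF I]) (simp add: comp_def)
qed

lemma nn_integral_lborel_vec_prod:
  fixes g :: "'k::finite \<Rightarrow> real \<Rightarrow> ennreal"
  assumes [measurable]: "\<And>i. g i \<in> borel_measurable borel"
  shows "(\<integral>\<^sup>+x. (\<Prod>i\<in>UNIV. g i (x $ i)) \<partial>(lborel :: (real^'k) measure)) = (\<Prod>i\<in>UNIV. \<integral>\<^sup>+u. g i u \<partial>lborel)"
proof -
  \<comment> \<open>The Lebesgue measure is a product over \<open>Basis\<close>, whose members are the axis vectors.\<close>
  define f where "f b = g (THE i. b = axis i 1)" for b :: "real^'k"
  have f: "f (axis i 1) = g i" for i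
    by (simp add: f_def axis_eq_axis)
  have "(\<integral>\<^sup>+x. (\<Prod>b\<in>Basis. f b (x \<bullet> b)) \<partial>(lborel :: (real^'k) measure)) = (\<Prod>b\<in>Basis. (\<integral>\<^sup>+u. f b u \<partial>lborel))"
    by (rule nn_integral_lborel_prod) (auto simp: f_def)
  then show ?thesis
    by (simp add: prod_Basis_vec f inner_axis)
qed

lemma sets_std_normal_vec [measurable_cong, simp]: "sets std_normal_vec = sets borel"
  and space_std_normal_vec [simp]: "space std_normal_vec = UNIV"
  by (simp_all add: std_normal_vec_def)

lemma emeasure_std_normal_vec_box:
  assumes [measurable]: "\<And>i. A i \<in> sets borel"
  shows "emeasure std_normal_vec {x :: real^'k. \<forall>i. x $ i \<in> A i} =
    (\<Prod>i\<in>UNIV. emeasure std_normal_distribution (A i))"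
proof -
  have [measurable]: "{x :: real^'k. \<forall>i. x $ i \<in> A i} \<in> sets borel"
    by measurable
  have "emeasure std_normal_vec {x :: real^'k. \<forall>i. x $ i \<in> A i} =
      (\<integral>\<^sup>+x. ennreal (\<Prod>i\<in>UNIV. std_normal_density (x $ i)) * indicator {x. \<forall>i. x $ i \<in> A i} x \<partial>lborel)"
    by (simp add: std_normal_vec_def emeasure_density)
  also have "\<dots> = (\<integral>\<^sup>+x. (\<Prod>i\<in>UNIV. ennreal (std_normal_density (x $ i)) * indicator (A i) (x $ i)) \<partial>lborel)"
  proof (intro nn_integral_cong)
    fix x :: "real^'k"
    have "(indicator {x. \<forall>i. x $ i \<in> A i} x :: ennreal) = (\<Prod>i\<in>UNIV. indicator (A i) (x $ i))"
      by (auto simp: indicator_def)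
    then show "ennreal (\<Prod>i\<in>UNIV. std_normal_density (x $ i)) * indicator {x. \<forall>i. x $ i \<in> A i} x =
        (\<Prod>i\<in>UNIV. ennreal (std_normal_density (x $ i)) * indicator (A i) (x $ i))"
      by (simp add: prod.distrib prod_ennreal)
  qed
  also have "\<dots> = (\<Prod>i\<in>UNIV. \<integral>\<^sup>+u. ennreal (std_normal_density u) * indicator (A i) u \<partial>lborel)"
    by (rule nn_integral_lborel_vec_prod) simp
  also have "\<dots> = (\<Prod>i\<in>UNIV. emeasure std_normal_distribution (A i))"
    by (simp add: emeasure_density)
  finally show ?thesis .
qed

lemma prob_space_std_normal_vec: "prob_space (std_normal_vec :: (real^'k) measure)"
proof
  interpret L: prob_space std_normal_distribution by (rule prob_space_normal_density) simp
  have "emeasure std_normal_distribution UNIV = 1" using L.emeasure_space_1 by simp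
  then show "emeasure (std_normal_vec :: (real^'k) measure) (space std_normal_vec) = 1"
    using emeasure_std_normal_vec_box[of "\<lambda>_::'k. UNIV"] by simp
qed

lemma distr_std_normal_vec_component:
  "distr std_normal_vec borel (\<lambda>x :: real^'k. x $ i) = std_normal_distribution"
proof (rule measure_eqI)
  interpret L: prob_space std_normal_distribution by (rule prob_space_normal_density) simp
  have 1: "emeasure std_normal_distribution UNIV = 1" using L.emeasure_space_1 by simp
  fix A assume "A \<in> sets (distr std_normal_vec borel (\<lambda>x :: real^'k. x $ i))"
  then have [measurable]: "A \<in> sets borel" by simp
  have eq: "{x :: real^'k. \<forall>j. x $ j \<in> (if j = i then A else UNIV)} = (\<lambda>x. x $ i) -` A"
    by auto
  have "(\<Prod>j\<in>UNIV. emeasure std_normal_distribution (if j = i then A else UNIV)) =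
      emeasure std_normal_distribution A"
    using 1 by (subst prod.remove[of _ i]) (auto intro!: prod.neutral)
  then show "emeasure (distr std_normal_vec borel (\<lambda>x :: real^'k. x $ i)) A = emeasure std_normal_distribution A"
    using emeasure_std_normal_vec_box[of "\<lambda>j. if j = i then A else UNIV"]
    by (simp add: emeasure_distr eq)
qed simp

text \<open>Boxes generate, and the probability of a box is a product by the previous lemmas.\<close>

lemma indep_vars_std_normal_vec:
  "prob_space.indep_vars std_normal_vec (\<lambda>_. borel) (\<lambda>i (x :: real^'k). x $ i) UNIV"
proof -
  interpret prob_space "std_normal_vec :: (real^'k) measure" by (rule prob_space_std_normal_vec)
  have "indep_vars (\<lambda>_. borel) (\<lambda>i (x :: real^'k). x $ i) UNIV \<longleftrightarrow>
    (\<forall>A\<in>(\<Pi> i\<in>UNIV. sets borel). prob (\<Inter>j\<in>UNIV. (\<lambda>x. x $ j) -` A j \<inter> space std_normal_vec) =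
       (\<Prod>j\<in>UNIV. prob ((\<lambda>x. x $ j) -` A j \<inter> space std_normal_vec)))"
    by (rule indep_vars_finite)
       (auto simp: sets.sigma_sets_eq[of borel, simplified] Int_stable_def)
  also have "\<dots>"
  proof
    fix A :: "'k \<Rightarrow> real set" assume "A \<in> (\<Pi> i\<in>UNIV. sets borel)"
    then have [measurable]: "A i \<in> sets borel" for i by auto
    have m: "emeasure std_normal_vec ((\<lambda>x :: real^'k. x $ j) -` A j) = emeasure std_normal_distribution (A j)" for j
      using arg_cong[OF distr_std_normal_vec_component[of j], of "\<lambda>D. emeasure D (A j)"] by (simp add: emeasure_distr)
    have "(\<Inter>j\<in>UNIV. (\<lambda>x :: real^'k. x $ j) -` A j) = {x. \<forall>i. x $ i \<in> A i}" by auto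
    then have "emeasure std_normal_vec (\<Inter>j\<in>UNIV. (\<lambda>x :: real^'k. x $ j) -` A j) =
        (\<Prod>j\<in>UNIV. emeasure std_normal_vec ((\<lambda>x :: real^'k. x $ j) -` A j))"
      by (simp only: emeasure_std_normal_vec_box m) (simp add: emeasure_std_normal_vec_box)
    then show "prob (\<Inter>j\<in>UNIV. (\<lambda>x. x $ j) -` A j \<inter> space std_normal_vec) =
       (\<Prod>j\<in>UNIV. prob ((\<lambda>x. x $ j) -` A j \<inter> space std_normal_vec))"
      by (simp add: emeasure_eq_measure prod_ennreal prod_nonneg)
  qed
  finally show ?thesis .
qed

definition vec_char :: "(real^'k) measure \<Rightarrow> real^'k \<Rightarrow> complex" where
  "vec_char \<nu> t = (CLINT x|\<nu>. iexp (t \<bullet> x))"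

text \<open>Independent coordinates reduce the claim to the scalar normal law.\<close>

lemma vec_char_std_normal: "vec_char (std_normal_vec :: (real^'k) measure) t = exp (- (norm t)\<^sup>2 / 2)"
proof -
  interpret prob_space "std_normal_vec :: (real^'k) measure" by (rule prob_space_std_normal_vec)
  have ind: "indep_vars (\<lambda>_. borel) (\<lambda>i (x :: real^'k). t $ i * x $ i) UNIV"
    using indep_vars_compose2[OF indep_vars_std_normal_vec, where Y="\<lambda>i u. t $ i * u" and N="\<lambda>_. borel"] by simp
  have c: "char (distr std_normal_vec borel (\<lambda>x :: real^'k. t $ i * x $ i)) 1 = exp (- (t $ i)\<^sup>2 / 2)" for i
  proof -
    have "char (distr std_normal_vec borel (\<lambda>x :: real^'k. t $ i * x $ i)) 1 =
        char (distr std_normal_vec borel (\<lambda>x :: real^'k. x $ i)) (t $ i)"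
      by (simp add: char_def integral_distr)
    then show ?thesis
      by (simp add: distr_std_normal_vec_component char_std_normal_distribution)
  qed
  have "vec_char (std_normal_vec :: (real^'k) measure) t =
      char (distr std_normal_vec borel (\<lambda>x :: real^'k. \<Sum>i\<in>UNIV. t $ i * x $ i)) 1"
    by (simp add: vec_char_def char_def integral_distr inner_vec_def)
  also have "\<dots> = (\<Prod>i\<in>UNIV. of_real (exp (- (t $ i)\<^sup>2 / 2)))"
    by (subst char_distr_sum[OF ind]) (simp add: c)
  also have "\<dots> = of_real (exp (\<Sum>i\<in>UNIV. - (t $ i)\<^sup>2 / 2))"
    by (simp add: exp_sum)
  also have "(\<Sum>i\<in>UNIV. - (t $ i)\<^sup>2 / 2) = - (norm t)\<^sup>2 / 2"
    by (simp add: norm_vec_def L2_set_def sum_nonneg sum_negf sum_divide_distrib)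
  finally show ?thesis by simp
qed

section \<open>Weak convergence and characteristic functions\<close>

text \<open>The Gaussian bump is itself a characteristic function, namely that of a standard normal vector
\<open>w\<close>. By Fubini, averaging the bump around \<open>y\<close> over a law \<open>\<rho>\<close> only involves the characteristic
function of \<open>\<rho>\<close> at \<open>- w / \<epsilon>\<close>. Hence pointwise convergence of characteristic functions gives
convergence of these averages for every \<open>y\<close>, and dominated convergence integrates against \<open>h\<close>.\<close>

lemma smoothed_integral_converges:
  fixes \<nu>s :: "nat \<Rightarrow> (real^'k) measure"
  assumes p: "\<And>n. prob_space (\<nu>s n)" "prob_space \<nu>"
    and s [measurable_cong, simp]: "\<And>n. sets (\<nu>s n) = sets borel" "sets \<nu> = sets borel"
    and conv: "\<And>t. (\<lambda>n. vec_char (\<nu>s n) t) \<longlonglongrightarrow> vec_char \<nu> t"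
    and h [measurable]: "h \<in> borel_measurable borel" and h_int: "integrable lborel h"
    and "0 < \<epsilon>"
  shows "(\<lambda>n. \<integral>x. \<integral>y. h y * exp (- (norm ((1 / \<epsilon>) *\<^sub>R (y - x)))\<^sup>2 / 2) \<partial>lborel \<partial>\<nu>s n) \<longlonglongrightarrow>
    (\<integral>x. \<integral>y. h y * exp (- (norm ((1 / \<epsilon>) *\<^sub>R (y - x)))\<^sup>2 / 2) \<partial>lborel \<partial>\<nu>)"
proof -
  interpret W: prob_space "std_normal_vec :: (real^'k) measure" by (rule prob_space_std_normal_vec)
  let ?W = "std_normal_vec :: (real^'k) measure"
  let ?e = "\<lambda>y x. exp (- (norm ((1 / \<epsilon>) *\<^sub>R (y - x)))\<^sup>2 / 2)"
  have key: "complex_of_real (\<integral>x. ?e y x \<partial>\<rho>) = (CLINT w|?W. iexp ((1 / \<epsilon>) *\<^sub>R w \<bullet> y) * vec_char \<rho> (- (1 / \<epsilon>) *\<^sub>R w))"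
    if \<rho>: "prob_space \<rho>" and [measurable_cong, simp]: "sets \<rho> = sets borel" for y and \<rho> :: "(real^'k) measure"
  proof -
    interpret R: prob_space \<rho> by fact
    interpret RW: pair_prob_space \<rho> ?W ..
    have "complex_of_real (\<integral>x. ?e y x \<partial>\<rho>) = (CLINT x|\<rho>. complex_of_real (?e y x))"
      by simp
    also have "\<dots> = (CLINT x|\<rho>. CLINT w|?W. iexp ((1 / \<epsilon>) *\<^sub>R (y - x) \<bullet> w))"
      unfolding vec_char_std_normal[symmetric] vec_char_def ..
    also have "\<dots> = (CLINT w|?W. CLINT x|\<rho>. iexp ((1 / \<epsilon>) *\<^sub>R (y - x) \<bullet> w))"
    proof (rule RW.Fubini_integral[symmetric])
      show "integrable (\<rho> \<Otimes>\<^sub>M ?W) (\<lambda>(x, w). iexp ((1 / \<epsilon>) *\<^sub>R (y - x) \<bullet> w))"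
        by (rule RW.P.integrable_const_bound[of _ 1]) (auto simp: split_beta')
    qed
    also have "\<dots> = (CLINT w|?W. iexp ((1 / \<epsilon>) *\<^sub>R w \<bullet> y) * vec_char \<rho> (- (1 / \<epsilon>) *\<^sub>R w))"
    proof (rule Bochner_Integration.integral_cong[OF refl])
      fix w
      have "iexp ((1 / \<epsilon>) *\<^sub>R (y - x) \<bullet> w) = iexp ((1 / \<epsilon>) *\<^sub>R w \<bullet> y) * iexp (- (1 / \<epsilon>) *\<^sub>R w \<bullet> x)" for x
        by (simp add: exp_add[symmetric] inner_diff_left inner_commute algebra_simps diff_divide_distrib)
      then show "(CLINT x|\<rho>. iexp ((1 / \<epsilon>) *\<^sub>R (y - x) \<bullet> w)) = iexp ((1 / \<epsilon>) *\<^sub>R w \<bullet> y) * vec_char \<rho> (- (1 / \<epsilon>) *\<^sub>R w)"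
        by (simp add: vec_char_def)
    qed
    finally show ?thesis .
  qed
  have char_meas [measurable]: "(\<lambda>w. vec_char \<rho> (- (1 / \<epsilon>) *\<^sub>R w)) \<in> borel_measurable borel"
    and char_le: "\<And>t. norm (vec_char \<rho> t) \<le> 1"
    if \<rho>: "prob_space \<rho>" and [measurable_cong, simp]: "sets \<rho> = sets borel" for \<rho> :: "(real^'k) measure"
  proof -
    interpret R: prob_space \<rho> by fact
    show "(\<lambda>w. vec_char \<rho> (- (1 / \<epsilon>) *\<^sub>R w)) \<in> borel_measurable borel"
      unfolding vec_char_def by measurable
    fix t
    have "norm (vec_char \<rho> t) \<le> (\<integral>x. norm (iexp (t \<bullet> x)) \<partial>\<rho>)"
      unfolding vec_char_def by (rule integral_norm_bound)
    also have "\<dots> = 1" using R.prob_space by simp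
    finally show "norm (vec_char \<rho> t) \<le> 1" .
  qed
  have pt: "(\<lambda>n. \<integral>x. ?e y x \<partial>\<nu>s n) \<longlonglongrightarrow> (\<integral>x. ?e y x \<partial>\<nu>)" for y
  proof -
    have "(\<lambda>n. complex_of_real (\<integral>x. ?e y x \<partial>\<nu>s n)) \<longlonglongrightarrow> complex_of_real (\<integral>x. ?e y x \<partial>\<nu>)"
      unfolding key[OF p(1) s(1)] key[OF p(2) s(2)]
    proof (rule integral_dominated_convergence[where w="\<lambda>_. 1"])
      show "AE w in ?W. (\<lambda>n. iexp ((1 / \<epsilon>) *\<^sub>R w \<bullet> y) * vec_char (\<nu>s n) (- (1 / \<epsilon>) *\<^sub>R w))
          \<longlonglongrightarrow> iexp ((1 / \<epsilon>) *\<^sub>R w \<bullet> y) * vec_char \<nu> (- (1 / \<epsilon>) *\<^sub>R w)"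
        by (intro AE_I2 tendsto_mult_left conv)
      show "AE w in ?W. norm (iexp ((1 / \<epsilon>) *\<^sub>R w \<bullet> y) * vec_char (\<nu>s n) (- (1 / \<epsilon>) *\<^sub>R w)) \<le> 1" for n
        using char_le[OF p(1) s(1)] by (auto simp: norm_mult)
      show "(\<lambda>w. iexp ((1 / \<epsilon>) *\<^sub>R w \<bullet> y) * vec_char \<nu> (- (1 / \<epsilon>) *\<^sub>R w)) \<in> borel_measurable ?W"
        using char_meas[OF p(2) s(2)] by measurable
      show "(\<lambda>w. iexp ((1 / \<epsilon>) *\<^sub>R w \<bullet> y) * vec_char (\<nu>s n) (- (1 / \<epsilon>) *\<^sub>R w)) \<in> borel_measurable ?W" for n
        using char_meas[OF p(1) s(1)] by measurable
    qed simp
    then show ?thesis by (simp only: tendsto_of_real_iff)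
  qed
  have fub: "(\<integral>x. \<integral>y. h y * ?e y x \<partial>lborel \<partial>\<rho>) = (\<integral>y. h y * (\<integral>x. ?e y x \<partial>\<rho>) \<partial>lborel)"
    and e_int: "(\<lambda>y. \<integral>x. ?e y x \<partial>\<rho>) \<in> borel_measurable borel" "\<bar>\<integral>x. ?e y x \<partial>\<rho>\<bar> \<le> 1"
    if \<rho>: "prob_space \<rho>" and [measurable_cong, simp]: "sets \<rho> = sets borel" for y and \<rho> :: "(real^'k) measure"
  proof -
    interpret R: prob_space \<rho> by fact
    interpret RL: pair_sigma_finite \<rho> "lborel :: (real^'k) measure" ..
    have "(\<integral>x. \<integral>y. h y * ?e y x \<partial>lborel \<partial>\<rho>) = (\<integral>y. \<integral>x. h y * ?e y x \<partial>\<rho> \<partial>lborel)"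
    proof (rule RL.Fubini_integral[symmetric])
      have 1: "integrable (\<rho> \<Otimes>\<^sub>M lborel) (\<lambda>z. h (snd z))"
      proof (rule integrableI_bounded)
        have "(\<integral>\<^sup>+z. ennreal (norm (h (snd z))) \<partial>(\<rho> \<Otimes>\<^sub>M lborel)) =
            (\<integral>\<^sup>+x. \<integral>\<^sup>+y. ennreal (norm (h y)) \<partial>lborel \<partial>\<rho>)"
          by (subst lborel.nn_integral_fst[symmetric]) simp_all
        also have "\<dots> < \<infinity>"
          using h_int by (simp add: R.emeasure_space_1 integrable_iff_bounded)
        finally show "(\<integral>\<^sup>+z. ennreal (norm (h (snd z))) \<partial>(\<rho> \<Otimes>\<^sub>M lborel)) < \<infinity>" .
      qed simp
      show "integrable (\<rho> \<Otimes>\<^sub>M lborel) (\<lambda>(x, y). h y * ?e y x)"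
        by (rule Bochner_Integration.integrable_bound[OF 1])
           (auto simp: split_beta' abs_mult intro!: AE_I2 mult_left_le)
    qed
    then show "(\<integral>x. \<integral>y. h y * ?e y x \<partial>lborel \<partial>\<rho>) = (\<integral>y. h y * (\<integral>x. ?e y x \<partial>\<rho>) \<partial>lborel)"
      by simp
    show "(\<lambda>y. \<integral>x. ?e y x \<partial>\<rho>) \<in> borel_measurable borel" by measurable
    have "\<bar>\<integral>x. ?e y x \<partial>\<rho>\<bar> \<le> (\<integral>x. 1 \<partial>\<rho>)"
      by (rule integral_abs_bound[THEN order_trans], rule integral_mono)
         (auto intro!: R.integrable_const_bound[of _ 1])
    then show "\<bar>\<integral>x. ?e y x \<partial>\<rho>\<bar> \<le> 1" using R.prob_space by simp
  qed
  show ?thesis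
    unfolding fub[OF p(1) s(1)] fub[OF p(2) s(2)]
  proof (rule integral_dominated_convergence[where w="\<lambda>y. \<bar>h y\<bar>"])
    show "AE y in lborel. (\<lambda>n. h y * (\<integral>x. ?e y x \<partial>\<nu>s n)) \<longlonglongrightarrow> h y * (\<integral>x. ?e y x \<partial>\<nu>)"
      by (intro AE_I2 tendsto_mult_left pt)
    show "AE y in lborel. norm (h y * (\<integral>x. ?e y x \<partial>\<nu>s n)) \<le> \<bar>h y\<bar>" for n
      using e_int(2)[OF p(1) s(1)] by (auto simp: abs_mult intro!: mult_left_le)
    show "(\<lambda>y. h y * (\<integral>x. ?e y x \<partial>\<nu>)) \<in> borel_measurable lborel"
      using e_int(1)[OF p(2) s(2)] by simp
    show "(\<lambda>y. h y * (\<integral>x. ?e y x \<partial>\<nu>s n)) \<in> borel_measurable lborel" for n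
      using e_int(1)[OF p(1) s(1)] by simp
  qed (use h_int in auto)
qed

definition cutoff :: "real \<Rightarrow> 'b::real_normed_vector \<Rightarrow> real" where
  "cutoff R x = max 0 (min 1 (R + 1 - norm x))"

lemma cutoff_continuous: "continuous_on UNIV (cutoff R)"
  unfolding cutoff_def by (intro continuous_intros)

lemma cutoff_measurable [measurable]: "cutoff R \<in> borel_measurable (borel :: 'b::{real_normed_vector, second_countable_topology} measure)"
  by (rule borel_measurable_continuous_onI[OF cutoff_continuous])

lemma cutoff_bounds: "0 \<le> cutoff R x" "cutoff R x \<le> 1"
  by (auto simp: cutoff_def)

lemma abs_cutoff [simp]: "\<bar>cutoff R x\<bar> = cutoff R x"
  by (simp add: cutoff_bounds)

lemma cutoff_eq_1: "norm x \<le> R \<Longrightarrow> cutoff R x = 1"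
  and cutoff_eq_0: "R + 1 \<le> norm x \<Longrightarrow> cutoff R x = 0"
  by (auto simp: cutoff_def)

text \<open>Continuous functions of compact support: they are bounded, uniformly continuous and integrable
at once, and they suffice to test weak convergence.\<close>

definition test_function :: "('b::real_normed_vector \<Rightarrow> real) \<Rightarrow> bool" where
  "test_function h \<longleftrightarrow> continuous_on UNIV h \<and> (\<exists>R. \<forall>x. R < norm x \<longrightarrow> h x = 0)"

lemma test_functionD:
  fixes h :: "'b::euclidean_space \<Rightarrow> real"
  assumes "test_function h"
  shows test_function_continuous: "continuous_on UNIV h"
    and test_function_measurable: "h \<in> borel_measurable borel"
    and test_function_bounded: "\<exists>B>0. \<forall>x. \<bar>h x\<bar> \<le> B"
    and test_function_uniform: "0 < e \<Longrightarrow> \<exists>d>0. \<forall>x y. dist x y < d \<longrightarrow> \<bar>h x - h y\<bar> < e"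
    and test_function_integrable: "integrable lborel h"
proof -
  show c: "continuous_on UNIV h" using assms by (simp add: test_function_def)
  then show m: "h \<in> borel_measurable borel" by (rule borel_measurable_continuous_onI)
  obtain R where R: "\<And>x. R < norm x \<Longrightarrow> h x = 0" using assms by (auto simp: test_function_def)
  have "compact (h ` cball 0 R)"
    by (intro compact_continuous_image continuous_on_subset[OF c]) auto
  then obtain B where B: "\<And>x. x \<in> cball 0 R \<Longrightarrow> \<bar>h x\<bar> \<le> B"
    using compact_imp_bounded[of "h ` cball 0 R"] unfolding bounded_iff by fastforce
  have "\<bar>h x\<bar> \<le> max B 1" for x
    using B[of x] R[of x] by (cases "x \<in> cball 0 R") (auto simp: max_def)
  then show "\<exists>B>0. \<forall>x. \<bar>h x\<bar> \<le> B" by (intro exI[of _ "max B 1"]) auto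
  show "\<exists>d>0. \<forall>x y. dist x y < d \<longrightarrow> \<bar>h x - h y\<bar> < e" if "0 < e"
  proof -
    have "uniformly_continuous_on (cball 0 (R + 1)) h"
      by (intro compact_uniformly_continuous continuous_on_subset[OF c]) auto
    with \<open>0 < e\<close> obtain d where d: "0 < d"
      "\<And>x y. x \<in> cball 0 (R + 1) \<Longrightarrow> y \<in> cball 0 (R + 1) \<Longrightarrow> dist y x < d \<Longrightarrow> dist (h y) (h x) < e"
      unfolding uniformly_continuous_on_def by metis
    show ?thesis
    proof (intro exI[of _ "min d 1"] conjI allI impI)
      fix x y :: 'b assume xy: "dist x y < min d 1"
      have tr: "norm x \<le> norm y + dist x y" "norm y \<le> norm x + dist x y"
        using norm_triangle_ineq2[of x y] norm_triangle_ineq2[of y x] by (auto simp: dist_norm norm_minus_commute)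
      show "\<bar>h x - h y\<bar> < e"
      proof (cases "norm x \<le> R + 1 \<and> norm y \<le> R + 1")
        case True
        with d(2)[of y x] xy show ?thesis by (auto simp: dist_real_def dist_commute)
      next
        case False
        with tr xy have "R < norm x" "R < norm y" by auto
        with R \<open>0 < e\<close> show ?thesis by simp
      qed
    qed (use d in auto)
  qed
  have "integrable lborel (\<lambda>x. indicator (cball 0 R) x *\<^sub>R h x)"
    by (intro borel_integrable_compact continuous_on_subset[OF c]) auto
  moreover have "(\<lambda>x. indicator (cball 0 R) x *\<^sub>R h x) = h"
  proof
    fix x show "indicator (cball 0 R) x *\<^sub>R h x = h x"
      using R[of x] by (cases "x \<in> cball 0 R") auto
  qed
  ultimately show "integrable lborel h" by (simp only:)
qed

lemma test_function_mult_cutoff: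
  "continuous_on UNIV h \<Longrightarrow> test_function (\<lambda>x. h x * cutoff R x)"
  unfolding test_function_def
  by (intro conjI continuous_on_mult cutoff_continuous exI[of _ "R + 1"]) (auto simp: cutoff_eq_0)

lemma test_function_cutoff: "test_function (cutoff R)"
  using test_function_mult_cutoff[of "\<lambda>_. 1" R] by simp

lemma (in prob_space) tail_small:
  fixes X :: "'a \<Rightarrow> 'b::{real_normed_vector, second_countable_topology}"
  assumes [measurable]: "random_variable borel X" and "0 < e"
  shows "\<exists>R>0. prob {x \<in> space M. R < norm (X x)} < e"
proof -
  have "(\<lambda>n. prob {x \<in> space M. real n < norm (X x)}) \<longlonglongrightarrow> prob (\<Inter>n. {x \<in> space M. real n < norm (X x)})"
    by (rule finite_Lim_measure_decseq) (auto simp: decseq_def)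
  also have "(\<Inter>n. {x \<in> space M. real n < norm (X x)}) = {}"
  proof -
    have "\<exists>n. norm (X x) \<le> real n" for x using real_arch_simple by blast
    then show ?thesis using leD by blast
  qed
  finally have "(\<lambda>n. prob {x \<in> space M. real n < norm (X x)}) \<longlonglongrightarrow> 0" by simp
  then have "\<forall>\<^sub>F n in sequentially. 0 < n \<and> prob {x \<in> space M. real n < norm (X x)} < e"
    using \<open>0 < e\<close> by (intro eventually_conj eventually_gt_at_top order_tendstoD) 
  then obtain n :: nat where "0 < n" "prob {x \<in> space M. real n < norm (X x)} < e"
    by (auto simp: eventually_sequentially)
  then show ?thesis by (intro exI[of _ "real n"]) auto
qed

lemma (in prob_space) expectation_cutoff_near_1:
  fixes X :: "'a \<Rightarrow> 'b::{real_normed_vector, second_countable_topology}"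
  assumes [measurable]: "random_variable borel X" and "0 < e"
  shows "\<exists>R>0. 1 - e < expectation (\<lambda>x. cutoff R (X x))"
proof -
  obtain R where R: "R > 0" "prob {x \<in> space M. R < norm (X x)} < e" using tail_small[OF assms] by blast
  let ?A = "{x \<in> space M. R < norm (X x)}"
  have "1 - prob ?A = (\<integral>x. 1 - indicator ?A x \<partial>M)"
    by (subst Bochner_Integration.integral_diff) (auto simp: prob_space intro!: integrable_real_indicator simp: emeasure_eq_measure)
  also have "\<dots> \<le> expectation (\<lambda>x. cutoff R (X x))"
  proof (rule integral_mono)
    show "1 - indicator ?A x \<le> cutoff R (X x)" if "x \<in> space M" for x
      using that cutoff_bounds[of R "X x"] by (auto simp: indicator_def cutoff_eq_1 not_less)
    show "integrable M (\<lambda>x. 1 - indicator ?A x :: real)"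
      by (intro Bochner_Integration.integrable_diff integrable_const integrable_real_indicator) (auto simp: emeasure_eq_measure)
    show "integrable M (\<lambda>x. cutoff R (X x))"
      by (intro integrable_const_bound[of _ 1]) (auto simp: cutoff_bounds)
  qed
  finally show ?thesis using R by (intro exI[of _ R]) auto
qed

text \<open>No mass escapes to infinity because the limit is a probability: a cutoff function that has
integral close to \<open>1\<close> under \<open>\<nu>\<close> also has integral close to \<open>1\<close> under \<open>\<nu>s n\<close> for large \<open>n\<close>, and a
bounded continuous function multiplied by the cutoff is a test function.\<close>

lemma converges_weakly_testI:
  fixes \<nu>s :: "nat \<Rightarrow> 'b::euclidean_space measure"
  assumes p: "\<And>n. prob_space (\<nu>s n)" "prob_space \<nu>"
    and s [measurable_cong, simp]: "\<And>n. sets (\<nu>s n) = sets borel" "sets \<nu> = sets borel"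
    and conv: "\<And>h. test_function h \<Longrightarrow> (\<lambda>n. \<integral>x. h x \<partial>\<nu>s n) \<longlonglongrightarrow> (\<integral>x. h x \<partial>\<nu>)"
  shows "converges_weakly \<nu>s \<nu>"
  unfolding converges_weakly_def
proof (intro allI impI)
  fix h :: "'b \<Rightarrow> real"
  assume c: "continuous_on UNIV h" and b: "bounded (range h)"
  have [measurable]: "h \<in> borel_measurable borel" using c by (rule borel_measurable_continuous_onI)
  obtain B0 where "\<And>x. \<bar>h x\<bar> \<le> B0" using b by (auto simp: bounded_iff)
  then have "\<exists>B>0. \<forall>x. \<bar>h x\<bar> \<le> B" by (intro exI[of _ "max B0 1"]) (auto simp: le_max_iff_disj)
  then obtain B where B: "0 < B" "\<And>x. \<bar>h x\<bar> \<le> B" by blast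
  have split: "\<bar>(\<integral>x. h x \<partial>\<rho>) - (\<integral>x. h x * cutoff R x \<partial>\<rho>)\<bar> \<le> B * (1 - (\<integral>x. cutoff R x \<partial>\<rho>))"
    if "prob_space \<rho>" and [measurable_cong, simp]: "sets \<rho> = sets borel" for \<rho> and R
  proof -
    interpret R: prob_space \<rho> by fact
    have i1: "integrable \<rho> h" using B by (intro R.integrable_const_bound[of _ B]) auto
    have i2: "integrable \<rho> (\<lambda>x. h x * cutoff R x)"
      using B cutoff_bounds[of R] by (intro Bochner_Integration.integrable_bound[OF i1]) (auto simp: abs_mult abs_of_nonneg intro!: mult_left_le AE_I2)
    have i3: "integrable \<rho> (cutoff R)"
      using cutoff_bounds[of R] by (intro R.integrable_const_bound[of _ 1]) auto
    have "\<bar>(\<integral>x. h x \<partial>\<rho>) - (\<integral>x. h x * cutoff R x \<partial>\<rho>)\<bar> = \<bar>\<integral>x. h x - h x * cutoff R x \<partial>\<rho>\<bar>"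
      by (subst Bochner_Integration.integral_diff[OF i1 i2]) simp
    also have "\<dots> \<le> (\<integral>x. B * (1 - cutoff R x) \<partial>\<rho>)"
    proof (rule integral_abs_bound[THEN order_trans], rule integral_mono)
      fix x
      have "\<bar>h x - h x * cutoff R x\<bar> = \<bar>h x\<bar> * (1 - cutoff R x)"
      proof -
        have "h x - h x * cutoff R x = h x * (1 - cutoff R x)" by (simp add: algebra_simps)
        then show ?thesis using cutoff_bounds[of R x] by (simp add: abs_mult)
      qed
      then show "\<bar>h x - h x * cutoff R x\<bar> \<le> B * (1 - cutoff R x)"
        using B(2)[of x] cutoff_bounds[of R x] by (simp add: mult_right_mono)
    qed (use i1 i2 i3 in auto)
    also have "\<dots> = B * (1 - (\<integral>x. cutoff R x \<partial>\<rho>))"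
      using i3 R.prob_space by simp
    finally show ?thesis .
  qed
  show "(\<lambda>n. \<integral>x. h x \<partial>\<nu>s n) \<longlonglongrightarrow> (\<integral>x. h x \<partial>\<nu>)"
  proof (rule tendstoI)
    fix e :: real assume "0 < e"
    obtain R where R: "R > 0" "1 - e / (4 * B) < (\<integral>x. cutoff R x \<partial>\<nu>)"
      using prob_space.expectation_cutoff_near_1[OF p(2), of "\<lambda>x. x" "e / (4 * B)"] B \<open>0 < e\<close> by auto
    have "\<forall>\<^sub>F n in sequentially. 1 - e / (4 * B) < (\<integral>x. cutoff R x \<partial>\<nu>s n)"
      using conv[OF test_function_cutoff[of R]] R(2) by (rule order_tendstoD)
    moreover have "\<forall>\<^sub>F n in sequentially. dist (\<integral>x. h x * cutoff R x \<partial>\<nu>s n) (\<integral>x. h x * cutoff R x \<partial>\<nu>) < e / 2"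
      using conv[OF test_function_mult_cutoff[OF c, of R]] \<open>0 < e\<close> by (intro tendstoD) auto
    ultimately show "\<forall>\<^sub>F n in sequentially. dist (\<integral>x. h x \<partial>\<nu>s n) (\<integral>x. h x \<partial>\<nu>) < e"
    proof eventually_elim
      case (elim n)
      have lt: "B * (1 - c) < e / 4" if "1 - e / (4 * B) < c" for c
      proof -
        have "B * (1 - c) < B * (e / (4 * B))" using that B by (intro mult_strict_left_mono) auto
        then show ?thesis using B by simp
      qed
      show ?case
        using split[OF p(1) s(1), of n R] split[OF p(2) s(2), of R] elim lt[OF elim(1)] lt[OF R(2)]
        unfolding dist_real_def by linarith
    qed
  qed
qed

text \<open>A form of Slutsky's theorem whose error is small relative to \<open>W n\<close>. Where the cutoff of \<open>W n\<close> does
not vanish, \<open>W n\<close> is bounded and the error is small in absolute terms, so uniform continuity of the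
test function applies; the rest of the space has small probability because \<open>W n\<close> converges
weakly.\<close>

lemma (in prob_space) converges_weakly_perturb:
  fixes Y W :: "nat \<Rightarrow> 'a \<Rightarrow> 'b::euclidean_space"
  assumes [measurable]: "\<And>n. random_variable borel (Y n)" "\<And>n. random_variable borel (W n)"
    and \<nu>: "prob_space \<nu>" and [measurable_cong, simp]: "sets \<nu> = sets borel"
    and W: "converges_weakly (\<lambda>n. distr M borel (W n)) \<nu>"
    and close: "AE \<omega> in M. \<forall>\<delta>>0. \<forall>\<^sub>F n in sequentially. norm (Y n \<omega> - W n \<omega>) \<le> \<delta> * norm (W n \<omega>)"
  shows "converges_weakly (\<lambda>n. distr M borel (Y n)) \<nu>"
proof (rule converges_weakly_testI)
  fix h :: "'b \<Rightarrow> real" assume h: "test_function h"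
  note [measurable] = test_function_measurable[OF h]
  obtain B where B: "0 < B" "\<And>x. \<bar>h x\<bar> \<le> B" using test_function_bounded[OF h] by blast
  have Wt: "(\<lambda>n. expectation (\<lambda>\<omega>. k (W n \<omega>))) \<longlonglongrightarrow> (\<integral>x. k x \<partial>\<nu>)" if "test_function k" for k
  proof -
    from test_function_bounded[OF that] have "bounded (range k)" by (auto simp: bounded_iff)
    then show ?thesis
      using W[unfolded converges_weakly_def, rule_format, OF test_function_continuous[OF that]]
        test_function_measurable[OF that] by (simp add: integral_distr)
  qed
  let ?d = "\<lambda>n \<omega>. \<bar>h (Y n \<omega>) - h (W n \<omega>)\<bar>"
  have d2: "?d n \<omega> \<le> 2 * B" for n \<omega>
    using B(2)[of "Y n \<omega>"] B(2)[of "W n \<omega>"] by linarith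
  have dc: "\<bar>?d n \<omega> * cutoff R (W n \<omega>)\<bar> \<le> 2 * B" for n \<omega> R
    using mult_mono[OF d2[of n \<omega>] cutoff_bounds(2)[of R "W n \<omega>"]] B(1) cutoff_bounds(1)[of R "W n \<omega>"]
    by (simp add: abs_mult)
  have di: "integrable M (\<lambda>\<omega>. ?d n \<omega> * cutoff R (W n \<omega>))" for n R
    by (rule integrable_const_bound[of _ "2 * B"]) (use dc in simp_all)
  have ci: "integrable M (\<lambda>\<omega>. cutoff R (W n \<omega>))" for n R
    using cutoff_bounds[of R] by (intro integrable_const_bound[of _ 1]) auto
  have z: "(\<lambda>n. expectation (\<lambda>\<omega>. ?d n \<omega> * cutoff R (W n \<omega>))) \<longlonglongrightarrow> 0" if "0 < R" for R
  proof -
    have "(\<lambda>n. expectation (\<lambda>\<omega>. ?d n \<omega> * cutoff R (W n \<omega>))) \<longlonglongrightarrow> expectation (\<lambda>\<omega>. 0)"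
    proof (rule integral_dominated_convergence[where w="\<lambda>_. 2 * B"])
      show "AE \<omega> in M. (\<lambda>n. ?d n \<omega> * cutoff R (W n \<omega>)) \<longlonglongrightarrow> 0"
        using close
      proof eventually_elim
        case (elim \<omega>)
        show ?case
        proof (rule tendstoI)
          fix e :: real assume "0 < e"
          obtain d where d: "0 < d" "\<And>x y. dist x y < d \<Longrightarrow> \<bar>h x - h y\<bar> < e"
            using test_function_uniform[OF h \<open>0 < e\<close>] by blast
          define \<delta> where "\<delta> = d / (2 * (R + 1))"
          have "\<delta> > 0" using d \<open>0 < R\<close> by (simp add: \<delta>_def)
          with elim have "\<forall>\<^sub>F n in sequentially. norm (Y n \<omega> - W n \<omega>) \<le> \<delta> * norm (W n \<omega>)" by blast
          then show "\<forall>\<^sub>F n in sequentially. dist (?d n \<omega> * cutoff R (W n \<omega>)) 0 < e"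
          proof eventually_elim
            case (elim n)
            show ?case
            proof (cases "R + 1 \<le> norm (W n \<omega>)")
              case True then show ?thesis using \<open>0 < e\<close> by (simp add: cutoff_eq_0)
            next
              case False
              then have "\<delta> * norm (W n \<omega>) \<le> \<delta> * (R + 1)" using \<open>\<delta> > 0\<close> by (intro mult_left_mono) auto
              also have "\<dots> = d / 2" using \<open>0 < R\<close> by (simp add: \<delta>_def field_simps)
              finally have "dist (Y n \<omega>) (W n \<omega>) < d" using elim d(1) by (simp add: dist_norm)
              then have "?d n \<omega> < e" by (rule d(2))
              moreover have "?d n \<omega> * cutoff R (W n \<omega>) \<le> ?d n \<omega>"
                using cutoff_bounds[of R "W n \<omega>"] by (intro mult_left_le) auto
              ultimately show ?thesis using cutoff_bounds[of R "W n \<omega>"] by (simp add: abs_mult)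
            qed
          qed
        qed
      qed
      show "AE \<omega> in M. norm (?d n \<omega> * cutoff R (W n \<omega>)) \<le> 2 * B" for n
        using dc by simp
    qed auto
    then show ?thesis by simp
  qed
  have bound: "\<bar>expectation (\<lambda>\<omega>. h (Y n \<omega>)) - expectation (\<lambda>\<omega>. h (W n \<omega>))\<bar> \<le>
      expectation (\<lambda>\<omega>. ?d n \<omega> * cutoff R (W n \<omega>)) + 2 * B * (1 - expectation (\<lambda>\<omega>. cutoff R (W n \<omega>)))" for n R
  proof -
    have i: "integrable M (\<lambda>\<omega>. h (Y n \<omega>))" "integrable M (\<lambda>\<omega>. h (W n \<omega>))"
      using B by (auto intro!: integrable_const_bound[of _ B])
    have "\<bar>expectation (\<lambda>\<omega>. h (Y n \<omega>)) - expectation (\<lambda>\<omega>. h (W n \<omega>))\<bar> = \<bar>expectation (\<lambda>\<omega>. h (Y n \<omega>) - h (W n \<omega>))\<bar>"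
      using i by simp
    also have "\<dots> \<le> expectation (\<lambda>\<omega>. ?d n \<omega> * cutoff R (W n \<omega>) + 2 * B * (1 - cutoff R (W n \<omega>)))"
    proof (rule integral_abs_bound[THEN order_trans], rule integral_mono)
      fix \<omega>
      have "?d n \<omega> * (1 - cutoff R (W n \<omega>)) \<le> 2 * B * (1 - cutoff R (W n \<omega>))"
        using d2[of n \<omega>] cutoff_bounds[of R "W n \<omega>"] by (intro mult_right_mono) auto
      then show "?d n \<omega> \<le> ?d n \<omega> * cutoff R (W n \<omega>) + 2 * B * (1 - cutoff R (W n \<omega>))"
        by (simp add: algebra_simps)
    qed (use i di ci in auto)
    also have "\<dots> = expectation (\<lambda>\<omega>. ?d n \<omega> * cutoff R (W n \<omega>)) + 2 * B * (1 - expectation (\<lambda>\<omega>. cutoff R (W n \<omega>)))"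
      using di ci by (simp add: prob_space)
    finally show ?thesis .
  qed
  show "(\<lambda>n. \<integral>x. h x \<partial>distr M borel (Y n)) \<longlonglongrightarrow> (\<integral>x. h x \<partial>\<nu>)"
  proof (rule tendstoI)
    fix e :: real assume "0 < e"
    obtain R where R: "R > 0" "1 - e / (8 * B) < (\<integral>x. cutoff R x \<partial>\<nu>)"
      using prob_space.expectation_cutoff_near_1[OF \<nu>, of "\<lambda>x. x" "e / (8 * B)"] B \<open>0 < e\<close> by auto
    have "\<forall>\<^sub>F n in sequentially. 1 - e / (8 * B) < expectation (\<lambda>\<omega>. cutoff R (W n \<omega>))"
      using Wt[OF test_function_cutoff[of R]] R(2) by (rule order_tendstoD)
    moreover have "\<forall>\<^sub>F n in sequentially. expectation (\<lambda>\<omega>. ?d n \<omega> * cutoff R (W n \<omega>)) < e / 4"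
      using z[OF R(1)] \<open>0 < e\<close> by (intro order_tendstoD) auto
    moreover have "\<forall>\<^sub>F n in sequentially. dist (expectation (\<lambda>\<omega>. h (W n \<omega>))) (\<integral>x. h x \<partial>\<nu>) < e / 2"
      using Wt[OF h] \<open>0 < e\<close> by (intro tendstoD) auto
    ultimately show "\<forall>\<^sub>F n in sequentially. dist (\<integral>x. h x \<partial>distr M borel (Y n)) (\<integral>x. h x \<partial>\<nu>) < e"
    proof eventually_elim
      case (elim n)
      have "2 * B * (1 - expectation (\<lambda>\<omega>. cutoff R (W n \<omega>))) < 2 * B * (e / (8 * B))"
        using elim B by (intro mult_strict_left_mono) auto
      also have "\<dots> = e / 4" using B by simp
      finally have "\<bar>expectation (\<lambda>\<omega>. h (Y n \<omega>)) - expectation (\<lambda>\<omega>. h (W n \<omega>))\<bar> < e / 2"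
        using bound[of n R] elim by linarith
      moreover have "(\<integral>x. h x \<partial>distr M borel (Y n)) = expectation (\<lambda>\<omega>. h (Y n \<omega>))"
        by (simp add: integral_distr)
      ultimately show ?case using elim unfolding dist_real_def by linarith
    qed
  qed
qed (use \<nu> in \<open>auto intro: prob_space_distr\<close>)

lemma exp_norm_eq_std_normal_density:
  "exp (- (norm (z :: real^'k))\<^sup>2 / 2) = sqrt (2 * pi) ^ CARD('k) * (\<Prod>i\<in>UNIV. std_normal_density (z $ i))"
proof -
  have "(norm z)\<^sup>2 = (\<Sum>i\<in>UNIV. (z $ i)\<^sup>2)"
    by (simp add: norm_vec_def L2_set_def sum_nonneg)
  then have "exp (- (norm z)\<^sup>2 / 2) = (\<Prod>i\<in>UNIV. exp (- (z $ i)\<^sup>2 / 2))"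
    by (simp add: exp_sum[symmetric] sum_negf sum_divide_distrib)
  moreover have "(\<Prod>i\<in>UNIV. std_normal_density (z $ i)) = (1 / sqrt (2 * pi)) ^ CARD('k) * (\<Prod>i\<in>UNIV. exp (- (z $ i)\<^sup>2 / 2))"
    by (simp add: std_normal_density_def prod.distrib prod_dividef power_one_over)
  ultimately show ?thesis by (simp add: power_divide)
qed

text \<open>The substitution \<open>y = x + \<epsilon> z\<close>; the factor in front is the reciprocal of the normalising constant
of the density.\<close>

lemma gaussian_smoothing_eq:
  fixes h :: "real^'k \<Rightarrow> real"
  assumes [measurable]: "h \<in> borel_measurable borel" and "0 < \<epsilon>"
  shows "(\<integral>y. h y * exp (- (norm ((1 / \<epsilon>) *\<^sub>R (y - x)))\<^sup>2 / 2) \<partial>lborel) =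
    \<epsilon> ^ CARD('k) * sqrt (2 * pi) ^ CARD('k) * (\<integral>z. h (x + \<epsilon> *\<^sub>R z) \<partial>std_normal_vec)"
proof -
  let ?g = "\<lambda>y. h y * exp (- (norm ((1 / \<epsilon>) *\<^sub>R (y - x)))\<^sup>2 / 2)"
  have "(\<integral>y. ?g y \<partial>lborel) = (\<integral>y. ?g y \<partial>density (distr lborel borel (\<lambda>z. x + \<epsilon> *\<^sub>R z)) (\<lambda>_. ennreal (\<bar>\<epsilon>\<bar>^DIM(real^'k))))"
    using \<open>0 < \<epsilon>\<close> by (subst lborel_affine[of \<epsilon> x]) (auto simp: ennreal_power)
  also have "\<dots> = \<epsilon> ^ CARD('k) * (\<integral>z. ?g (x + \<epsilon> *\<^sub>R z) \<partial>lborel)"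
    using \<open>0 < \<epsilon>\<close> by (simp add: integral_density integral_distr)
  also have "(\<integral>z. ?g (x + \<epsilon> *\<^sub>R z) \<partial>lborel) =
      (\<integral>z. sqrt (2 * pi) ^ CARD('k) * ((\<Prod>i\<in>UNIV. std_normal_density (z $ i)) *\<^sub>R h (x + \<epsilon> *\<^sub>R z)) \<partial>lborel)"
  proof (intro Bochner_Integration.integral_cong refl)
    fix z
    have "(1 / \<epsilon>) *\<^sub>R (x + \<epsilon> *\<^sub>R z - x) = z" using \<open>0 < \<epsilon>\<close> by simp
    then show "?g (x + \<epsilon> *\<^sub>R z) = sqrt (2 * pi) ^ CARD('k) * ((\<Prod>i\<in>UNIV. std_normal_density (z $ i)) *\<^sub>R h (x + \<epsilon> *\<^sub>R z))"
      by (simp only: exp_norm_eq_std_normal_density) simp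
  qed
  also have "\<dots> = sqrt (2 * pi) ^ CARD('k) * (\<integral>z. h (x + \<epsilon> *\<^sub>R z) \<partial>std_normal_vec)"
    unfolding std_normal_vec_def by (subst integral_density) (auto simp: prod_nonneg)
  finally show ?thesis by simp
qed

lemma gaussian_smoothing_approx:
  fixes h :: "real^'k \<Rightarrow> real"
  assumes h: "test_function h" and "0 < e"
  shows "\<exists>\<epsilon>>0. \<forall>x. \<bar>(\<integral>z. h (x + \<epsilon> *\<^sub>R z) \<partial>std_normal_vec) - h x\<bar> \<le> e"
proof -
  interpret W: prob_space "std_normal_vec :: (real^'k) measure" by (rule prob_space_std_normal_vec)
  let ?W = "std_normal_vec :: (real^'k) measure"
  note [measurable] = test_function_measurable[OF h]
  obtain B where B: "0 < B" "\<And>x. \<bar>h x\<bar> \<le> B" using test_function_bounded[OF h] by blast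
  obtain d where d: "0 < d" "\<And>x y. dist x y < d \<Longrightarrow> \<bar>h x - h y\<bar> < e / 2"
    using test_function_uniform[OF h, of "e / 2"] \<open>0 < e\<close> by auto
  obtain R where R: "R > 0" "W.prob {x. R < norm x} < e / (4 * B)"
    using W.tail_small[of "\<lambda>x. x" "e / (4 * B)"] \<open>0 < e\<close> B by auto
  define \<epsilon> where "\<epsilon> = d / (R + 1)"
  have \<epsilon>: "\<epsilon> > 0" "\<epsilon> * R < d"
    using d R by (auto simp: \<epsilon>_def field_simps)
  have "\<bar>(\<integral>z. h (x + \<epsilon> *\<^sub>R z) \<partial>?W) - h x\<bar> \<le> e" for x
  proof -
    let ?A = "{z :: real^'k. R < norm z}"
    have i: "integrable ?W (\<lambda>z. h (x + \<epsilon> *\<^sub>R z))"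
      by (rule W.integrable_const_bound[of _ B]) (use B in auto)
    have iA: "integrable ?W (\<lambda>z. indicator ?A z :: real)"
      by (rule W.integrable_const_bound[of _ 1]) auto
    have "\<bar>(\<integral>z. h (x + \<epsilon> *\<^sub>R z) \<partial>?W) - h x\<bar> = \<bar>\<integral>z. h (x + \<epsilon> *\<^sub>R z) - h x \<partial>?W\<bar>"
      using i W.prob_space by (simp add: Bochner_Integration.integral_diff)
    also have "\<dots> \<le> (\<integral>z. e / 2 + 2 * B * indicator ?A z \<partial>?W)"
    proof (rule integral_abs_bound[THEN order_trans], rule integral_mono)
      fix z :: "real^'k"
      show "\<bar>h (x + \<epsilon> *\<^sub>R z) - h x\<bar> \<le> e / 2 + 2 * B * indicator ?A z"
      proof (cases "R < norm z")
        case True then show ?thesis using B(2)[of x] B(2)[of "x + \<epsilon> *\<^sub>R z"] \<open>0 < e\<close> by auto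
      next
        case False
        then have "\<epsilon> * norm z \<le> \<epsilon> * R" using \<epsilon> by (intro mult_left_mono) auto
        with \<epsilon>(2) have "\<epsilon> * norm z < d" by linarith
        then have "dist (x + \<epsilon> *\<^sub>R z) x < d" using \<epsilon>(1) by (simp add: dist_norm)
        from d(2)[OF this] False show ?thesis by simp
      qed
    qed (use i iA in auto)
    also have "\<dots> = e / 2 + 2 * B * W.prob ?A"
      using iA W.prob_space by simp
    also have "2 * B * W.prob ?A \<le> 2 * B * (e / (4 * B))"
      using B R by (intro mult_left_mono) auto
    also have "e / 2 + 2 * B * (e / (4 * B)) = e" using B by simp
    finally show ?thesis by simp
  qed
  with \<epsilon>(1) show ?thesis by blast
qed

text \<open>Levy's continuity theorem for a limit known to be a characteristic function. A test function is
uniformly close to its Gaussian smoothing at a fixed small scale, and the integrals of the smoothing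
converge.\<close>

theorem converges_weakly_vec_charI:
  fixes \<nu>s :: "nat \<Rightarrow> (real^'k) measure"
  assumes p: "\<And>n. prob_space (\<nu>s n)" "prob_space \<nu>"
    and s [measurable_cong, simp]: "\<And>n. sets (\<nu>s n) = sets borel" "sets \<nu> = sets borel"
    and conv: "\<And>t. (\<lambda>n. vec_char (\<nu>s n) t) \<longlonglongrightarrow> vec_char \<nu> t"
  shows "converges_weakly \<nu>s \<nu>"
proof (rule converges_weakly_testI[OF p s])
  fix h :: "real^'k \<Rightarrow> real" assume h: "test_function h"
  interpret W: prob_space "std_normal_vec :: (real^'k) measure" by (rule prob_space_std_normal_vec)
  let ?W = "std_normal_vec :: (real^'k) measure"
  note [measurable] = test_function_measurable[OF h]
  obtain B where B: "0 < B" "\<And>x. \<bar>h x\<bar> \<le> B" using test_function_bounded[OF h] by blast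
  show "(\<lambda>n. \<integral>x. h x \<partial>\<nu>s n) \<longlonglongrightarrow> (\<integral>x. h x \<partial>\<nu>)"
  proof (rule tendstoI)
    fix e :: real assume "0 < e"
    obtain \<epsilon> where \<epsilon>: "\<epsilon> > 0" "\<And>x. \<bar>(\<integral>z. h (x + \<epsilon> *\<^sub>R z) \<partial>?W) - h x\<bar> \<le> e / 3"
      using gaussian_smoothing_approx[OF h, of "e / 3"] \<open>0 < e\<close> by auto
    let ?h = "\<lambda>x. \<integral>z. h (x + \<epsilon> *\<^sub>R z) \<partial>?W"
    define c where "c = \<epsilon> ^ CARD('k) * sqrt (2 * pi) ^ CARD('k)"
    have "c > 0" using \<epsilon> by (simp add: c_def)
    have "(\<lambda>n. \<integral>x. c * ?h x \<partial>\<nu>s n) \<longlonglongrightarrow> (\<integral>x. c * ?h x \<partial>\<nu>)"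
      using smoothed_integral_converges[OF p s conv test_function_measurable[OF h] test_function_integrable[OF h] \<epsilon>(1)]
      by (simp only: gaussian_smoothing_eq[OF test_function_measurable[OF h] \<epsilon>(1)] c_def)
    then have sm: "(\<lambda>n. \<integral>x. ?h x \<partial>\<nu>s n) \<longlonglongrightarrow> (\<integral>x. ?h x \<partial>\<nu>)"
      using \<open>c > 0\<close> by simp
    have near: "\<bar>(\<integral>x. h x \<partial>\<rho>) - (\<integral>x. ?h x \<partial>\<rho>)\<bar> \<le> e / 3"
      if "prob_space \<rho>" and [measurable_cong, simp]: "sets \<rho> = sets borel" for \<rho>
    proof -
      interpret R: prob_space \<rho> by fact
      have "\<bar>?h x\<bar> \<le> B" for x
      proof -
        have "\<bar>?h x\<bar> \<le> (\<integral>z. B \<partial>?W)"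
          by (rule integral_abs_bound[THEN order_trans], rule integral_mono)
             (use B in \<open>auto intro!: W.integrable_const_bound[of _ B]\<close>)
        then show ?thesis using W.prob_space by simp
      qed
      moreover have "?h \<in> borel_measurable borel" by measurable
      ultimately have i: "integrable \<rho> ?h" by (intro R.integrable_const_bound[of _ B]) auto
      have i2: "integrable \<rho> h" by (intro R.integrable_const_bound[of _ B]) (use B in auto)
      have "\<bar>(\<integral>x. h x \<partial>\<rho>) - (\<integral>x. ?h x \<partial>\<rho>)\<bar> = \<bar>\<integral>x. h x - ?h x \<partial>\<rho>\<bar>"
        using i i2 by simp
      also have "\<dots> \<le> (\<integral>x. e / 3 \<partial>\<rho>)"
        using \<epsilon>(2) by (intro integral_abs_bound[THEN order_trans] integral_mono integrable_abs Bochner_Integration.integrable_diff i i2)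
          (auto simp: abs_minus_commute)
      finally show ?thesis using R.prob_space by simp
    qed
    from tendstoD[OF sm, of "e / 3"] \<open>0 < e\<close>
    have "\<forall>\<^sub>F n in sequentially. dist (\<integral>x. ?h x \<partial>\<nu>s n) (\<integral>x. ?h x \<partial>\<nu>) < e / 3" by simp
    then show "\<forall>\<^sub>F n in sequentially. dist (\<integral>x. h x \<partial>\<nu>s n) (\<integral>x. h x \<partial>\<nu>) < e"
    proof eventually_elim
      case (elim n)
      with near[OF p(1) s(1), of n] near[OF p(2) s(2)] show ?case
        unfolding dist_real_def by linarith
    qed
  qed
qed

text \<open>Otherwise the quadratic form at \<open>e\<^sub>j + c e\<^sub>i\<close> would be a nonconstant affine function of \<open>c\<close>.\<close>

lemma psd_diagonal_zero_row:
  fixes S :: "real^'k^'k"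
  assumes sym: "\<And>i j. S $ i $ j = S $ j $ i" and psd: "\<And>x. 0 \<le> x \<bullet> (S *v x)" and z: "S $ i $ i = 0"
  shows "S $ i $ j = 0"
proof (rule ccontr)
  assume nz: "S $ i $ j \<noteq> 0"
  have q: "(axis j 1 + c *\<^sub>R axis i 1) \<bullet> (S *v (axis j 1 + c *\<^sub>R axis i 1)) = S $ j $ j + 2 * c * S $ i $ j" for c
    by (simp add: matrix_vector_right_distrib matrix_vector_mult_scaleR matrix_vector_mul_component
        matrix_vector_mult_basis inner_add_left inner_add_right inner_axis' column_def z sym[of j i] algebra_simps)
  \<comment> \<open>For this \<open>c\<close> the affine function takes the value \<open>- 1\<close>.\<close>
  from psd[of "axis j 1 + (- (S $ j $ j + 1) / (2 * S $ i $ j)) *\<^sub>R axis i 1"] nz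
  show False unfolding q by (simp add: field_simps)
qed

text \<open>Cholesky factorisation by induction on the set of nonzero rows. Subtracting \<open>c c\<^sup>T\<close>, where \<open>c\<close> is
column \<open>m\<close> divided by the root of the pivot, clears row \<open>m\<close> and leaves the Schur complement, which is
positive semidefinite because its form at \<open>x\<close> is the original form at a suitable \<open>y\<close>. A vanishing
pivot means that the row already vanishes. The vanishing columns of \<open>L\<close> leave room for the column
\<open>c\<close> in the next step.\<close>

lemma psd_factorization_on:
  fixes S :: "real^'k^'k"
  assumes "finite I" and "\<And>i j. S $ i $ j = S $ j $ i" and "\<And>x. 0 \<le> x \<bullet> (S *v x)"
    and "\<And>i j. i \<notin> I \<Longrightarrow> S $ i $ j = 0"
  shows "\<exists>L :: real^'k^'k. L ** transpose L = S \<and> (\<forall>i j. j \<notin> I \<longrightarrow> L $ i $ j = 0)"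
  using assms
proof (induction I arbitrary: S rule: finite_induct)
  case empty
  then show ?case by (intro exI[of _ 0]) (auto simp: vec_eq_iff matrix_matrix_mult_def)
next
  case (insert m I S)
  note sym = insert.prems(1) and psd = insert.prems(2) and supp = insert.prems(3)
  show ?case
  proof (cases "S $ m $ m = 0")
    case True
    have "S $ i $ j = 0" if "i \<notin> I" for i j
      using psd_diagonal_zero_row[OF sym psd True, of j] supp[of i j] that by (cases "i = m") auto
    from insert.IH[OF sym psd this] show ?thesis by blast
  next
    case False
    define s where "s = S $ m $ m"
    have "0 \<le> s" using psd[of "axis m 1"]
      by (simp add: s_def matrix_vector_mult_basis inner_axis' column_def)
    with False have s: "0 < s" by (simp add: s_def)
    define c where "c = (\<chi> i. S $ i $ m / sqrt s)"
    define S' where "S' = (\<chi> i j. S $ i $ j - c $ i * c $ j)"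
    have cc: "c $ i * c $ j = S $ i $ m * S $ j $ m / s" for i j
      using s by (simp add: c_def)
    have "0 \<le> x \<bullet> (S' *v x)" for x
    proof -
      define b where "b = (\<Sum>i\<in>UNIV. x $ i * S $ i $ m)"
      \<comment> \<open>The point that minimises the form along the axis \<open>m\<close> through \<open>x\<close>.\<close>
      define y where "y = x - (b / s) *\<^sub>R axis m 1"
      have Sx: "(S *v x) $ m = b"
        by (simp add: b_def matrix_vector_mult_def sym[of m] mult.commute)
      have xS: "x \<bullet> (S *v axis m 1) = b"
        by (simp add: b_def matrix_vector_mult_basis column_def inner_vec_def)
      have "y \<bullet> (S *v y) = x \<bullet> (S *v x) - b * b / s"
        using s by (simp add: y_def matrix_vector_right_distrib matrix_vector_mult_diff_distrib matrix_vector_mult_scaleR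
            inner_diff_left inner_diff_right inner_axis' Sx xS)
           (simp add: matrix_vector_mult_basis column_def s_def[symmetric] field_simps)
      moreover have "x \<bullet> (S' *v x) = x \<bullet> (S *v x) - b * b / s"
      proof -
        have "x \<bullet> (S' *v x) = (\<Sum>i\<in>UNIV. \<Sum>j\<in>UNIV. x $ i * S $ i $ j * x $ j - (x $ i * S $ i $ m) * (x $ j * S $ j $ m) / s)"
          by (simp add: inner_vec_def matrix_vector_mult_def S'_def cc sum_distrib_left algebra_simps)
        also have "\<dots> = (\<Sum>i\<in>UNIV. \<Sum>j\<in>UNIV. x $ i * S $ i $ j * x $ j) - b * b / s"
          by (simp add: sum_subtractf b_def sum_product sum_divide_distrib)
        also have "(\<Sum>i\<in>UNIV. \<Sum>j\<in>UNIV. x $ i * S $ i $ j * x $ j) = x \<bullet> (S *v x)"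
          by (simp add: inner_vec_def matrix_vector_mult_def sum_distrib_left algebra_simps)
        finally show ?thesis .
      qed
      ultimately show ?thesis using psd[of y] by simp
    qed
    moreover have "S' $ i $ j = S' $ j $ i" for i j
      by (simp add: S'_def sym[of i j] mult.commute)
    moreover have "S' $ i $ j = 0" if "i \<notin> I" for i j
    proof (cases "i = m")
      case True then show ?thesis using s by (simp add: S'_def cc s_def[symmetric] sym[of j m])
    next
      case False then show ?thesis using supp[of i] that by (simp add: S'_def cc)
    qed
    ultimately obtain L where L: "L ** transpose L = S'" "\<And>i j. j \<notin> I \<Longrightarrow> L $ i $ j = 0"
      using insert.IH[of S'] by blast
    define L' where "L' = (\<chi> i j. if j = m then c $ i else L $ i $ j)"
    have "(L' ** transpose L') $ i $ j = S $ i $ j" for i j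
    proof -
      have "(L' ** transpose L') $ i $ j = (\<Sum>k\<in>UNIV. L' $ i $ k * L' $ j $ k)"
        by (simp add: matrix_matrix_mult_def transpose_def)
      also have "\<dots> = c $ i * c $ j + (\<Sum>k\<in>UNIV - {m}. L $ i $ k * L $ j $ k)"
        by (subst sum.remove[of _ m]) (auto simp: L'_def intro!: sum.cong)
      also have "(\<Sum>k\<in>UNIV - {m}. L $ i $ k * L $ j $ k) = (\<Sum>k\<in>UNIV. L $ i $ k * L $ j $ k)"
        using L(2)[OF insert.hyps(2)] by (subst (2) sum.remove[of _ m]) auto
      also have "\<dots> = S' $ i $ j"
        using L(1) by (simp add: matrix_matrix_mult_def transpose_def vec_eq_iff)
      finally show ?thesis by (simp add: S'_def)
    qed
    then have "L' ** transpose L' = S" by (simp add: vec_eq_iff)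
    moreover have "L' $ i $ j = 0" if "j \<notin> insert m I" for i j
      using that L(2) by (simp add: L'_def)
    ultimately show ?thesis by blast
  qed
qed

lemma psd_factorization:
  fixes S :: "real^'k^'k"
  assumes "\<And>i j. S $ i $ j = S $ j $ i" and "\<And>x. 0 \<le> x \<bullet> (S *v x)"
  shows "\<exists>L :: real^'k^'k. L ** transpose L = S"
  using psd_factorization_on[of UNIV S] assms by auto

section \<open>The central limit theorem in several dimensions\<close>

lemma borel_measurable_vec_nth_comp [measurable (raw)]:
  fixes f :: "'a \<Rightarrow> real^'k"
  assumes "f \<in> borel_measurable M"
  shows "(\<lambda>x. f x $ i) \<in> borel_measurable M"
  using borel_measurable_inner[OF assms borel_measurable_const[of "axis i 1"]] by (simp add: inner_axis)

lemma integrable_vec_nth: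
  fixes f :: "'a \<Rightarrow> real^'k"
  assumes "integrable M f"
  shows "integrable M (\<lambda>x. f x $ i)"
  using integrable_inner_left[of "axis i 1" M f] assms by (simp add: inner_axis)

lemma vec_char_normal:
  fixes L :: "real^'k^'k"
  shows "vec_char (distr std_normal_vec borel (\<lambda>z. 0 + L *v z)) t = exp (- (t \<bullet> ((L ** transpose L) *v t)) / 2)"
proof -
  have [measurable]: "(\<lambda>z. L *v z) \<in> borel_measurable borel"
    by (intro borel_measurable_continuous_onI linear_continuous_on matrix_vector_mul_bounded_linear)
  have "vec_char (distr std_normal_vec borel (\<lambda>z. 0 + L *v z)) t = vec_char std_normal_vec (transpose L *v t)"
    by (simp add: vec_char_def integral_distr dot_lmul_matrix[symmetric] transpose_matrix_vector)
  also have "\<dots> = exp (- (norm (transpose L *v t))\<^sup>2 / 2)"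
    by (rule vec_char_std_normal)
  also have "(norm (transpose L *v t))\<^sup>2 = t \<bullet> ((L ** transpose L) *v t)"
    by (simp add: power2_norm_eq_inner dot_lmul_matrix[symmetric] transpose_matrix_vector
        matrix_vector_mul_assoc[symmetric] inner_commute)
  finally show ?thesis by simp
qed

lemma (in prob_space)
  fixes X :: "'a \<Rightarrow> real^'k"
  assumes [measurable]: "random_variable borel X" and sq: "integrable M (\<lambda>\<omega>. (norm (X \<omega>))\<^sup>2)"
  shows integrable_of_square_norm: "integrable M X"
    and integrable_component_product: "\<And>i j. integrable M (\<lambda>\<omega>. X \<omega> $ i * X \<omega> $ j)"
proof -
  have "integrable M (\<lambda>\<omega>. norm (X \<omega>))"
    by (rule square_integrable_imp_integrable[OF _ sq]) simp
  then show "integrable M X" by (subst (asm) integrable_norm_iff) auto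
  fix i j
  show "integrable M (\<lambda>\<omega>. X \<omega> $ i * X \<omega> $ j)"
  proof (rule Bochner_Integration.integrable_bound[OF sq])
    have "\<bar>X \<omega> $ i\<bar> * \<bar>X \<omega> $ j\<bar> \<le> norm (X \<omega>) * norm (X \<omega>)" for \<omega>
      by (intro mult_mono component_le_norm_cart) auto
    then show "AE \<omega> in M. norm (X \<omega> $ i * X \<omega> $ j) \<le> norm ((norm (X \<omega>))\<^sup>2)"
      by (simp add: abs_mult power2_eq_square)
  qed simp
qed

lemma (in prob_space) covariance_centered:
  fixes X :: "'a \<Rightarrow> real^'k"
  assumes [measurable]: "random_variable borel X" and sq: "integrable M (\<lambda>\<omega>. (norm (X \<omega>))\<^sup>2)"
    and mean: "\<And>i. expectation (\<lambda>\<omega>. X \<omega> $ i) = 0"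
  shows covariance_centered_entry: "covariance_matrix M X $ i $ j = expectation (\<lambda>\<omega>. X \<omega> $ i * X \<omega> $ j)"
    and covariance_quadratic_form: "t \<bullet> (covariance_matrix M X *v t) = expectation (\<lambda>\<omega>. (t \<bullet> X \<omega>)\<^sup>2)"
proof -
  show e: "covariance_matrix M X $ i $ j = expectation (\<lambda>\<omega>. X \<omega> $ i * X \<omega> $ j)" for i j
    by (simp add: covariance_matrix_def mean)
  note i = integrable_component_product[OF assms(1) sq]
  have "t \<bullet> (covariance_matrix M X *v t) =
      (\<Sum>i\<in>UNIV. \<Sum>j\<in>UNIV. t $ i * t $ j * expectation (\<lambda>\<omega>. X \<omega> $ i * X \<omega> $ j))"
    by (simp add: inner_vec_def matrix_vector_mult_def e sum_distrib_left algebra_simps)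
  also have "\<dots> = expectation (\<lambda>\<omega>. \<Sum>i\<in>UNIV. \<Sum>j\<in>UNIV. t $ i * t $ j * (X \<omega> $ i * X \<omega> $ j))"
    using i by simp
  also have "(\<lambda>\<omega>. \<Sum>i\<in>UNIV. \<Sum>j\<in>UNIV. t $ i * t $ j * (X \<omega> $ i * X \<omega> $ j)) = (\<lambda>\<omega>. (t \<bullet> X \<omega>)\<^sup>2)"
    by (auto simp: inner_vec_def power2_eq_square sum_product algebra_simps)
  finally show "t \<bullet> (covariance_matrix M X *v t) = expectation (\<lambda>\<omega>. (t \<bullet> X \<omega>)\<^sup>2)" .
qed

text \<open>The Cramer--Wold device: the characteristic function at \<open>t\<close> is that of the scalar normalised sums
of \<open>t \<bullet> X\<^sub>i\<close>, to which the scalar theorem applies. If \<open>t \<bullet> X\<^sub>i\<close> has variance zero it vanishes almost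
surely, and the characteristic function is constant.\<close>

theorem (in prob_space) multivariate_central_limit_theorem:
  fixes X :: "nat \<Rightarrow> 'a \<Rightarrow> real^'k"
  assumes ind: "indep_vars (\<lambda>_. borel) X UNIV"
    and law: "\<And>i. distr M borel (X i) = distr M borel (X 0)"
    and sq: "integrable M (\<lambda>\<omega>. (norm (X 0 \<omega>))\<^sup>2)"
    and mean: "\<And>j. expectation (\<lambda>\<omega>. X 0 \<omega> $ j) = 0"
  shows "\<exists>\<nu>. normal_law 0 (covariance_matrix M (X 0)) \<nu> \<and> prob_space \<nu> \<and> sets \<nu> = sets borel \<and>
    converges_weakly (\<lambda>n. distr M borel (\<lambda>\<omega>. (1 / sqrt n) *\<^sub>R (\<Sum>i<n. X i \<omega>))) \<nu>"
proof -
  interpret W: prob_space "std_normal_vec :: (real^'k) measure" by (rule prob_space_std_normal_vec)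
  have X [measurable]: "random_variable borel (X i)" for i
    using ind unfolding indep_vars_def2 by simp
  let ?S = "covariance_matrix M (X 0)"
  note quad = covariance_quadratic_form[OF X sq mean]
  have "?S $ i $ j = ?S $ j $ i" for i j
    by (simp add: covariance_centered_entry[OF X sq mean] mult.commute)
  moreover have "0 \<le> t \<bullet> (?S *v t)" for t
    unfolding quad by (rule Bochner_Integration.integral_nonneg) simp
  ultimately obtain L :: "real^'k^'k" where L: "L ** transpose L = ?S"
    using psd_factorization[of ?S] by blast
  have [measurable]: "(\<lambda>z. L *v z) \<in> borel_measurable borel"
    by (intro borel_measurable_continuous_onI linear_continuous_on matrix_vector_mul_bounded_linear)
  define \<nu> where "\<nu> = distr std_normal_vec borel (\<lambda>z. 0 + L *v z)"
  have p\<nu>: "prob_space \<nu>" unfolding \<nu>_def by (rule W.prob_space_distr) simp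
  let ?U = "\<lambda>n \<omega>. (1 / sqrt (real n)) *\<^sub>R (\<Sum>i<n. X i \<omega>)"
  have "converges_weakly (\<lambda>n. distr M borel (?U n)) \<nu>"
  proof (rule converges_weakly_vec_charI)
    fix t :: "real^'k"
    define \<sigma> where "\<sigma> = sqrt (t \<bullet> (?S *v t))"
    have \<sigma>2: "\<sigma>\<^sup>2 = expectation (\<lambda>\<omega>. (t \<bullet> X 0 \<omega>)\<^sup>2)" and "0 \<le> \<sigma>"
      unfolding \<sigma>_def quad[symmetric] using \<open>\<And>t. 0 \<le> t \<bullet> (?S *v t)\<close>[of t] by auto
    let ?Y = "\<lambda>i \<omega>. t \<bullet> X i \<omega>"
    have Ylaw: "distr M borel (?Y i) = distr (distr M borel (X i)) borel (\<lambda>x. t \<bullet> x)" for i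
      by (subst distr_distr) (auto simp: comp_def)
    have Yd: "distr M borel (?Y i) = distr M borel (?Y 0)" for i
      using Ylaw[of i] Ylaw[of 0] law[of i] by simp
    have Ysq0: "integrable M (\<lambda>\<omega>. (?Y 0 \<omega>)\<^sup>2)"
    proof (rule Bochner_Integration.integrable_bound)
      show "integrable M (\<lambda>\<omega>. (norm t)\<^sup>2 * (norm (X 0 \<omega>))\<^sup>2)" using sq by simp
      show "AE \<omega> in M. norm ((?Y 0 \<omega>)\<^sup>2) \<le> norm ((norm t)\<^sup>2 * (norm (X 0 \<omega>))\<^sup>2)"
      proof (rule AE_I2)
        fix \<omega>
        have "\<bar>?Y 0 \<omega>\<bar>\<^sup>2 \<le> (norm t * norm (X 0 \<omega>))\<^sup>2"
          by (intro power_mono Cauchy_Schwarz_ineq2) auto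
        then show "norm ((?Y 0 \<omega>)\<^sup>2) \<le> norm ((norm t)\<^sup>2 * (norm (X 0 \<omega>))\<^sup>2)"
          by (simp add: power_mult_distrib)
      qed
    qed simp
    have tr: "integrable M (\<lambda>\<omega>. k (?Y i \<omega>)) \<longleftrightarrow> integrable M (\<lambda>\<omega>. k (?Y 0 \<omega>))"
      "expectation (\<lambda>\<omega>. k (?Y i \<omega>)) = expectation (\<lambda>\<omega>. k (?Y 0 \<omega>))"
      if [measurable]: "k \<in> borel_measurable borel" for k :: "real \<Rightarrow> real" and i
    proof -
      have "integrable (distr M borel (?Y i)) k \<longleftrightarrow> integrable M (\<lambda>\<omega>. k (?Y i \<omega>))"
        "integral\<^sup>L (distr M borel (?Y i)) k = expectation (\<lambda>\<omega>. k (?Y i \<omega>))" for i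
        by (auto intro!: integrable_distr_eq integral_distr)
      then show "integrable M (\<lambda>\<omega>. k (?Y i \<omega>)) \<longleftrightarrow> integrable M (\<lambda>\<omega>. k (?Y 0 \<omega>))"
        "expectation (\<lambda>\<omega>. k (?Y i \<omega>)) = expectation (\<lambda>\<omega>. k (?Y 0 \<omega>))"
        using Yd[of i] by metis+
    qed
    have Ysq: "integrable M (\<lambda>\<omega>. (?Y i \<omega>)\<^sup>2)" for i
      using tr(1)[of "\<lambda>u. u\<^sup>2" i] Ysq0 by simp
    have Y0: "expectation (?Y i) = 0" for i
    proof -
      have "expectation (?Y 0) = expectation (\<lambda>\<omega>. \<Sum>j\<in>UNIV. t $ j * X 0 \<omega> $ j)"
        by (simp add: inner_vec_def)
      also have "\<dots> = (\<Sum>j\<in>UNIV. t $ j * expectation (\<lambda>\<omega>. X 0 \<omega> $ j))"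
        using integrable_vec_nth[OF integrable_of_square_norm[OF X sq]]
        by (subst Bochner_Integration.integral_sum) auto
      finally have "expectation (?Y 0) = 0" by (simp add: mean)
      then show ?thesis using tr(2)[of "\<lambda>u. u" i] by simp
    qed
    have Yvar: "variance (?Y i) = \<sigma>\<^sup>2" for i
      using tr(2)[of "\<lambda>u. u\<^sup>2" i] by (simp add: Y0 \<sigma>2)
    have indY: "indep_vars (\<lambda>_. borel) ?Y UNIV"
      using indep_vars_compose2[OF ind, where Y="\<lambda>_ x. t \<bullet> x" and N="\<lambda>_. borel"] by simp
    let ?V = "\<lambda>n \<omega>. (\<Sum>i<n. ?Y i \<omega>) / sqrt (real n)"
    have c: "vec_char (distr M borel (?U n)) t = char (distr M borel (?V n)) 1" for n
      by (simp add: vec_char_def char_def integral_distr inner_sum_right)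
    have "(\<lambda>n. char (distr M borel (?V n)) 1) \<longlonglongrightarrow> exp (- \<sigma>\<^sup>2 / 2)"
    proof (cases "\<sigma> = 0")
      case True
      then have "expectation (\<lambda>\<omega>. (?Y 0 \<omega>)\<^sup>2) = 0" using \<sigma>2 by simp
      then have "expectation (\<lambda>\<omega>. (?Y i \<omega>)\<^sup>2) = 0" for i using tr(2)[of "\<lambda>u. u\<^sup>2" i] by simp
      then have "AE \<omega> in M. ?Y i \<omega> = 0" for i
        using integral_nonneg_eq_0_iff_AE[OF Ysq[of i]] by simp
      then have "AE \<omega> in M. \<forall>i. ?Y i \<omega> = 0" by (simp add: AE_all_countable)
      then have "AE \<omega> in M. iexp (1 * ?V n \<omega>) = 1" for n
        by eventually_elim simp
      then have "(CLINT \<omega>|M. iexp (1 * ?V n \<omega>)) = (CLINT \<omega>|M. 1)" for n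
        by (intro integral_cong_AE) auto
      then have "char (distr M borel (?V n)) 1 = (CLINT \<omega>|M. 1)" for n
        unfolding char_def by (subst integral_distr) simp_all
      then show ?thesis using True prob_space by simp
    next
      case False
      with \<open>0 \<le> \<sigma>\<close> have "0 < \<sigma>" by simp
      have "weak_conv_m (\<lambda>n. distr M borel (\<lambda>\<omega>. (\<Sum>i<n. ?Y i \<omega>) / sqrt (real n * \<sigma>\<^sup>2))) std_normal_distribution"
        by (rule central_limit_theorem_zero_mean[OF indY Y0 \<open>0 < \<sigma>\<close> Ysq Yvar Yd])
      then have "(\<lambda>n. char (distr M borel (\<lambda>\<omega>. (\<Sum>i<n. ?Y i \<omega>) / sqrt (real n * \<sigma>\<^sup>2))) \<sigma>) \<longlonglongrightarrow> char std_normal_distribution \<sigma>"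
        by (intro levy_continuity1) (auto intro!: real_distribution_distr real_dist_normal_dist)
      moreover have "char (distr M borel (\<lambda>\<omega>. (\<Sum>i<n. ?Y i \<omega>) / sqrt (real n * \<sigma>\<^sup>2))) \<sigma> = char (distr M borel (?V n)) 1" for n
        using \<open>0 < \<sigma>\<close> by (simp add: char_def integral_distr real_sqrt_mult)
      ultimately show ?thesis by (simp add: char_std_normal_distribution)
    qed
    moreover have "vec_char \<nu> t = exp (- \<sigma>\<^sup>2 / 2)"
      unfolding \<nu>_def vec_char_normal L using \<sigma>2 quad[of t] by simp
    ultimately show "(\<lambda>n. vec_char (distr M borel (?U n)) t) \<longlonglongrightarrow> vec_char \<nu> t"
      unfolding c by simp
  qed (use p\<nu> in \<open>auto simp: \<nu>_def intro: prob_space_distr\<close>)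
  then show ?thesis using L p\<nu> unfolding normal_law_def \<nu>_def by (intro exI[of _ \<nu>]) (auto simp: \<nu>_def)
qed

section \<open>Convex M-estimation\<close>

lemma (in prob_space) indep_vars_reindex:
  assumes ind: "indep_vars N X (f ` I)" and inj: "inj_on f I"
  shows "indep_vars (\<lambda>i. N (f i)) (\<lambda>i. X (f i)) I"
  unfolding indep_vars_def2
proof (intro conjI ballI indep_setsI)
  have rv: "\<And>i. i \<in> I \<Longrightarrow> random_variable (N (f i)) (X (f i))"
    and ids: "indep_sets (\<lambda>i. {X i -` A \<inter> space M |A. A \<in> sets (N i)}) (f ` I)"
    using ind unfolding indep_vars_def2 by auto
  then show "\<And>i. i \<in> I \<Longrightarrow> random_variable (N (f i)) (X (f i))" by blast
  show "{X (f i) -` A \<inter> space M |A. A \<in> sets (N (f i))} \<subseteq> events" if "i \<in> I" for i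
    using rv[OF that] by (auto intro: measurable_sets)
  fix A J assume J: "J \<noteq> {}" "J \<subseteq> I" "finite J" and A: "\<forall>j\<in>J. A j \<in> {X (f j) -` A \<inter> space M |A. A \<in> sets (N (f j))}"
  define g where "g = the_inv_into I f"
  have g: "g (f j) = j" if "j \<in> I" for j
    unfolding g_def by (rule the_inv_into_f_f[OF inj that])
  have injJ: "inj_on f J" using inj J(2) by (rule inj_on_subset)
  have "prob (\<Inter>k\<in>f ` J. A (g k)) = (\<Prod>k\<in>f ` J. prob (A (g k)))"
    by (rule indep_setsD[OF ids]) (use J A in \<open>auto simp: g subset_iff\<close>)
  also have "(\<Inter>k\<in>f ` J. A (g k)) = (\<Inter>j\<in>J. A j)"
    unfolding image_image using J(2) g by (intro INF_cong) auto
  also have "(\<Prod>k\<in>f ` J. prob (A (g k))) = (\<Prod>j\<in>J. prob (A j))"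
    using J(2) g by (subst prod.reindex[OF injJ]) (auto intro!: prod.cong simp: subset_iff)
  finally show "prob (\<Inter>j\<in>J. A j) = (\<Prod>j\<in>J. prob (A j))" .
qed

text \<open>Derivatives below are read off from expansions with quadratic remainder, since such expansions
survive both averaging over a sample and integration.\<close>

lemma has_derivative_quadratic_error:
  fixes f :: "'a::real_normed_vector \<Rightarrow> 'b::real_normed_vector"
  assumes L: "bounded_linear L" and "0 < e"
    and q: "\<And>y. dist x y < e \<Longrightarrow> norm (f y - f x - L (y - x)) \<le> C * (norm (y - x))\<^sup>2"
  shows "(f has_derivative L) (at x)"
  unfolding has_derivative_at2
proof (intro conjI L)
  have "((\<lambda>y. C * norm (y - x)) \<longlongrightarrow> C * norm (x - x)) (at x)" by (intro tendsto_intros)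
  then have "((\<lambda>y. C * norm (y - x)) \<longlongrightarrow> 0) (at x)" by simp
  then show "((\<lambda>y. (1 / norm (y - x)) *\<^sub>R (f y - (f x + L (y - x)))) \<longlongrightarrow> 0) (at x)"
  proof (rule Lim_null_comparison[rotated])
    have "\<forall>\<^sub>F y in at x. dist y x < e" using \<open>0 < e\<close> by (auto simp: eventually_at)
    moreover have "\<forall>\<^sub>F y in at x. y \<noteq> x" by (simp add: eventually_at_filter)
    ultimately show "\<forall>\<^sub>F y in at x. norm ((1 / norm (y - x)) *\<^sub>R (f y - (f x + L (y - x)))) \<le> C * norm (y - x)"
    proof eventually_elim
      case (elim y)
      then have "norm (f y - f x - L (y - x)) \<le> C * (norm (y - x))\<^sup>2" by (intro q) (simp add: dist_commute)
      with elim show ?case by (simp add: divide_le_eq power2_eq_square diff_diff_eq mult.assoc)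
    qed
  qed
qed

lemma norm_matrix_vector_le:
  fixes A :: "real^'n^'m"
  shows "norm (A *v x) \<le> CARD('m) * norm A * norm x"
proof -
  have "norm (A *v x) \<le> (\<Sum>i\<in>UNIV. \<bar>(A *v x) $ i\<bar>)" by (rule norm_le_l1_cart)
  also have "\<dots> \<le> (\<Sum>i\<in>(UNIV::'m set). norm A * norm x)"
  proof (rule sum_mono)
    fix i
    have "\<bar>(A *v x) $ i\<bar> \<le> norm (A $ i) * norm x"
      unfolding matrix_vector_mul_component by (rule Cauchy_Schwarz_ineq2)
    also have "\<dots> \<le> norm A * norm x" by (intro mult_right_mono Finite_Cartesian_Product.norm_nth_le) auto
    finally show "\<bar>(A *v x) $ i\<bar> \<le> norm A * norm x" .
  qed
  finally show ?thesis by simp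
qed

lemma bounded_linear_matrix_vector_left: "bounded_linear (\<lambda>A :: real^'n^'m. A *v x)"
  unfolding linear_conv_bounded_linear[symmetric]
  by (rule linearI) (simp_all add: matrix_vector_mult_add_rdistrib scaleR_matrix_vector_assoc)

text \<open>\<open>P\<close> is the law of one observation and \<open>F z\<close> the loss caused by the observation \<open>z\<close>; \<open>DF\<close> and \<open>HF\<close> stand
for its gradient near the minimiser \<open>x0\<close> of the expected loss and for its Hessian at \<open>x0\<close>. They enter
only through the expansions, and one integrable \<open>K\<close> controls all remainders.\<close>

locale convex_m_estimation = prob_space M for M :: "'a measure" +
  fixes S P :: "'z measure" and Z :: "nat \<Rightarrow> 'a \<Rightarrow> 'z"
    and F :: "'z \<Rightarrow> real^'k \<Rightarrow> real" and D :: "(real^'k) set" and x0 :: "real^'k" and r :: real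
    and DF :: "'z \<Rightarrow> real^'k \<Rightarrow> real^'k" and HF :: "'z \<Rightarrow> real^'k^'k" and K :: "'z \<Rightarrow> real"
  assumes Z_indep: "indep_vars (\<lambda>_. S) Z {1..}"
    and Z_law: "\<And>j. 1 \<le> j \<Longrightarrow> distr M S (Z j) = P"
    and D: "convex D" and r: "0 < r" "cball x0 r \<subseteq> D"
    and F_integrable: "\<And>x. x \<in> cball x0 r \<Longrightarrow> integrable P (\<lambda>z. F z x)"
    and DF_integrable: "\<And>x. x \<in> cball x0 r \<Longrightarrow> integrable P (\<lambda>z. DF z x)"
    and HF_integrable: "integrable P HF"
    and K_integrable: "integrable P K"
    and F_lipschitz: "\<And>z x y. z \<in> space P \<Longrightarrow> x \<in> cball x0 r \<Longrightarrow> y \<in> cball x0 r \<Longrightarrow>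
      \<bar>F z y - F z x\<bar> \<le> K z * norm (y - x)"
    and F_expansion: "\<And>z x y. z \<in> space P \<Longrightarrow> x \<in> cball x0 r \<Longrightarrow> y \<in> cball x0 r \<Longrightarrow>
      \<bar>F z y - F z x - DF z x \<bullet> (y - x)\<bar> \<le> K z * (norm (y - x))\<^sup>2"
    and DF_expansion: "\<And>z y. z \<in> space P \<Longrightarrow> y \<in> cball x0 r \<Longrightarrow>
      norm (DF z y - DF z x0 - HF z *v (y - x0)) \<le> K z * (norm (y - x0))\<^sup>2"
    and F_convex: "\<And>z. z \<in> space P \<Longrightarrow> convex_on D (F z)"
    and F_strict: "\<exists>A\<in>sets P. measure P A > 0 \<and>
      (\<forall>z\<in>A. \<forall>x\<in>D. \<forall>y\<in>D. x \<noteq> y \<longrightarrow> F z ((1/2) *\<^sub>R (x + y)) < (F z x + F z y) / 2)"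
    and x0_minimal: "\<And>x. x \<in> D \<Longrightarrow> x \<noteq> x0 \<Longrightarrow> (\<integral>z. F z x0 \<partial>P) < (\<integral>z. F z x \<partial>P)"
begin

definition mean_F :: "nat \<Rightarrow> 'a \<Rightarrow> real^'k \<Rightarrow> real" where
  "mean_F n \<omega> x = 1 / real n * (\<Sum>j=1..n. F (Z j \<omega>) x)"

definition limit_F :: "real^'k \<Rightarrow> real" where
  "limit_F x = (\<integral>z. F z x \<partial>P)"

lemma Z_measurable [measurable]: "1 \<le> j \<Longrightarrow> Z j \<in> measurable M S"
  using Z_indep unfolding indep_vars_def2 by auto

lemma sets_P [measurable_cong, simp]: "sets P = sets S" and space_P: "space P = space S"
  using arg_cong[OF Z_law[of 1], of sets] arg_cong[OF Z_law[of 1], of space] by simp_all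

lemma P_prob: "prob_space P"
  using prob_space_distr[of "Z 1" S] Z_law[of 1] by simp

lemma Z_space: "1 \<le> j \<Longrightarrow> \<omega> \<in> space M \<Longrightarrow> Z j \<omega> \<in> space P"
  using measurable_space[OF Z_measurable] by (simp add: space_P)

lemma shifted_iid:
  assumes [measurable]: "\<phi> \<in> measurable S N"
  shows "indep_vars (\<lambda>_. N) (\<lambda>i \<omega>. \<phi> (Z (Suc i) \<omega>)) UNIV"
    and "distr M N (\<lambda>\<omega>. \<phi> (Z (Suc i) \<omega>)) = distr P N \<phi>"
proof -
  have "{1..} = range Suc" by (auto simp: image_iff) (metis Suc_le_D)
  then have "indep_vars (\<lambda>_. S) Z (range Suc)" using Z_indep by (simp only:)
  from indep_vars_reindex[OF this inj_Suc]
  have "indep_vars (\<lambda>_. S) (\<lambda>i. Z (Suc i)) UNIV" .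
  from indep_vars_compose2[OF this, where Y="\<lambda>_. \<phi>" and N="\<lambda>_. N"]
  show "indep_vars (\<lambda>_. N) (\<lambda>i \<omega>. \<phi> (Z (Suc i) \<omega>)) UNIV" using assms by blast
  have "distr M N (\<lambda>\<omega>. \<phi> (Z (Suc i) \<omega>)) = distr (distr M S (Z (Suc i))) N \<phi>"
    using distr_distr[OF assms Z_measurable[of "Suc i"]] by (simp add: comp_def)
  also have "distr M S (Z (Suc i)) = P" by (rule Z_law) simp
  finally show "distr M N (\<lambda>\<omega>. \<phi> (Z (Suc i) \<omega>)) = distr P N \<phi>" .
qed

lemma sample_mean_converges_real:
  fixes \<phi> :: "'z \<Rightarrow> real"
  assumes int: "integrable P \<phi>"
  shows "AE \<omega> in M. (\<lambda>n. 1 / real n * (\<Sum>j=1..n. \<phi> (Z j \<omega>))) \<longlonglongrightarrow> (\<integral>z. \<phi> z \<partial>P)"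
proof -
  have [measurable]: "\<phi> \<in> borel_measurable S" using borel_measurable_integrable[OF int] by simp
  let ?X = "\<lambda>i \<omega>. \<phi> (Z (Suc i) \<omega>)"
  have law: "distr M borel (?X i) = distr P borel \<phi>" for i by (rule shifted_iid) simp
  have "integrable (distr M borel (?X 0)) (\<lambda>x. x)"
    unfolding law using int by (subst integrable_distr_eq) auto
  then have i0: "integrable M (?X 0)" by (subst (asm) integrable_distr_eq) auto
  have "distr M borel (?X i) = distr M borel (?X 0)" for i unfolding law ..
  from strong_law_of_large_numbers[OF shifted_iid(1) this i0]
  have lln: "AE \<omega> in M. (\<lambda>n. (\<Sum>i<n. ?X i \<omega>) / n) \<longlonglongrightarrow> expectation (?X 0)"
    by simp
  have mean: "expectation (?X 0) = (\<integral>z. \<phi> z \<partial>P)"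
  proof -
    have "expectation (?X 0) = (\<integral>x. x \<partial>distr M borel (?X 0))" by (subst integral_distr) auto
    also have "\<dots> = (\<integral>z. \<phi> z \<partial>P)" unfolding law by (subst integral_distr) auto
    finally show ?thesis .
  qed
  have sums: "(\<lambda>n. (\<Sum>i<n. ?X i \<omega>) / n) = (\<lambda>n. 1 / real n * (\<Sum>j=1..n. \<phi> (Z j \<omega>)))" for \<omega>
    by (simp add: sum.atLeast1_atMost_eq)
  from lln show ?thesis unfolding sums mean .
qed

lemma sample_mean_converges:
  fixes \<phi> :: "'z \<Rightarrow> 'b::euclidean_space"
  assumes int: "integrable P \<phi>"
  shows "AE \<omega> in M. (\<lambda>n. (1 / real n) *\<^sub>R (\<Sum>j=1..n. \<phi> (Z j \<omega>))) \<longlonglongrightarrow> (\<integral>z. \<phi> z \<partial>P)"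
proof -
  have 1: "integrable P (\<lambda>z. \<phi> z \<bullet> b)" for b by (rule integrable_inner_left[OF int])
  have 2: "AE \<omega> in M. (\<lambda>n. 1 / real n * (\<Sum>j=1..n. \<phi> (Z j \<omega>) \<bullet> b)) \<longlonglongrightarrow> (\<integral>z. \<phi> z \<bullet> b \<partial>P)" for b 
      using sample_mean_converges_real[OF 1] .
  have 3: "AE \<omega> in M. \<forall>b\<in>Basis. (\<lambda>n. 1 / real n * (\<Sum>j=1..n. \<phi> (Z j \<omega>) \<bullet> b)) \<longlonglongrightarrow> (\<integral>z. \<phi> z \<bullet> b \<partial>P)"
    using AE_finite_allI[OF finite_Basis 2] .
  from 3 show ?thesis
  proof eventually_elim
    case (elim \<omega>)
    have "(\<lambda>n. ((1 / real n) *\<^sub>R (\<Sum>j=1..n. \<phi> (Z j \<omega>))) \<bullet> b) \<longlonglongrightarrow> (\<integral>z. \<phi> z \<partial>P) \<bullet> b" if "b \<in> Basis" for b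
      using elim[rule_format, OF that] unfolding inner_scaleR_left inner_sum_left integral_inner_left[OF int] .
    then show ?case by (subst tendsto_componentwise_iff) blast
  qed
qed

abbreviation mean_K :: "nat \<Rightarrow> 'a \<Rightarrow> real" where
  "mean_K n \<omega> \<equiv> 1 / real n * (\<Sum>j=1..n. K (Z j \<omega>))"

abbreviation limit_K :: real where
  "limit_K \<equiv> \<integral>z. K z \<partial>P"

lemma mean_F_lipschitz:
  assumes "\<omega> \<in> space M" "x \<in> cball x0 r" "y \<in> cball x0 r"
  shows "\<bar>mean_F n \<omega> y - mean_F n \<omega> x\<bar> \<le> mean_K n \<omega> * norm (y - x)"
proof -
  have "\<bar>\<Sum>j=1..n. F (Z j \<omega>) y - F (Z j \<omega>) x\<bar> \<le> (\<Sum>j=1..n. K (Z j \<omega>) * norm (y - x))"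
    by (rule order_trans[OF sum_abs], rule sum_mono) (use assms in \<open>auto intro!: F_lipschitz Z_space\<close>)
  moreover have "mean_F n \<omega> y - mean_F n \<omega> x = 1 / real n * (\<Sum>j=1..n. F (Z j \<omega>) y - F (Z j \<omega>) x)"
    by (simp only: mean_F_def sum_subtractf right_diff_distrib)
  moreover have "mean_K n \<omega> * norm (y - x) = 1 / real n * (\<Sum>j=1..n. K (Z j \<omega>) * norm (y - x))"
    by (simp only: sum_distrib_right mult.assoc)
  moreover have "\<bar>1 / real n * u\<bar> = 1 / real n * \<bar>u\<bar>" for u :: real
    by (simp add: abs_mult)
  ultimately show ?thesis
    by (simp only:) (rule mult_left_mono, simp_all)
qed

lemma limit_F_lipschitz:
  assumes "x \<in> cball x0 r" "y \<in> cball x0 r"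
  shows "\<bar>limit_F y - limit_F x\<bar> \<le> limit_K * norm (y - x)"
proof -
  have "limit_F y - limit_F x = (\<integral>z. F z y - F z x \<partial>P)"
    unfolding limit_F_def using F_integrable assms by simp
  also have "\<bar>\<dots>\<bar> \<le> (\<integral>z. K z * norm (y - x) \<partial>P)"
    by (rule order_trans[OF integral_abs_bound], rule integral_mono)
      (use assms F_integrable K_integrable F_lipschitz in auto)
  finally show ?thesis using K_integrable by simp
qed

text \<open>The expected loss attains on the sphere a minimum larger than its value at \<open>x0\<close>; let \<open>4 \<eta>\<close> be the
gap. The strong law on a finite net of the sphere and the Lipschitz constants, whose means converge,
transfer the gap to the empirical means with a loss of less than \<open>4 \<eta>\<close>.\<close>

lemma mean_F_exceeds_on_sphere:
  assumes e: "0 < e" "e \<le> r"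
  shows "AE \<omega> in M. \<forall>\<^sub>F n in sequentially. \<forall>x\<in>sphere x0 e. mean_F n \<omega> x0 < mean_F n \<omega> x"
proof (cases "sphere x0 e = {}")
  case False
  have sub: "sphere x0 e \<subseteq> cball x0 r" using e by auto
  have x0: "x0 \<in> cball x0 r" using r by auto
  have K0: "0 \<le> \<bar>limit_K\<bar> + 1" by simp
  have "continuous_on (sphere x0 e) limit_F"
  proof (rule lipschitz_on_continuous_on[OF lipschitz_onI[OF _ K0]])
    fix x y assume "x \<in> sphere x0 e" "y \<in> sphere x0 e"
    with sub have "\<bar>limit_F x - limit_F y\<bar> \<le> limit_K * norm (x - y)" by (intro limit_F_lipschitz) auto
    also have "\<dots> \<le> (\<bar>limit_K\<bar> + 1) * norm (x - y)" by (intro mult_right_mono) auto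
    finally show "dist (limit_F x) (limit_F y) \<le> (\<bar>limit_K\<bar> + 1) * dist x y" by (simp add: dist_norm)
  qed
  then obtain s where s: "s \<in> sphere x0 e" "\<And>x. x \<in> sphere x0 e \<Longrightarrow> limit_F s \<le> limit_F x"
    using continuous_attains_inf[OF compact_sphere False] by blast
  define \<eta> where "\<eta> = (limit_F s - limit_F x0) / 4"
  have "s \<noteq> x0" "s \<in> D" using s(1) e sub r(2) by auto
  then have "0 < \<eta>" using x0_minimal[of s] by (simp add: \<eta>_def limit_F_def)
  define \<kappa> where "\<kappa> = \<bar>limit_K\<bar> + 1"
  have "limit_K < \<kappa>" "0 < \<kappa>" by (auto simp: \<kappa>_def)
  obtain T where T: "finite T" "T \<subseteq> sphere x0 e" "sphere x0 e \<subseteq> (\<Union>t\<in>T. ball t (\<eta> / \<kappa>))"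
  proof -
    have "seq_compact (sphere x0 e)" by (intro compact_imp_seq_compact) simp
    from seq_compact_imp_totally_bounded[OF this] \<open>0 < \<eta>\<close> \<open>0 < \<kappa>\<close>
    have "\<exists>T. finite T \<and> T \<subseteq> sphere x0 e \<and> sphere x0 e \<subseteq> (\<Union>t\<in>T. ball t (\<eta> / \<kappa>))" by simp
    then show ?thesis using that by blast
  qed
  have lln: "AE \<omega> in M. (\<lambda>n. mean_F n \<omega> t) \<longlonglongrightarrow> limit_F t" if "t \<in> cball x0 r" for t
    unfolding mean_F_def limit_F_def by (rule sample_mean_converges_real[OF F_integrable[OF that]])
  have "AE \<omega> in M. \<forall>t\<in>T. (\<lambda>n. mean_F n \<omega> t) \<longlonglongrightarrow> limit_F t"
    using T sub by (intro AE_finite_allI) (auto intro: lln)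
  moreover note lln[OF x0]
  moreover have "AE \<omega> in M. (\<lambda>n. mean_K n \<omega>) \<longlonglongrightarrow> limit_K"
    by (rule sample_mean_converges_real[OF K_integrable])
  moreover have "AE \<omega> in M. \<omega> \<in> space M" by simp
  ultimately show ?thesis
  proof eventually_elim
    case (elim \<omega>)
    have "\<forall>\<^sub>F n in sequentially. \<forall>t\<in>T. dist (mean_F n \<omega> t) (limit_F t) < \<eta>"
      using elim(1) \<open>0 < \<eta>\<close> T(1) by (intro eventually_ball_finite ballI tendstoD) auto
    moreover have "\<forall>\<^sub>F n in sequentially. dist (mean_F n \<omega> x0) (limit_F x0) < \<eta>"
      using elim(2) \<open>0 < \<eta>\<close> by (rule tendstoD)
    moreover have "\<forall>\<^sub>F n in sequentially. mean_K n \<omega> < \<kappa>"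
      using elim(3) \<open>limit_K < \<kappa>\<close> by (rule order_tendstoD)
    ultimately show ?case
    proof eventually_elim
      case (elim n)
      show ?case
      proof
        fix x assume x: "x \<in> sphere x0 e"
        then obtain t where t: "t \<in> T" "dist t x < \<eta> / \<kappa>" using T(3) by auto
        have "\<bar>mean_F n \<omega> x - mean_F n \<omega> t\<bar> \<le> mean_K n \<omega> * norm (x - t)"
          using x t(1) T(2) sub \<open>\<omega> \<in> space M\<close> by (intro mean_F_lipschitz) auto
        also have "\<dots> \<le> \<kappa> * norm (x - t)" using elim(3) by (intro mult_right_mono) auto
        also have "\<dots> \<le> \<kappa> * (\<eta> / \<kappa>)" using t(2) \<open>0 < \<kappa>\<close> by (intro mult_left_mono) (auto simp: dist_norm norm_minus_commute)
        also have "\<dots> = \<eta>" using \<open>0 < \<kappa>\<close> by simp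
        finally have "\<bar>mean_F n \<omega> x - mean_F n \<omega> t\<bar> \<le> \<eta>" .
        moreover have "\<bar>mean_F n \<omega> t - limit_F t\<bar> < \<eta>" using elim(1) t(1) by (simp add: dist_real_def)
        moreover have "limit_F s \<le> limit_F t" using s(2) t(1) T(2) by auto
        moreover have "limit_F s = limit_F x0 + 4 * \<eta>" by (simp add: \<eta>_def field_simps)
        moreover have "\<bar>mean_F n \<omega> x0 - limit_F x0\<bar> < \<eta>" using elim(2) by (simp add: dist_real_def)
        ultimately show "mean_F n \<omega> x0 < mean_F n \<omega> x" using \<open>0 < \<eta>\<close> by linarith
      qed
    qed
  qed
qed simp


lemma mean_F_convex: "\<omega> \<in> space M \<Longrightarrow> convex_on D (mean_F n \<omega>)"
proof -
  assume \<omega>: "\<omega> \<in> space M"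
  have "convex_on D (\<lambda>x. \<Sum>j\<in>J. F (Z j \<omega>) x)" if "finite J" "J \<subseteq> {1..}" for J
    using that
  proof (induction J rule: finite_induct)
    case (insert j J)
    then have "convex_on D (F (Z j \<omega>))" using \<omega> by (intro F_convex Z_space) auto
    with insert show ?case by (simp add: convex_on_add)
  qed (simp add: D convex_on_const)
  from this[of "{1..n}"] show "convex_on D (mean_F n \<omega>)"
    unfolding mean_F_def by (intro convex_on_cmul) auto
qed

text \<open>By the strong law applied to an indicator, the sample eventually contains an observation whose
loss is strictly convex, and one such summand makes the sum strictly convex.\<close>

lemma strict_sample_eventually:
  "AE \<omega> in M. \<forall>\<^sub>F n in sequentially. \<forall>x\<in>D. \<forall>y\<in>D. x \<noteq> y \<longrightarrow>
     mean_F n \<omega> ((1/2) *\<^sub>R (x + y)) < (mean_F n \<omega> x + mean_F n \<omega> y) / 2"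
proof -
  interpret PP: prob_space P by (rule P_prob)
  obtain A where A: "A \<in> sets P" "measure P A > 0"
    and strict: "\<And>z x y. z \<in> A \<Longrightarrow> x \<in> D \<Longrightarrow> y \<in> D \<Longrightarrow> x \<noteq> y \<Longrightarrow>
      F z ((1/2) *\<^sub>R (x + y)) < (F z x + F z y) / 2"
    using F_strict by blast
  have "integrable P (indicator A :: 'z \<Rightarrow> real)"
    using A(1) by (simp add: integrable_indicator_iff PP.emeasure_eq_measure)
  from sample_mean_converges_real[OF this]
  have "AE \<omega> in M. (\<lambda>n. 1 / real n * (\<Sum>j=1..n. indicator A (Z j \<omega>))) \<longlonglongrightarrow> measure P A"
    using A(1) by simp
  moreover have "AE \<omega> in M. \<omega> \<in> space M" by simp
  ultimately show ?thesis
  proof eventually_elim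
    case (elim \<omega>)
    have "\<forall>\<^sub>F n in sequentially. 0 < 1 / real n * (\<Sum>j=1..n. indicator A (Z j \<omega>) :: real)"
      using elim(1) A(2) by (rule order_tendstoD)
    then show ?case
    proof eventually_elim
      case (elim n)
      then have n: "0 < n" by (cases n) auto
      from elim have "(\<Sum>j=1..n. indicator A (Z j \<omega>) :: real) \<noteq> 0" by auto
      then obtain j where "j \<in> {1..n}" "indicator A (Z j \<omega>) \<noteq> (0::real)"
        by (rule sum.not_neutral_contains_not_neutral)
      then have j: "j \<in> {1..n}" "Z j \<omega> \<in> A" by (auto simp: indicator_def split: if_splits)
      show ?case
      proof (intro ballI impI)
        fix x y assume xy: "x \<in> D" "y \<in> D" "x \<noteq> y"
        have "(\<Sum>j=1..n. F (Z j \<omega>) ((1/2) *\<^sub>R (x + y))) < (\<Sum>j=1..n. (F (Z j \<omega>) x + F (Z j \<omega>) y) / 2)"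
        proof (rule sum_strict_mono_ex1)
          show "\<forall>i\<in>{1..n}. F (Z i \<omega>) ((1/2) *\<^sub>R (x + y)) \<le> (F (Z i \<omega>) x + F (Z i \<omega>) y) / 2"
          proof
            fix i assume "i \<in> {1..n}"
            then have "convex_on D (F (Z i \<omega>))" using \<open>\<omega> \<in> space M\<close> by (intro F_convex Z_space) auto
            from convex_onD[OF this, of "1/2" x y] xy
            show "F (Z i \<omega>) ((1/2) *\<^sub>R (x + y)) \<le> (F (Z i \<omega>) x + F (Z i \<omega>) y) / 2"
              by (simp add: scaleR_add_right)
          qed
          show "\<exists>i\<in>{1..n}. F (Z i \<omega>) ((1/2) *\<^sub>R (x + y)) < (F (Z i \<omega>) x + F (Z i \<omega>) y) / 2"
            using strict[OF j(2) xy] j(1) by blast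
        qed simp
        then have "1 / real n * (\<Sum>j=1..n. F (Z j \<omega>) ((1/2) *\<^sub>R (x + y))) < 1 / real n * (\<Sum>j=1..n. (F (Z j \<omega>) x + F (Z j \<omega>) y) / 2)"
          using n by (intro mult_strict_left_mono) auto
        also have "\<dots> = (mean_F n \<omega> x + mean_F n \<omega> y) / 2"
          by (simp add: mean_F_def sum.distrib sum_divide_distrib[symmetric] add_divide_distrib)
        finally show "mean_F n \<omega> ((1/2) *\<^sub>R (x + y)) < (mean_F n \<omega> x + mean_F n \<omega> y) / 2"
          by (simp only: mean_F_def)
      qed
    qed
  qed
qed

text \<open>A continuous function has a minimum on the closed ball. Outside the ball a convex function that is
larger on the sphere than at the centre is larger still, so this minimum is global; it is unique
once the empirical mean is strictly convex.\<close>

theorem minimizer_consistent: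
  "AE \<omega> in M. \<forall>e>0. \<forall>\<^sub>F n in sequentially. \<exists>x. unique_minimizer (mean_F n \<omega>) D x \<and> norm (x - x0) < e"
proof -
  have "AE \<omega> in M. \<forall>m. \<forall>\<^sub>F n in sequentially. \<forall>x\<in>sphere x0 (r / Suc m). mean_F n \<omega> x0 < mean_F n \<omega> x"
    unfolding AE_all_countable using r(1) by (intro allI mean_F_exceeds_on_sphere) (auto simp: divide_le_eq)
  moreover note strict_sample_eventually
  moreover have "AE \<omega> in M. \<omega> \<in> space M" by simp
  ultimately show ?thesis
  proof eventually_elim
    case (elim \<omega>)
    note \<omega> = \<open>\<omega> \<in> space M\<close>
    show ?case
    proof (intro allI impI)
      fix e :: real assume "0 < e"
      obtain m where m: "r / Suc m < e"
      proof -
        obtain m :: nat where "r / e < real m" using reals_Archimedean2 by blast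
        then have "r < e * real (Suc m)" using \<open>0 < e\<close> by (simp add: field_simps)
        then show ?thesis using that[of m] by (simp add: divide_less_eq)
      qed
      define s where "s = r / Suc m"
      have s: "0 < s" "s \<le> r" "s < e" using r(1) m by (auto simp: s_def divide_le_eq)
      have ball: "cball x0 s \<subseteq> cball x0 r" using s by auto
      have x0: "x0 \<in> cball x0 s" "x0 \<in> D" using s r by auto
      from elim(1)[rule_format, of m] elim(2)
      show "\<forall>\<^sub>F n in sequentially. \<exists>x. unique_minimizer (mean_F n \<omega>) D x \<and> norm (x - x0) < e"
      proof eventually_elim
        case (elim n)
        let ?f = "mean_F n \<omega>"
        have K0: "0 \<le> \<bar>mean_K n \<omega>\<bar>" by simp
        have "continuous_on (cball x0 s) ?f"
        proof (rule lipschitz_on_continuous_on[OF lipschitz_onI[OF _ K0]])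
          fix x y assume "x \<in> cball x0 s" "y \<in> cball x0 s"
          with ball have "\<bar>?f x - ?f y\<bar> \<le> mean_K n \<omega> * norm (x - y)" by (intro mean_F_lipschitz[OF \<omega>]) auto
          also have "\<dots> \<le> \<bar>mean_K n \<omega>\<bar> * norm (x - y)" by (intro mult_right_mono abs_ge_self norm_ge_zero)
          finally show "dist (?f x) (?f y) \<le> \<bar>mean_K n \<omega>\<bar> * dist x y" by (simp add: dist_norm)
        qed
        then obtain x1 where x1: "x1 \<in> cball x0 s" "\<And>x. x \<in> cball x0 s \<Longrightarrow> ?f x1 \<le> ?f x"
          using continuous_attains_inf[OF compact_cball, of x0 s ?f] x0 by blast
        have min: "?f x1 \<le> ?f y" if y: "y \<in> D" for y
        proof (cases "y \<in> cball x0 s")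
          case False
          \<comment> \<open>The segment from \<open>x0\<close> to \<open>y\<close> crosses the sphere at \<open>p\<close>.\<close>
          define t where "t = s / norm (y - x0)"
          have far: "s < norm (y - x0)" using False by (simp add: dist_norm norm_minus_commute)
          with s(1) have "0 < norm (y - x0)" by linarith
          with far s(1) have t: "0 < t" "t < 1" by (auto simp: t_def divide_less_eq)
          define p where "p = (1 - t) *\<^sub>R x0 + t *\<^sub>R y"
          have "p - x0 = t *\<^sub>R (y - x0)" by (simp add: p_def algebra_simps)
          then have "norm (p - x0) = s" using \<open>0 < norm (y - x0)\<close> t s by (simp add: t_def) 
          then have "?f x0 < ?f p" using elim(1) by (simp add: s_def dist_norm norm_minus_commute)
          also have "?f p \<le> (1 - t) * ?f x0 + t * ?f y"
            unfolding p_def using t x0 y by (intro convex_onD[OF mean_F_convex[OF \<omega>]]) auto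
          finally have "t * ?f x0 < t * ?f y" by (simp add: algebra_simps)
          then have "?f x0 < ?f y" using t by simp
          with x1(2)[OF x0(1)] show ?thesis by simp
        qed (rule x1)
        have x1D: "x1 \<in> D" using x1(1) ball r(2) by auto
        have "unique_minimizer ?f D x1"
          unfolding unique_minimizer_def is_arg_min_def
        proof (intro conjI allI impI)
          show "\<nexists>y. y \<in> D \<and> ?f y < ?f x1" using min by (auto simp: not_less)
          fix y assume y: "y \<in> D \<and> (\<nexists>y'. y' \<in> D \<and> ?f y' < ?f y)"
          show "y = x1"
          proof (rule ccontr)
            assume "y \<noteq> x1"
            with elim(2) y x1D have "?f ((1/2) *\<^sub>R (x1 + y)) < (?f x1 + ?f y) / 2" by auto
            moreover have "(1/2) *\<^sub>R (x1 + y) \<in> D"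
              using convexD[OF D x1D, of y "1/2" "1/2"] y by (simp add: scaleR_add_right)
            ultimately show False using min[of "(1/2) *\<^sub>R (x1 + y)"] y x1D by (auto simp: not_less)
          qed
        qed (rule x1D)
        moreover have "norm (x1 - x0) < e" using x1(1) s by (simp add: dist_norm norm_minus_commute)
        ultimately show ?case by blast
      qed
    qed
  qed
qed

end

lemma gradient_eqI:
  assumes "(f has_derivative (\<lambda>d. g \<bullet> d)) (at x)"
  shows "gradient f x = g"
proof -
  have "frechet_derivative f (at x) = (\<lambda>d. g \<bullet> d)"
    using frechet_derivative_at[OF assms] by simp
  then show ?thesis by (simp add: gradient_def vec_eq_iff inner_axis)
qed

lemma hessian_eqI:
  fixes H :: "real^'k^'k"
  assumes "(gradient f has_derivative (\<lambda>d. H *v d)) (at x)"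
  shows "hessian f x = H"
proof -
  have "frechet_derivative (gradient f) (at x) = (\<lambda>d. H *v d)"
    using frechet_derivative_at[OF assms] by simp
  then show ?thesis by (simp add: hessian_def jacobian_def matrix_of_matrix_vector_mul)
qed

lemma matrix_inv_inverse:
  assumes "invertible A"
  shows "A ** matrix_inv A = mat 1" "matrix_inv A ** A = mat 1"
  using someI_ex[OF assms[unfolded invertible_def]] unfolding matrix_inv_def by auto

context convex_m_estimation
begin

definition mean_DF :: "nat \<Rightarrow> 'a \<Rightarrow> real^'k \<Rightarrow> real^'k" where
  "mean_DF n \<omega> x = (1 / real n) *\<^sub>R (\<Sum>j=1..n. DF (Z j \<omega>) x)"

definition mean_HF :: "nat \<Rightarrow> 'a \<Rightarrow> real^'k^'k" where
  "mean_HF n \<omega> = (1 / real n) *\<^sub>R (\<Sum>j=1..n. HF (Z j \<omega>))"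

definition limit_DF :: "real^'k \<Rightarrow> real^'k" where
  "limit_DF x = (\<integral>z. DF z x \<partial>P)"

definition limit_HF :: "real^'k^'k" where
  "limit_HF = (\<integral>z. HF z \<partial>P)"

lemma mean_F_expansion:
  assumes "\<omega> \<in> space M" "x \<in> cball x0 r" "y \<in> cball x0 r"
  shows "\<bar>mean_F n \<omega> y - mean_F n \<omega> x - mean_DF n \<omega> x \<bullet> (y - x)\<bar> \<le> mean_K n \<omega> * (norm (y - x))\<^sup>2"
proof -
  have "\<bar>\<Sum>j=1..n. F (Z j \<omega>) y - F (Z j \<omega>) x - DF (Z j \<omega>) x \<bullet> (y - x)\<bar> \<le> (\<Sum>j=1..n. K (Z j \<omega>) * (norm (y - x))\<^sup>2)"
    by (rule order_trans[OF sum_abs], rule sum_mono) (use assms in \<open>auto intro!: F_expansion Z_space\<close>)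
  moreover have "mean_F n \<omega> y - mean_F n \<omega> x - mean_DF n \<omega> x \<bullet> (y - x) =
      1 / real n * (\<Sum>j=1..n. F (Z j \<omega>) y - F (Z j \<omega>) x - DF (Z j \<omega>) x \<bullet> (y - x))"
    by (simp only: mean_F_def mean_DF_def sum_subtractf right_diff_distrib inner_scaleR_left inner_sum_left)
  moreover have "mean_K n \<omega> * (norm (y - x))\<^sup>2 = 1 / real n * (\<Sum>j=1..n. K (Z j \<omega>) * (norm (y - x))\<^sup>2)"
    by (simp only: sum_distrib_right mult.assoc)
  moreover have "\<bar>1 / real n * u\<bar> = 1 / real n * \<bar>u\<bar>" for u :: real
    by (simp add: abs_mult)
  ultimately show ?thesis
    by (simp only:) (rule mult_left_mono, simp_all)
qed

lemma mean_DF_expansion: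
  assumes "\<omega> \<in> space M" "y \<in> cball x0 r"
  shows "norm (mean_DF n \<omega> y - mean_DF n \<omega> x0 - mean_HF n \<omega> *v (y - x0)) \<le> mean_K n \<omega> * (norm (y - x0))\<^sup>2"
proof -
  interpret L: bounded_linear "\<lambda>A :: real^'k^'k. A *v (y - x0)" by (rule bounded_linear_matrix_vector_left)
  have "norm (\<Sum>j=1..n. DF (Z j \<omega>) y - DF (Z j \<omega>) x0 - HF (Z j \<omega>) *v (y - x0)) \<le> (\<Sum>j=1..n. K (Z j \<omega>) * (norm (y - x0))\<^sup>2)"
    by (rule sum_norm_le) (use assms in \<open>auto intro!: DF_expansion Z_space\<close>)
  moreover have "mean_DF n \<omega> y - mean_DF n \<omega> x0 - mean_HF n \<omega> *v (y - x0) =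
      (1 / real n) *\<^sub>R (\<Sum>j=1..n. DF (Z j \<omega>) y - DF (Z j \<omega>) x0 - HF (Z j \<omega>) *v (y - x0))"
    by (simp only: mean_HF_def mean_DF_def sum_subtractf scaleR_diff_right L.scaleR L.sum)
  moreover have "mean_K n \<omega> * (norm (y - x0))\<^sup>2 = 1 / real n * (\<Sum>j=1..n. K (Z j \<omega>) * (norm (y - x0))\<^sup>2)"
    by (simp only: sum_distrib_right mult.assoc)
  moreover have "norm ((1 / real n) *\<^sub>R u) = 1 / real n * norm u" for u :: "real^'k"
    by simp
  ultimately show ?thesis
    by (simp only:) (rule mult_left_mono, simp_all)
qed

lemma limit_F_expansion:
  assumes "x \<in> cball x0 r" "y \<in> cball x0 r"
  shows "\<bar>limit_F y - limit_F x - limit_DF x \<bullet> (y - x)\<bar> \<le> limit_K * (norm (y - x))\<^sup>2"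
proof -
  have i: "integrable P (\<lambda>z. DF z x \<bullet> (y - x))"
    by (rule integrable_inner_left) (rule DF_integrable[OF assms(1)])
  have "limit_F y - limit_F x - limit_DF x \<bullet> (y - x) = (\<integral>z. F z y - F z x - DF z x \<bullet> (y - x) \<partial>P)"
    unfolding limit_F_def limit_DF_def using F_integrable assms i DF_integrable by simp
  also have "\<bar>\<dots>\<bar> \<le> (\<integral>z. K z * (norm (y - x))\<^sup>2 \<partial>P)"
    by (rule order_trans[OF integral_abs_bound], rule integral_mono)
      (use assms F_integrable K_integrable F_expansion i in auto)
  finally show ?thesis using K_integrable by simp
qed

lemma limit_DF_expansion:
  assumes "y \<in> cball x0 r"
  shows "norm (limit_DF y - limit_DF x0 - limit_HF *v (y - x0)) \<le> limit_K * (norm (y - x0))\<^sup>2"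
proof -
  have x0: "x0 \<in> cball x0 r" using r by auto
  have L: "bounded_linear (\<lambda>A :: real^'k^'k. A *v (y - x0))" by (rule bounded_linear_matrix_vector_left)
  have i: "integrable P (\<lambda>z. HF z *v (y - x0))"
    by (rule integrable_bounded_linear[OF L HF_integrable])
  have "limit_DF y - limit_DF x0 - limit_HF *v (y - x0) = (\<integral>z. DF z y - DF z x0 - HF z *v (y - x0) \<partial>P)"
    unfolding limit_DF_def limit_HF_def integral_bounded_linear[OF L HF_integrable, symmetric]
    using assms i DF_integrable[OF x0] DF_integrable[OF assms] by simp
  also have "norm \<dots> \<le> (\<integral>z. norm (DF z y - DF z x0 - HF z *v (y - x0)) \<partial>P)"
    by (rule integral_norm_bound)
  also have "\<dots> \<le> (\<integral>z. K z * (norm (y - x0))\<^sup>2 \<partial>P)"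
    by (rule integral_mono)
      (use assms DF_integrable[OF x0] DF_integrable[OF assms] K_integrable DF_expansion i in auto)
  finally show ?thesis using K_integrable by simp
qed

lemma limit_F_has_derivative:
  assumes "x \<in> ball x0 r"
  shows "(limit_F has_derivative (\<lambda>d. limit_DF x \<bullet> d)) (at x)"
proof (rule has_derivative_quadratic_error[where e="r - dist x0 x" and C=limit_K])
  show "bounded_linear (\<lambda>d. limit_DF x \<bullet> d)" by (rule bounded_linear_inner_right)
  show "0 < r - dist x0 x" using assms by simp
  fix y assume "dist x y < r - dist x0 x"
  then have "y \<in> cball x0 r" "x \<in> cball x0 r" using dist_triangle[of x0 y x] zero_le_dist[of x y] by (auto simp del: zero_le_dist)
  then show "norm (limit_F y - limit_F x - limit_DF x \<bullet> (y - x)) \<le> limit_K * (norm (y - x))\<^sup>2"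
    using limit_F_expansion by simp
qed

lemma gradient_limit_F: "x \<in> ball x0 r \<Longrightarrow> gradient limit_F x = limit_DF x"
  by (rule gradient_eqI[OF limit_F_has_derivative])

lemma gradient_limit_F_has_derivative:
  "(gradient limit_F has_derivative (\<lambda>d. limit_HF *v d)) (at x0)"
proof (rule has_derivative_quadratic_error[where e=r and C=limit_K])
  show "bounded_linear ((*v) limit_HF)" by (rule matrix_vector_mul_bounded_linear)
  fix y assume "dist x0 y < r"
  then show "norm (gradient limit_F y - gradient limit_F x0 - limit_HF *v (y - x0)) \<le> limit_K * (norm (y - x0))\<^sup>2"
    using limit_DF_expansion[of y] r by (simp add: gradient_limit_F)
qed (rule r)

lemma limit_DF_zero: "limit_DF x0 = 0"
proof -
  have "(\<lambda>d. limit_DF x0 \<bullet> d) = (\<lambda>d. 0)"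
  proof (rule differential_zero_maxmin[OF _ open_ball limit_F_has_derivative])
    show "(\<forall>y\<in>ball x0 r. limit_F y \<le> limit_F x0) \<or> (\<forall>y\<in>ball x0 r. limit_F x0 \<le> limit_F y)"
      using x0_minimal r(2) unfolding limit_F_def by (intro disjI2 ballI) (metis ball_subset_cball in_mono less_imp_le order_refl)
  qed (use r in auto)
  then show ?thesis by (metis inner_eq_zero_iff)
qed

lemma mean_DF_zero_at_minimizer:
  assumes \<omega>: "\<omega> \<in> space M" and x: "x \<in> ball x0 r" and min: "unique_minimizer (mean_F n \<omega>) D x"
  shows "mean_DF n \<omega> x = 0"
proof -
  have "(mean_F n \<omega> has_derivative (\<lambda>d. mean_DF n \<omega> x \<bullet> d)) (at x)"
  proof (rule has_derivative_quadratic_error[where e="r - dist x0 x" and C="mean_K n \<omega>"])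
    show "bounded_linear (\<lambda>d. mean_DF n \<omega> x \<bullet> d)" by (rule bounded_linear_inner_right)
    show "0 < r - dist x0 x" using x by simp
    fix y assume "dist x y < r - dist x0 x"
    then have "y \<in> cball x0 r" "x \<in> cball x0 r" using dist_triangle[of x0 y x] zero_le_dist[of x y] by (auto simp del: zero_le_dist)
    then show "norm (mean_F n \<omega> y - mean_F n \<omega> x - mean_DF n \<omega> x \<bullet> (y - x)) \<le> mean_K n \<omega> * (norm (y - x))\<^sup>2"
      using mean_F_expansion[OF \<omega>, of x y n] by simp
  qed
  then have "(\<lambda>d. mean_DF n \<omega> x \<bullet> d) = (\<lambda>d. 0)"
  proof (rule differential_zero_maxmin[OF x open_ball])
    have "ball x0 r \<subseteq> D" using r(2) ball_subset_cball by blast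
    then show "(\<forall>y\<in>ball x0 r. mean_F n \<omega> y \<le> mean_F n \<omega> x) \<or> (\<forall>y\<in>ball x0 r. mean_F n \<omega> x \<le> mean_F n \<omega> y)"
      using min unfolding unique_minimizer_def is_arg_min_def by (auto simp: not_less)
  qed
  then show ?thesis by (metis inner_eq_zero_iff)
qed

text \<open>With \<open>h = est - x0\<close> and \<open>w = - H\<^sup>-\<^sup>1 DF\<^sub>n(x0)\<close>, the equation \<open>DF\<^sub>n(est) = 0\<close> and the expansion of \<open>DF\<^sub>n\<close>
give \<open>\<bar>h - w\<bar> \<le> E\<^sub>n \<bar>h\<bar>\<close>, where \<open>E\<^sub>n\<close> collects \<open>\<bar>HF\<^sub>n - H\<bar>\<close> and \<open>K\<^sub>n \<bar>h\<bar>\<close> and tends to zero by the strong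
law and consistency. Once \<open>E\<^sub>n \<le> 1/2\<close> this bounds \<open>h\<close> by \<open>2 w\<close>, so that the error is small relative to
\<open>w\<close>.\<close>

lemma minimizer_linearization:
  assumes inv: "invertible limit_HF"
    and est: "\<And>n \<omega> x. 1 \<le> n \<Longrightarrow> \<omega> \<in> space M \<Longrightarrow> unique_minimizer (mean_F n \<omega>) D x \<Longrightarrow> est n \<omega> = x"
  shows "AE \<omega> in M. \<forall>\<delta>>0. \<forall>\<^sub>F n in sequentially.
    norm ((est n \<omega> - x0) - - (matrix_inv limit_HF *v mean_DF n \<omega> x0)) \<le> \<delta> * norm (- (matrix_inv limit_HF *v mean_DF n \<omega> x0))"
proof -
  define H' where "H' = matrix_inv limit_HF"
  have H': "H' ** limit_HF = mat 1" unfolding H'_def using matrix_inv_inverse(2)[OF inv] .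
  define C where "C = CARD('k) * norm H'"
  have C: "0 \<le> C" "norm (H' *v x) \<le> C * norm x" for x
    using norm_matrix_vector_le[of H' x] by (auto simp: C_def)
  have "AE \<omega> in M. (\<lambda>n. mean_HF n \<omega>) \<longlonglongrightarrow> limit_HF"
    unfolding mean_HF_def limit_HF_def by (rule sample_mean_converges[OF HF_integrable])
  moreover have "AE \<omega> in M. (\<lambda>n. mean_K n \<omega>) \<longlonglongrightarrow> limit_K"
    by (rule sample_mean_converges_real[OF K_integrable])
  moreover note minimizer_consistent
  moreover have "AE \<omega> in M. \<omega> \<in> space M" by simp
  ultimately show ?thesis unfolding H'_def[symmetric]
  proof eventually_elim
    case (elim \<omega>)
    note \<omega> = \<open>\<omega> \<in> space M\<close>
    have close: "\<forall>\<^sub>F n in sequentially. unique_minimizer (mean_F n \<omega>) D (est n \<omega>) \<and> norm (est n \<omega> - x0) < e" if "0 < e" for e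
      using elim(3)[rule_format, OF that] eventually_ge_at_top[of 1]
      by eventually_elim (use est \<omega> in blast)
    have h0: "(\<lambda>n. est n \<omega> - x0) \<longlonglongrightarrow> 0"
    proof (rule tendstoI)
      fix e :: real assume "0 < e"
      from close[OF this] show "\<forall>\<^sub>F n in sequentially. dist (est n \<omega> - x0) 0 < e"
        by eventually_elim simp
    qed
    define E where "E n = C * (CARD('k) * norm (mean_HF n \<omega> - limit_HF) + mean_K n \<omega> * norm (est n \<omega> - x0))" for n
    have "(\<lambda>n. C * (CARD('k) * norm (mean_HF n \<omega> - limit_HF) + mean_K n \<omega> * norm (est n \<omega> - x0)))
        \<longlonglongrightarrow> C * (CARD('k) * norm (limit_HF - limit_HF) + limit_K * norm (0 :: real^'k))"
      using elim(1,2) h0 by (intro tendsto_intros)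
    then have E0: "E \<longlonglongrightarrow> 0" unfolding E_def by simp
    show ?case
    proof (intro allI impI)
      fix \<delta> :: real assume "0 < \<delta>"
      have "\<forall>\<^sub>F n in sequentially. E n < min (1/2) (\<delta> / 2)"
        using E0 \<open>0 < \<delta>\<close> by (intro order_tendstoD(2)) auto
      with close[OF r(1)]
      show "\<forall>\<^sub>F n in sequentially. norm ((est n \<omega> - x0) - - (H' *v mean_DF n \<omega> x0)) \<le> \<delta> * norm (- (H' *v mean_DF n \<omega> x0))"
      proof eventually_elim
        case (elim n)
        define h where "h = est n \<omega> - x0"
        define w where "w = - (H' *v mean_DF n \<omega> x0)"
        have eball: "est n \<omega> \<in> ball x0 r" using elim(1) by (simp add: dist_norm norm_minus_commute)
        then have ecball: "est n \<omega> \<in> cball x0 r" by simp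
        have "mean_DF n \<omega> (est n \<omega>) = 0"
          using mean_DF_zero_at_minimizer[OF \<omega> eball] elim(1) by blast
        with mean_DF_expansion[OF \<omega> ecball, of n]
        have 1: "norm (mean_DF n \<omega> x0 + mean_HF n \<omega> *v h) \<le> mean_K n \<omega> * (norm h)\<^sup>2"
          by (simp add: h_def norm_minus_commute) (metis add.commute norm_minus_cancel minus_add_distrib uminus_add_conv_diff)
        have "h = H' *v (limit_HF *v h)"
          by (simp add: matrix_vector_mul_assoc H')
        then have "h - w = H' *v (limit_HF *v h) + H' *v mean_DF n \<omega> x0" by (simp add: w_def)
        also have "\<dots> = H' *v ((mean_DF n \<omega> x0 + mean_HF n \<omega> *v h) - (mean_HF n \<omega> - limit_HF) *v h)"
          by (simp add: matrix_vector_right_distrib[symmetric] matrix_vector_mult_diff_rdistrib add.commute)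
        finally have "norm (h - w) \<le> C * norm ((mean_DF n \<omega> x0 + mean_HF n \<omega> *v h) - (mean_HF n \<omega> - limit_HF) *v h)"
          using C(2) by simp
        also have "\<dots> \<le> C * (mean_K n \<omega> * (norm h)\<^sup>2 + CARD('k) * norm (mean_HF n \<omega> - limit_HF) * norm h)"
          using 1 norm_matrix_vector_le[of "mean_HF n \<omega> - limit_HF" h] C(1)
          by (intro mult_left_mono order_trans[OF norm_triangle_ineq4] add_mono)
        also have "\<dots> = E n * norm h" by (simp add: E_def h_def power2_eq_square algebra_simps)
        finally have 2: "norm (h - w) \<le> E n * norm h" .
        also have "E n * norm h \<le> 1/2 * norm h" using elim(2) by (intro mult_right_mono) auto
        finally have "norm h \<le> 2 * norm w" using norm_triangle_ineq2[of h w] by linarith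
        have "E n * norm h \<le> \<delta> / 2 * norm h" using elim(2) by (intro mult_right_mono) auto
        also have "\<dots> \<le> \<delta> / 2 * (2 * norm w)" using \<open>norm h \<le> 2 * norm w\<close> \<open>0 < \<delta>\<close> by (intro mult_left_mono) auto
        finally have "norm (h - w) \<le> \<delta> * norm w" using 2 by simp
        then show ?case by (simp only: h_def w_def)
      qed
    qed
  qed
qed


text \<open>By the linearisation \<open>sqrt n (est - x0)\<close> differs relatively little from the normalised sum of the
centred vectors \<open>- H\<^sup>-\<^sup>1 DF(Z\<^sub>j, x0)\<close>, whose covariance matrix is
\<open>H\<^sup>-\<^sup>1 \<Sigma> H\<^sup>-\<^sup>1\<close> if \<open>\<Sigma>\<close> is that of \<open>DF(Z\<^sub>j, x0)\<close>, because \<open>H\<close> is symmetric.\<close>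

lemma minimizer_asymptotically_normal:
  assumes inv: "invertible limit_HF" and sym: "transpose limit_HF = limit_HF"
    and sq: "integrable P (\<lambda>z. (norm (DF z x0))\<^sup>2)"
    and est_meas: "\<And>n. 1 \<le> n \<Longrightarrow> est n \<in> borel_measurable M"
    and est: "\<And>n \<omega> x. 1 \<le> n \<Longrightarrow> \<omega> \<in> space M \<Longrightarrow> unique_minimizer (mean_F n \<omega>) D x \<Longrightarrow> est n \<omega> = x"
  shows "\<exists>\<nu>. normal_law 0 (matrix_inv limit_HF ** covariance_matrix P (\<lambda>z. DF z x0) ** matrix_inv limit_HF) \<nu> \<and>
    converges_weakly (\<lambda>n. distr M borel (\<lambda>\<omega>. sqrt (real n) *\<^sub>R (est n \<omega> - x0))) \<nu>"
proof -
  define H' where "H' = matrix_inv limit_HF"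
  have x0: "x0 \<in> cball x0 r" using r by auto
  have DF_meas [measurable]: "(\<lambda>z. DF z x0) \<in> borel_measurable S"
    using borel_measurable_integrable[OF DF_integrable[OF x0]] by simp
  have mv [measurable]: "(\<lambda>y. H' *v y) \<in> borel_measurable borel"
    by (intro borel_measurable_continuous_onI linear_continuous_on matrix_vector_mul_bounded_linear)
  let ?\<phi> = "\<lambda>z. - (H' *v DF z x0)"
  have \<phi> [measurable]: "?\<phi> \<in> borel_measurable S"
    by measurable
  let ?X = "\<lambda>i \<omega>. ?\<phi> (Z (Suc i) \<omega>)"
  note ind = shifted_iid(1)[OF \<phi>] and law = shifted_iid(2)[OF \<phi>]
  have tr: "integrable M (\<lambda>\<omega>. k (?X 0 \<omega>)) \<longleftrightarrow> integrable P (\<lambda>z. k (?\<phi> z))"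
      "expectation (\<lambda>\<omega>. k (?X 0 \<omega>)) = (\<integral>z. k (?\<phi> z) \<partial>P)"
    if [measurable]: "k \<in> borel_measurable borel" for k :: "real^'k \<Rightarrow> real"
  proof -
    have "integrable (distr M borel (?X 0)) k \<longleftrightarrow> integrable (distr P borel ?\<phi>) k"
      "integral\<^sup>L (distr M borel (?X 0)) k = integral\<^sup>L (distr P borel ?\<phi>) k" unfolding law by auto
    then show "integrable M (\<lambda>\<omega>. k (?X 0 \<omega>)) \<longleftrightarrow> integrable P (\<lambda>z. k (?\<phi> z))"
      "expectation (\<lambda>\<omega>. k (?X 0 \<omega>)) = (\<integral>z. k (?\<phi> z) \<partial>P)"
      by (simp_all add: integrable_distr_eq integral_distr)
  qed
  interpret PP: prob_space P by (rule P_prob)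
  have sq\<phi>: "integrable P (\<lambda>z. (norm (?\<phi> z))\<^sup>2)"
  proof (rule Bochner_Integration.integrable_bound)
    show "integrable P (\<lambda>z. (CARD('k) * norm H')\<^sup>2 * (norm (DF z x0))\<^sup>2)" using sq by simp
    show "AE z in P. norm ((norm (?\<phi> z))\<^sup>2) \<le> norm ((CARD('k) * norm H')\<^sup>2 * (norm (DF z x0))\<^sup>2)"
    proof (rule AE_I2)
      fix z
      have "(norm (H' *v DF z x0))\<^sup>2 \<le> (CARD('k) * norm H' * norm (DF z x0))\<^sup>2"
        by (intro power_mono norm_matrix_vector_le) auto
      then show "norm ((norm (?\<phi> z))\<^sup>2) \<le> norm ((CARD('k) * norm H')\<^sup>2 * (norm (DF z x0))\<^sup>2)"
        by (simp add: power_mult_distrib)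
    qed
  qed measurable
  have sqX: "integrable M (\<lambda>\<omega>. (norm (?X 0 \<omega>))\<^sup>2)"
    using tr(1)[of "\<lambda>y. (norm y)\<^sup>2"] sq\<phi> by simp
  have mean_DF: "(\<integral>z. DF z x0 $ i \<partial>P) = 0" for i
  proof -
    have "(\<integral>z. DF z x0 \<bullet> axis i 1 \<partial>P) = limit_DF x0 \<bullet> axis i 1"
      unfolding limit_DF_def by (rule integral_inner_left) (rule DF_integrable[OF x0])
    then show ?thesis by (simp add: limit_DF_zero inner_axis)
  qed
  have DFi: "integrable P (\<lambda>z. DF z x0 $ i)" for i
    by (rule integrable_vec_nth[OF DF_integrable[OF x0]])
  have comp: "?\<phi> z $ i = - (\<Sum>j\<in>UNIV. H' $ i $ j * DF z x0 $ j)" for z i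
    by (simp add: matrix_vector_mult_def)
  have mean\<phi>: "(\<integral>z. ?\<phi> z $ i \<partial>P) = 0" for i
    unfolding comp using DFi mean_DF by simp
  have meanX: "expectation (\<lambda>\<omega>. ?X 0 \<omega> $ j) = 0" for j
    using tr(2)[of "\<lambda>y. y $ j"] mean\<phi>[of j] by simp
  have DFP [measurable]: "(\<lambda>z. DF z x0) \<in> borel_measurable P" by simp
  have symH': "transpose H' = H'"
  proof -
    have "transpose H' = transpose H' ** (limit_HF ** H')"
      unfolding H'_def by (simp add: matrix_inv_inverse(1)[OF inv])
    also have "\<dots> = transpose (limit_HF ** H') ** H'"
      by (simp add: matrix_transpose_mul sym matrix_mul_assoc)
    also have "\<dots> = H'" unfolding H'_def by (simp add: matrix_inv_inverse(1)[OF inv])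
    finally show ?thesis .
  qed
  have "law_eq": "distr M borel (?X i) = distr M borel (?X 0)" for i unfolding law ..
  have cov: "covariance_matrix M (?X 0) = H' ** covariance_matrix P (\<lambda>z. DF z x0) ** H'"
  proof -
    have X0m: "random_variable borel (?X 0)" using ind unfolding indep_vars_def2 by simp
    have "covariance_matrix M (?X 0) $ i $ j = (H' ** covariance_matrix P (\<lambda>z. DF z x0) ** transpose H') $ i $ j" for i j
    proof -
      have "covariance_matrix M (?X 0) $ i $ j = expectation (\<lambda>\<omega>. ?X 0 \<omega> $ i * ?X 0 \<omega> $ j)"
        by (rule covariance_centered_entry[OF X0m sqX meanX])
      also have "\<dots> = (\<integral>z. ?\<phi> z $ i * ?\<phi> z $ j \<partial>P)"
        by (rule tr(2)[of "\<lambda>y. y $ i * y $ j"]) simp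
      also have "\<dots> = (\<integral>z. (\<Sum>l\<in>UNIV. \<Sum>k\<in>UNIV. H' $ i $ k * H' $ j $ l * (DF z x0 $ k * DF z x0 $ l)) \<partial>P)"
        unfolding comp by (subst sum.swap) (simp add: sum_product mult_ac)
      also have "\<dots> = (\<Sum>l\<in>UNIV. \<Sum>k\<in>UNIV. H' $ i $ k * H' $ j $ l * (\<integral>z. DF z x0 $ k * DF z x0 $ l \<partial>P))"
        using PP.integrable_component_product[OF DFP sq] by simp
      also have "\<dots> = (\<Sum>l\<in>UNIV. \<Sum>k\<in>UNIV. H' $ i $ k * H' $ j $ l * covariance_matrix P (\<lambda>z. DF z x0) $ k $ l)"
        by (simp add: PP.covariance_centered_entry[OF DFP sq mean_DF])
      also have "\<dots> = (H' ** covariance_matrix P (\<lambda>z. DF z x0) ** transpose H') $ i $ j"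
        by (simp add: matrix_matrix_mult_def transpose_def sum_distrib_left sum_distrib_right mult_ac)
      finally show ?thesis .
    qed
    then show ?thesis by (simp add: vec_eq_iff symH')
  qed
  from multivariate_central_limit_theorem[OF ind law_eq sqX meanX]
  obtain \<nu> where \<nu>: "normal_law 0 (H' ** covariance_matrix P (\<lambda>z. DF z x0) ** H') \<nu>" "prob_space \<nu>" "sets \<nu> = sets borel"
    and clt: "converges_weakly (\<lambda>n. distr M borel (\<lambda>\<omega>. (1 / sqrt n) *\<^sub>R (\<Sum>i<n. ?X i \<omega>))) \<nu>"
    unfolding cov by blast
  have W_eq: "(1 / sqrt n) *\<^sub>R (\<Sum>i<n. ?X i \<omega>) = sqrt n *\<^sub>R (- (H' *v mean_DF n \<omega> x0))" for n \<omega>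
  proof -
    have s: "sqrt n * (1 / n) = 1 / sqrt n"
      by (cases "n = 0") (simp_all add: field_simps)
    have "(\<Sum>i<n. ?X i \<omega>) = - (H' *v (\<Sum>j=1..n. DF (Z j \<omega>) x0))"
      by (simp add: sum.atLeast1_atMost_eq sum_negf linear_sum[OF matrix_vector_mul_linear])
    then show ?thesis
      by (simp only: mean_DF_def matrix_vector_mult_scaleR scaleR_minus_right scaleR_scaleR s)
  qed
  have lin: "AE \<omega> in M. \<forall>\<delta>>0. \<forall>\<^sub>F n in sequentially.
      norm ((est n \<omega> - x0) - - (H' *v mean_DF n \<omega> x0)) \<le> \<delta> * norm (- (H' *v mean_DF n \<omega> x0))"
    unfolding H'_def by (rule minimizer_linearization[OF inv]) (rule est)
  have XU [measurable]: "random_variable borel (?X i)" for i using ind unfolding indep_vars_def2 by simp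
  \<comment> \<open>The estimator is only known to be measurable for positive sample sizes.\<close>
  define Y where "Y n = (if n = 0 then (\<lambda>\<omega>. 0) else (\<lambda>\<omega>. sqrt (real n) *\<^sub>R (est n \<omega> - x0)))" for n
  have "converges_weakly (\<lambda>n. distr M borel (Y n)) \<nu>"
  proof (rule converges_weakly_perturb[OF _ _ \<nu>(2,3) clt])
    show "random_variable borel (Y n)" for n
      using est_meas[of n] by (cases "n = 0") (auto simp: Y_def)
    show "random_variable borel (\<lambda>\<omega>. (1 / sqrt n) *\<^sub>R (\<Sum>i<n. ?X i \<omega>))" for n :: nat
      by measurable
    show "AE \<omega> in M. \<forall>\<delta>>0. \<forall>\<^sub>F n in sequentially.
        norm (Y n \<omega> - (1 / sqrt n) *\<^sub>R (\<Sum>i<n. ?X i \<omega>)) \<le> \<delta> * norm ((1 / sqrt n) *\<^sub>R (\<Sum>i<n. ?X i \<omega>))"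
      using lin
    proof eventually_elim
      case (elim \<omega>)
      show ?case
      proof (intro allI impI)
        fix \<delta> :: real assume "0 < \<delta>"
        from elim[rule_format, OF this] eventually_gt_at_top[of 0]
        show "\<forall>\<^sub>F n in sequentially. norm (Y n \<omega> - (1 / sqrt n) *\<^sub>R (\<Sum>i<n. ?X i \<omega>)) \<le>
            \<delta> * norm ((1 / sqrt n) *\<^sub>R (\<Sum>i<n. ?X i \<omega>))"
        proof eventually_elim
          case (elim n)
          let ?w = "- (H' *v mean_DF n \<omega> x0)"
          have "Y n \<omega> - (1 / sqrt n) *\<^sub>R (\<Sum>i<n. ?X i \<omega>) = sqrt n *\<^sub>R ((est n \<omega> - x0) - ?w)"
            unfolding W_eq using elim(2) by (simp only: Y_def scaleR_diff_right) simp
          then have "norm (Y n \<omega> - (1 / sqrt n) *\<^sub>R (\<Sum>i<n. ?X i \<omega>)) = sqrt n * norm ((est n \<omega> - x0) - ?w)"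
            by (simp only: norm_scaleR) simp
          also have "\<dots> \<le> sqrt n * (\<delta> * norm ?w)"
            using elim(1) by (intro mult_left_mono) auto
          also have "\<dots> = \<delta> * norm ((1 / sqrt n) *\<^sub>R (\<Sum>i<n. ?X i \<omega>))"
            unfolding W_eq norm_scaleR by simp
          finally show ?case .
        qed
      qed
    qed
  qed
  then have "converges_weakly (\<lambda>n. distr M borel (\<lambda>\<omega>. sqrt (real n) *\<^sub>R (est n \<omega> - x0))) \<nu>"
    unfolding converges_weakly_def
  proof (intro allI impI)
    fix h :: "real^'k \<Rightarrow> real"
    assume *: "\<forall>h :: real^'k \<Rightarrow> real. continuous_on UNIV h \<longrightarrow> bounded (range h) \<longrightarrow> (\<lambda>n. \<integral>x. h x \<partial>distr M borel (Y n)) \<longlonglongrightarrow> (\<integral>x. h x \<partial>\<nu>)"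
      and h: "continuous_on UNIV h" "bounded (range h)"
    have ev: "\<forall>\<^sub>F n in sequentially. (\<integral>x. h x \<partial>distr M borel (Y n)) =
        (\<integral>x. h x \<partial>distr M borel (\<lambda>\<omega>. sqrt (real n) *\<^sub>R (est n \<omega> - x0)))"
      using eventually_gt_at_top[of 0] by eventually_elim (simp add: Y_def)
    have lim: "(\<lambda>n. \<integral>x. h x \<partial>distr M borel (Y n)) \<longlonglongrightarrow> (\<integral>x. h x \<partial>\<nu>)"
      using * h by blast
    show "(\<lambda>n. \<integral>x. h x \<partial>distr M borel (\<lambda>\<omega>. sqrt (real n) *\<^sub>R (est n \<omega> - x0))) \<longlonglongrightarrow> (\<integral>x. h x \<partial>\<nu>)"
      by (rule Lim_transform_eventually[OF lim ev])
  qed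
  with \<nu>(1) show ?thesis unfolding H'_def by blast
qed

end

section \<open>Exponentials of ridge functions\<close>

lemma second_order_remainder:
  fixes \<phi> :: "real \<Rightarrow> real"
  assumes 1: "\<And>t. 0 \<le> t \<Longrightarrow> t \<le> 1 \<Longrightarrow> (\<phi> has_real_derivative \<phi>' t) (at t)"
    and 2: "\<And>t. 0 \<le> t \<Longrightarrow> t \<le> 1 \<Longrightarrow> (\<phi>' has_real_derivative \<phi>'' t) (at t)"
    and M: "\<And>t. 0 \<le> t \<Longrightarrow> t \<le> 1 \<Longrightarrow> \<bar>\<phi>'' t\<bar> \<le> B"
  shows "\<bar>\<phi> 1 - \<phi> 0 - \<phi>' 0\<bar> \<le> B"
proof -
  obtain s where s: "0 < s" "s < 1" "\<phi> 1 - \<phi> 0 = (1 - 0) * \<phi>' s"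
    using MVT2[of 0 1 \<phi> \<phi>'] 1 by auto
  obtain u where u: "0 < u" "u < s" "\<phi>' s - \<phi>' 0 = (s - 0) * \<phi>'' u"
    using MVT2[of 0 s \<phi>' \<phi>''] 2 s by auto
  have "\<bar>\<phi> 1 - \<phi> 0 - \<phi>' 0\<bar> = s * \<bar>\<phi>'' u\<bar>" using s u by (simp add: abs_mult)
  also have "\<dots> \<le> 1 * B" using s u M[of u] by (intro mult_mono) auto
  finally show ?thesis by simp
qed

text \<open>The mean slope on the right half exceeds the one on the left half.\<close>

lemma strict_midpoint_convexity:
  fixes \<phi> :: "real \<Rightarrow> real"
  assumes 1: "\<And>t. 0 \<le> t \<Longrightarrow> t \<le> 1 \<Longrightarrow> (\<phi> has_real_derivative \<phi>' t) (at t)"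
    and 2: "\<And>t. 0 \<le> t \<Longrightarrow> t \<le> 1 \<Longrightarrow> (\<phi>' has_real_derivative \<phi>'' t) (at t)"
    and pos: "\<And>t. 0 \<le> t \<Longrightarrow> t \<le> 1 \<Longrightarrow> 0 < \<phi>'' t"
  shows "\<phi> (1/2) < (\<phi> 0 + \<phi> 1) / 2"
proof -
  obtain s where s: "0 < s" "s < 1/2" "\<phi> (1/2) - \<phi> 0 = (1/2 - 0) * \<phi>' s"
    using MVT2[of 0 "1/2" \<phi> \<phi>'] 1 by auto
  obtain u where u: "1/2 < u" "u < 1" "\<phi> 1 - \<phi> (1/2) = (1 - 1/2) * \<phi>' u"
    using MVT2[of "1/2" 1 \<phi> \<phi>'] 1 by auto
  have "\<phi>' s < \<phi>' u"
  proof (rule DERIV_pos_imp_increasing[of s u \<phi>'])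
    show "\<exists>d. (\<phi>' has_real_derivative d) (at t) \<and> 0 < d" if "s \<le> t" "t \<le> u" for t
      using 2[of t] pos[of t] s u that by (intro exI[of _ "\<phi>'' t"]) auto
  qed (use s u in simp)
  with s u show ?thesis by simp
qed

definition outer :: "real^'k \<Rightarrow> real^'k^'k" where
  "outer u = (\<chi> i j. u $ i * u $ j)"

lemma outer_mult: "outer u *v h = (u \<bullet> h) *\<^sub>R u"
  by (simp add: outer_def vec_eq_iff matrix_vector_mult_def inner_vec_def sum_distrib_left mult_ac)

text \<open>Exponentials of sums of functions of linear forms. All directional derivatives are sums over \<open>i\<close>
of derivatives of \<open>\<rho> i\<close> with powers of \<open>c i \<bullet> h\<close> as weights, so bounds on the one-dimensional
functions bound everything.\<close>

locale ridge_exponential =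
  fixes c :: "'i::finite \<Rightarrow> real^'k" and \<rho> \<rho>1 \<rho>2 \<rho>3 :: "'i \<Rightarrow> real \<Rightarrow> real" and D :: "(real^'k) set"
  assumes D: "convex D"
    and deriv1: "\<And>i y. y \<in> D \<Longrightarrow> (\<rho> i has_real_derivative \<rho>1 i (c i \<bullet> y)) (at (c i \<bullet> y))"
    and deriv2: "\<And>i y. y \<in> D \<Longrightarrow> (\<rho>1 i has_real_derivative \<rho>2 i (c i \<bullet> y)) (at (c i \<bullet> y))"
    and deriv3: "\<And>i y. y \<in> D \<Longrightarrow> (\<rho>2 i has_real_derivative \<rho>3 i (c i \<bullet> y)) (at (c i \<bullet> y))"
    and \<rho>2_nonneg: "\<And>i y. y \<in> D \<Longrightarrow> 0 \<le> \<rho>2 i (c i \<bullet> y)"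
begin

definition E :: "real^'k \<Rightarrow> real" where
  "E y = exp (\<Sum>i\<in>UNIV. \<rho> i (c i \<bullet> y))"

definition slope :: "real^'k \<Rightarrow> real^'k" where
  "slope y = (\<Sum>i\<in>UNIV. \<rho>1 i (c i \<bullet> y) *\<^sub>R c i)"

definition curv :: "real^'k \<Rightarrow> real^'k^'k" where
  "curv y = (\<Sum>i\<in>UNIV. \<rho>2 i (c i \<bullet> y) *\<^sub>R outer (c i))"

definition grad :: "real^'k \<Rightarrow> real^'k" where
  "grad y = E y *\<^sub>R slope y"

definition hess :: "real^'k \<Rightarrow> real^'k^'k" where
  "hess y = E y *\<^sub>R (outer (slope y) + curv y)"

lemma E_pos: "0 < E y" by (simp add: E_def)

lemma slope_inner: "slope y \<bullet> w = (\<Sum>i\<in>UNIV. \<rho>1 i (c i \<bullet> y) * (c i \<bullet> w))"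
  by (simp add: slope_def inner_sum_left)

lemma curv_mult: "curv y *v h = (\<Sum>i\<in>UNIV. (\<rho>2 i (c i \<bullet> y) * (c i \<bullet> h)) *\<^sub>R c i)"
proof -
  interpret L: bounded_linear "\<lambda>A :: real^'k^'k. A *v h" by (rule bounded_linear_matrix_vector_left)
  show ?thesis by (simp add: curv_def L.sum L.scaleR outer_mult)
qed

lemma curv_form: "w \<bullet> (curv y *v h) = (\<Sum>i\<in>UNIV. \<rho>2 i (c i \<bullet> y) * (c i \<bullet> h) * (c i \<bullet> w))"
  by (simp add: curv_mult inner_sum_right inner_commute)

lemma hess_form: "w \<bullet> (hess y *v h) = E y * ((slope y \<bullet> h) * (slope y \<bullet> w) + w \<bullet> (curv y *v h))"
proof -
  interpret L: bounded_linear "\<lambda>A :: real^'k^'k. A *v h" by (rule bounded_linear_matrix_vector_left)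
  show ?thesis
    by (simp add: hess_def L.scaleR L.add outer_mult inner_add_right inner_commute algebra_simps)
qed

lemma hess_symmetric: "hess y $ i $ j = hess y $ j $ i"
  by (simp add: hess_def curv_def outer_def mult.commute)

lemma curv_nonneg: "y \<in> D \<Longrightarrow> 0 \<le> h \<bullet> (curv y *v h)"
  unfolding curv_form by (intro sum_nonneg) (simp add: \<rho>2_nonneg mult.assoc)

lemma curv_pos:
  assumes "y \<in> D" "\<And>i. 0 < \<rho>2 i (c i \<bullet> y)" "c i \<bullet> h \<noteq> 0"
  shows "0 < h \<bullet> (curv y *v h)"
  unfolding curv_form
  by (rule sum_pos2[of _ i]) (use assms \<rho>2_nonneg[OF assms(1)] in \<open>auto simp: mult.assoc less_imp_le intro!: mult_pos_pos simp: zero_less_mult_iff\<close>)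

context
  fixes x h :: "real^'k"
  assumes seg: "\<And>t. 0 \<le> t \<Longrightarrow> t \<le> 1 \<Longrightarrow> x + t *\<^sub>R h \<in> D"
begin

abbreviation "pt t \<equiv> x + t *\<^sub>R h"

lemma inner_pt_deriv: "((\<lambda>t. c i \<bullet> pt t) has_real_derivative c i \<bullet> h) (at t)"
  by (auto intro!: derivative_eq_intros simp: inner_add_right)

lemma slope_deriv:
  assumes t: "0 \<le> t" "t \<le> 1"
  shows "((\<lambda>t. slope (pt t) \<bullet> w) has_real_derivative w \<bullet> (curv (pt t) *v h)) (at t)"
  unfolding slope_inner curv_form
  by (rule DERIV_sum, rule DERIV_cmult_right, rule DERIV_chain2[OF deriv2[OF seg[OF t]] inner_pt_deriv])

lemma curv_deriv:
  assumes t: "0 \<le> t" "t \<le> 1"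
  shows "((\<lambda>t. w \<bullet> (curv (pt t) *v h)) has_real_derivative
    (\<Sum>i\<in>UNIV. \<rho>3 i (c i \<bullet> pt t) * (c i \<bullet> h) * (c i \<bullet> h) * (c i \<bullet> w))) (at t)"
  unfolding curv_form
  by (rule DERIV_sum, rule DERIV_cmult_right, rule DERIV_cmult_right, rule DERIV_chain2[OF deriv3[OF seg[OF t]] inner_pt_deriv])

lemma E_deriv:
  assumes t: "0 \<le> t" "t \<le> 1"
  shows "((\<lambda>t. E (pt t)) has_real_derivative grad (pt t) \<bullet> h) (at t)"
proof -
  have "((\<lambda>t. \<Sum>i\<in>UNIV. \<rho> i (c i \<bullet> pt t)) has_real_derivative slope (pt t) \<bullet> h) (at t)"
    unfolding slope_inner
    by (rule DERIV_sum, rule DERIV_chain2[OF deriv1[OF seg[OF t]] inner_pt_deriv])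
  from DERIV_chain2[OF DERIV_exp this] show ?thesis
    by (simp add: E_def grad_def)
qed

lemma grad_deriv:
  assumes t: "0 \<le> t" "t \<le> 1"
  shows "((\<lambda>t. grad (pt t) \<bullet> w) has_real_derivative w \<bullet> (hess (pt t) *v h)) (at t)"
  unfolding grad_def inner_scaleR_left hess_form
  by (rule DERIV_cong[OF DERIV_mult[OF E_deriv[OF t] slope_deriv[OF t]]]) (simp add: grad_def algebra_simps)

text \<open>The third derivative of the exponential, twice in the direction of the segment and once along
\<open>w\<close>; it controls the expansion of the gradient.\<close>

definition third :: "real \<Rightarrow> real^'k \<Rightarrow> real" where
  "third t w = E (pt t) * ((slope (pt t) \<bullet> h) * ((slope (pt t) \<bullet> h) * (slope (pt t) \<bullet> w) + w \<bullet> (curv (pt t) *v h))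
     + ((h \<bullet> (curv (pt t) *v h)) * (slope (pt t) \<bullet> w) + (slope (pt t) \<bullet> h) * (w \<bullet> (curv (pt t) *v h)))
     + (\<Sum>i\<in>UNIV. \<rho>3 i (c i \<bullet> pt t) * (c i \<bullet> h) * (c i \<bullet> h) * (c i \<bullet> w)))"

lemma hess_deriv:
  assumes t: "0 \<le> t" "t \<le> 1"
  shows "((\<lambda>t. w \<bullet> (hess (pt t) *v h)) has_real_derivative third t w) (at t)"
  unfolding hess_form
  by (rule DERIV_cong[OF DERIV_mult[OF E_deriv[OF t] DERIV_add[OF DERIV_mult[OF slope_deriv[OF t] slope_deriv[OF t]] curv_deriv[OF t]]]])
     (simp add: grad_def third_def algebra_simps)

end

lemma convex_E: "convex_on D E"
proof (rule convex_onI[OF _ D])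
  fix t :: real and x y assume t: "0 < t" "t < 1" and xy: "x \<in> D" "y \<in> D"
  have seg: "x + s *\<^sub>R (y - x) \<in> D" if "0 \<le> s" "s \<le> 1" for s
    using convexD_alt[OF D xy, of s] that by (simp add: algebra_simps)
  let ?p = "\<lambda>s. x + s *\<^sub>R (y - x)"
  have "convex_on {0..1} (\<lambda>s. E (?p s))"
  proof (rule f''_ge0_imp_convex)
    show "((\<lambda>s. E (?p s)) has_real_derivative grad (?p s) \<bullet> (y - x)) (at s)" if "s \<in> {0..1}" for s
      using E_deriv[OF seg] that by auto
    show "((\<lambda>s. grad (?p s) \<bullet> (y - x)) has_real_derivative (y - x) \<bullet> (hess (?p s) *v (y - x))) (at s)" if "s \<in> {0..1}" for s
      using grad_deriv[OF seg] that by auto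
    show "0 \<le> (y - x) \<bullet> (hess (?p s) *v (y - x))" if "s \<in> {0..1}" for s
      unfolding hess_form using E_pos[of "?p s"] curv_nonneg[OF seg, of s "y - x"] that by simp
  qed simp
  from convex_onD[OF this, of t 0 1] t show "E ((1 - t) *\<^sub>R x + t *\<^sub>R y) \<le> (1 - t) * E x + t * E y"
    by (simp add: algebra_simps)
qed

lemma strict_E:
  assumes xy: "x \<in> D" "y \<in> D" "x \<noteq> y"
    and pos: "\<And>i y. y \<in> D \<Longrightarrow> 0 < \<rho>2 i (c i \<bullet> y)" and inj: "\<And>h. (\<And>i. c i \<bullet> h = 0) \<Longrightarrow> h = 0"
  shows "E ((1/2) *\<^sub>R (x + y)) < (E x + E y) / 2"
proof -
  have seg: "x + s *\<^sub>R (y - x) \<in> D" if "0 \<le> s" "s \<le> 1" for s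
    using convexD_alt[OF D xy(1,2), of s] that by (simp add: algebra_simps)
  let ?p = "\<lambda>s. x + s *\<^sub>R (y - x)"
  obtain i where i: "c i \<bullet> (y - x) \<noteq> 0" using inj[of "y - x"] xy(3) by auto
  have "E (?p (1/2)) < (E (?p 0) + E (?p 1)) / 2"
  proof (rule strict_midpoint_convexity)
    show "((\<lambda>s. E (?p s)) has_real_derivative grad (?p s) \<bullet> (y - x)) (at s)" if "0 \<le> s" "s \<le> 1" for s
      using E_deriv[OF seg] that by auto
    show "((\<lambda>s. grad (?p s) \<bullet> (y - x)) has_real_derivative (y - x) \<bullet> (hess (?p s) *v (y - x))) (at s)" if "0 \<le> s" "s \<le> 1" for s
      using grad_deriv[OF seg] that by auto
    show "0 < (y - x) \<bullet> (hess (?p s) *v (y - x))" if "0 \<le> s" "s \<le> 1" for s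
      unfolding hess_form using E_pos[of "?p s"] curv_pos[OF seg pos[OF seg] i, of s] that by (simp add: add_nonneg_pos)
  qed
  moreover have "?p (1/2) = (1/2) *\<^sub>R (x + y)" by (simp add: vec_eq_iff field_simps)
  ultimately show ?thesis by simp
qed


text \<open>The cube of \<open>1 + norm\<close> dominates the norm, its square and its third power at once, so a single constant
serves the sums that occur in derivatives of all three orders.\<close>

definition \<kappa> :: real where
  "\<kappa> = 1 + (\<Sum>i\<in>UNIV. (1 + norm (c i)) ^ 3)"

text \<open>If all \<open>\<rho> i\<close> and their derivatives are bounded by \<open>\<Lambda>\<close>, the exponential is at most \<open>exp (m \<Lambda>)\<close>, where
\<open>m\<close> is the number of linear forms, and its logarithmic derivatives contribute at most
\<open>5 (\<kappa> \<Lambda>)\<^sup>3\<close>; the polynomial factor \<open>\<Lambda>\<^sup>3\<close> is absorbed in \<open>exp (3 \<Lambda>)\<close>.\<close>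

definition envelope :: "real \<Rightarrow> real" where
  "envelope \<Lambda> = 5 * \<kappa> ^ 3 * exp ((real CARD('i) + 3) * \<Lambda>)"

lemma \<kappa>_ge_1: "1 \<le> \<kappa>"
  by (simp add: \<kappa>_def sum_nonneg)

lemma weighted_sum_bound:
  assumes "\<And>i. \<bar>a i\<bar> \<le> \<Lambda>" "\<And>i. \<bar>b i\<bar> \<le> (1 + norm (c i)) ^ 3 * q" "0 \<le> q"
  shows "\<bar>\<Sum>i\<in>UNIV. a i * b i\<bar> \<le> \<kappa> * \<Lambda> * q"
proof -
  have "0 \<le> \<Lambda>" using assms(1)[of undefined] by linarith
  have "\<bar>\<Sum>i\<in>UNIV. a i * b i\<bar> \<le> (\<Sum>i\<in>UNIV. \<Lambda> * ((1 + norm (c i)) ^ 3 * q))"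
    by (rule order_trans[OF sum_abs], rule sum_mono) (use assms \<open>0 \<le> \<Lambda>\<close> in \<open>auto simp: abs_mult intro!: mult_mono\<close>)
  also have "\<dots> = \<Lambda> * q * (\<Sum>i\<in>UNIV. (1 + norm (c i)) ^ 3)"
    by (simp add: sum_distrib_left mult_ac)
  also have "\<dots> \<le> \<Lambda> * q * \<kappa>"
    using assms(3) \<open>0 \<le> \<Lambda>\<close> by (intro mult_left_mono) (auto simp: \<kappa>_def)
  finally show ?thesis by (simp add: mult_ac)
qed

lemma cubic_dominates:
  fixes u :: real
  assumes "0 \<le> u"
  shows "u \<le> (1 + u) ^ 3" "u * u \<le> (1 + u) ^ 3" "u * u * u \<le> (1 + u) ^ 3"
  using assms by (auto simp: power3_eq_cube algebra_simps add_increasing mult_nonneg_nonneg)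

context
  fixes Q :: "(real^'k) set" and \<Lambda> :: real
  assumes Q: "convex Q" "Q \<subseteq> D" and \<Lambda>: "1 \<le> \<Lambda>"
    and bounds: "\<And>i y. y \<in> Q \<Longrightarrow> \<bar>\<rho> i (c i \<bullet> y)\<bar> \<le> \<Lambda>" "\<And>i y. y \<in> Q \<Longrightarrow> \<bar>\<rho>1 i (c i \<bullet> y)\<bar> \<le> \<Lambda>"
      "\<And>i y. y \<in> Q \<Longrightarrow> \<bar>\<rho>2 i (c i \<bullet> y)\<bar> \<le> \<Lambda>" "\<And>i y. y \<in> Q \<Longrightarrow> \<bar>\<rho>3 i (c i \<bullet> y)\<bar> \<le> \<Lambda>"
begin

lemma S_ge_1: "1 \<le> \<kappa> * \<Lambda>"
  using mult_mono[OF \<kappa>_ge_1 \<Lambda>] \<kappa>_ge_1 by simp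

lemma E_le: "y \<in> Q \<Longrightarrow> E y \<le> exp (CARD('i) * \<Lambda>)"
  unfolding E_def using sum_bounded_above[of UNIV "\<lambda>i. \<rho> i (c i \<bullet> y)" \<Lambda>] bounds(1)[of y]
  by (auto simp: abs_le_iff)

lemma slope_le: "y \<in> Q \<Longrightarrow> \<bar>slope y \<bullet> w\<bar> \<le> \<kappa> * \<Lambda> * norm w"
  unfolding slope_inner
proof (rule weighted_sum_bound)
  fix i
  have "\<bar>c i \<bullet> w\<bar> \<le> norm (c i) * norm w" by (rule Cauchy_Schwarz_ineq2)
  also have "\<dots> \<le> (1 + norm (c i)) ^ 3 * norm w" by (intro mult_right_mono cubic_dominates) auto
  finally show "\<bar>c i \<bullet> w\<bar> \<le> (1 + norm (c i)) ^ 3 * norm w" .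
qed (use bounds in auto)

lemma norm_slope_le: "y \<in> Q \<Longrightarrow> norm (slope y) \<le> \<kappa> * \<Lambda>"
proof -
  assume "y \<in> Q"
  from slope_le[OF this, of "slope y"] have "norm (slope y) * norm (slope y) \<le> \<kappa> * \<Lambda> * norm (slope y)"
    by (simp add: power2_norm_eq_inner[symmetric] power2_eq_square)
  then show ?thesis using S_ge_1 by (cases "norm (slope y) = 0") (auto simp: mult_le_cancel_right)
qed

lemma curv_le: "y \<in> Q \<Longrightarrow> \<bar>w \<bullet> (curv y *v h)\<bar> \<le> \<kappa> * \<Lambda> * (norm h * norm w)"
  unfolding curv_form mult.assoc
proof (rule weighted_sum_bound[unfolded mult.assoc])
  fix i
  have "\<bar>(c i \<bullet> h) * (c i \<bullet> w)\<bar> \<le> (norm (c i) * norm h) * (norm (c i) * norm w)"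
    unfolding abs_mult by (intro mult_mono Cauchy_Schwarz_ineq2) auto
  also have "\<dots> = (norm (c i) * norm (c i)) * (norm h * norm w)" by (simp add: mult_ac)
  also have "\<dots> \<le> (1 + norm (c i)) ^ 3 * (norm h * norm w)" by (intro mult_right_mono cubic_dominates) auto
  finally show "\<bar>(c i \<bullet> h) * (c i \<bullet> w)\<bar> \<le> (1 + norm (c i)) ^ 3 * (norm h * norm w)" .
qed (use bounds in auto)

lemma third_sum_le:
  assumes "y \<in> Q"
  shows "\<bar>\<Sum>i\<in>UNIV. \<rho>3 i (c i \<bullet> y) * (c i \<bullet> h) * (c i \<bullet> h) * (c i \<bullet> w)\<bar> \<le> \<kappa> * \<Lambda> * (norm h * norm h * norm w)"
  unfolding mult.assoc
proof (rule weighted_sum_bound[unfolded mult.assoc])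
  fix i
  have "\<bar>(c i \<bullet> h) * ((c i \<bullet> h) * (c i \<bullet> w))\<bar> \<le> (norm (c i) * norm h) * ((norm (c i) * norm h) * (norm (c i) * norm w))"
    unfolding abs_mult by (intro mult_mono Cauchy_Schwarz_ineq2) auto
  also have "\<dots> = (norm (c i) * norm (c i) * norm (c i)) * (norm h * (norm h * norm w))" by (simp add: mult_ac)
  also have "\<dots> \<le> (1 + norm (c i)) ^ 3 * (norm h * (norm h * norm w))" by (intro mult_right_mono cubic_dominates) auto
  finally show "\<bar>(c i \<bullet> h) * ((c i \<bullet> h) * (c i \<bullet> w))\<bar> \<le> (1 + norm (c i)) ^ 3 * (norm h * (norm h * norm w))" .
qed (use bounds assms in auto)

lemma envelope_absorbs:
  assumes "y \<in> Q" "0 \<le> a" "a \<le> 5 * (\<kappa> * \<Lambda>) ^ 3"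
  shows "E y * a \<le> envelope \<Lambda>"
proof -
  have "\<Lambda> \<le> exp \<Lambda>" using exp_ge_add_one_self[of \<Lambda>] by linarith
  then have "\<Lambda> ^ 3 \<le> exp \<Lambda> ^ 3" using \<Lambda> by (intro power_mono) auto
  also have "exp \<Lambda> ^ 3 = exp (3 * \<Lambda>)" by (simp add: exp_of_nat_mult[symmetric])
  finally have 3: "\<Lambda> ^ 3 \<le> exp (3 * \<Lambda>)" .
  have "E y * a \<le> exp (CARD('i) * \<Lambda>) * (5 * (\<kappa> * \<Lambda>) ^ 3)"
    using E_le[OF assms(1)] assms(2,3) by (intro mult_mono) auto
  also have "\<dots> = 5 * \<kappa> ^ 3 * (exp (CARD('i) * \<Lambda>) * \<Lambda> ^ 3)"
    by (simp add: power_mult_distrib)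
  also have "\<dots> \<le> 5 * \<kappa> ^ 3 * (exp (CARD('i) * \<Lambda>) * exp (3 * \<Lambda>))"
    using 3 \<kappa>_ge_1 by (intro mult_left_mono) auto
  also have "\<dots> = envelope \<Lambda>"
    by (simp add: envelope_def exp_add[symmetric] algebra_simps)
  finally show ?thesis .
qed

lemma S_powers: "1 \<le> (\<kappa> * \<Lambda>) ^ 3" "\<kappa> * \<Lambda> \<le> (\<kappa> * \<Lambda>) ^ 3" "(\<kappa> * \<Lambda>) * (\<kappa> * \<Lambda>) \<le> (\<kappa> * \<Lambda>) ^ 3"
proof -
  show "1 \<le> (\<kappa> * \<Lambda>) ^ 3" using S_ge_1 by (rule one_le_power)
  show "\<kappa> * \<Lambda> \<le> (\<kappa> * \<Lambda>) ^ 3" using power_increasing[of 1 3 "\<kappa> * \<Lambda>"] S_ge_1 by simp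
  show "(\<kappa> * \<Lambda>) * (\<kappa> * \<Lambda>) \<le> (\<kappa> * \<Lambda>) ^ 3" using power_increasing[of 2 3 "\<kappa> * \<Lambda>"] S_ge_1
    by (simp only: power2_eq_square)
qed

lemma E_le_envelope: "y \<in> Q \<Longrightarrow> \<bar>E y\<bar> \<le> envelope \<Lambda>"
  using envelope_absorbs[of y 1] S_powers E_pos[of y] by simp

lemma grad_le_envelope: "y \<in> Q \<Longrightarrow> norm (grad y) \<le> envelope \<Lambda>"
  using envelope_absorbs[of y "norm (slope y)"] S_powers norm_slope_le[of y] E_pos[of y]
  by (simp add: grad_def)

lemma norm_outer: "norm (outer (u :: real^'k)) = norm u * norm u"
proof -
  have "norm (outer u $ i) = \<bar>u $ i\<bar> * norm u" for i
  proof -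
    have "outer u $ i = u $ i *\<^sub>R u" by (simp add: outer_def vec_eq_iff)
    then show ?thesis by simp
  qed
  then have "norm (outer u) = L2_set (\<lambda>i. \<bar>u $ i\<bar> * norm u) UNIV"
    by (simp only: norm_vec_def[of "outer u"])
  also have "\<dots> = L2_set (\<lambda>i. \<bar>u $ i\<bar>) UNIV * norm u"
    by (simp add: L2_set_right_distrib mult.commute)
  also have "L2_set (\<lambda>i. \<bar>u $ i\<bar>) UNIV = norm u"
    by (simp add: norm_vec_def)
  finally show ?thesis .
qed

lemma hess_le_envelope:
  assumes y: "y \<in> Q"
  shows "norm (hess y) \<le> envelope \<Lambda>"
proof -
  have "norm (curv y) \<le> (\<Sum>i\<in>UNIV. \<bar>\<rho>2 i (c i \<bullet> y) * (norm (c i) * norm (c i))\<bar>)"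
    unfolding curv_def by (rule order_trans[OF norm_sum]) (simp add: norm_outer abs_mult)
  also have "\<dots> = \<bar>\<Sum>i\<in>UNIV. \<bar>\<rho>2 i (c i \<bullet> y)\<bar> * (norm (c i) * norm (c i))\<bar>"
    by (simp add: abs_mult sum_nonneg)
  also have "\<dots> \<le> \<kappa> * \<Lambda> * 1"
    by (rule weighted_sum_bound) (use bounds y cubic_dominates in auto)
  finally have "norm (curv y) \<le> \<kappa> * \<Lambda>" by simp
  moreover have "norm (outer (slope y)) \<le> (\<kappa> * \<Lambda>) * (\<kappa> * \<Lambda>)"
    unfolding norm_outer using norm_slope_le[OF y] S_ge_1 by (intro mult_mono) auto
  ultimately have "norm (outer (slope y) + curv y) \<le> 5 * (\<kappa> * \<Lambda>) ^ 3"
    using norm_triangle_ineq[of "outer (slope y)" "curv y"] S_powers by linarith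
  from envelope_absorbs[OF y norm_ge_zero this] show ?thesis
    using E_pos[of y] by (simp add: hess_def)
qed

context
  fixes x y :: "real^'k"
  assumes xy: "x \<in> Q" "y \<in> Q"
begin

lemma segQ: "0 \<le> t \<Longrightarrow> t \<le> 1 \<Longrightarrow> x + t *\<^sub>R (y - x) \<in> Q"
  using convexD_alt[OF Q(1) xy, of t] by (simp add: algebra_simps)

lemma segD: "0 \<le> t \<Longrightarrow> t \<le> 1 \<Longrightarrow> x + t *\<^sub>R (y - x) \<in> D"
  using segQ Q(2) by blast

lemma E_lipschitz: "\<bar>E y - E x\<bar> \<le> envelope \<Lambda> * norm (y - x)"
proof -
  let ?p = "\<lambda>t. x + t *\<^sub>R (y - x)"
  obtain s where s: "0 < s" "s < 1" "E (?p 1) - E (?p 0) = (1 - 0) * (grad (?p s) \<bullet> (y - x))"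
    using MVT2[of 0 1 "\<lambda>t. E (?p t)" "\<lambda>t. grad (?p t) \<bullet> (y - x)"] E_deriv[OF segD] by auto
  have "\<bar>grad (?p s) \<bullet> (y - x)\<bar> \<le> norm (grad (?p s)) * norm (y - x)" by (rule Cauchy_Schwarz_ineq2)
  also have "\<dots> \<le> envelope \<Lambda> * norm (y - x)"
    using s by (intro mult_right_mono grad_le_envelope segQ) auto
  finally show ?thesis using s(3) by simp
qed

lemma E_expansion: "\<bar>E y - E x - grad x \<bullet> (y - x)\<bar> \<le> envelope \<Lambda> * (norm (y - x))\<^sup>2"
proof -
  let ?p = "\<lambda>t. x + t *\<^sub>R (y - x)" and ?h = "y - x"
  have "\<bar>E (?p 1) - E (?p 0) - grad (?p 0) \<bullet> ?h\<bar> \<le> envelope \<Lambda> * (norm ?h)\<^sup>2"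
  proof (rule second_order_remainder[where \<phi>="\<lambda>t. E (?p t)" and \<phi>'="\<lambda>t. grad (?p t) \<bullet> ?h"
        and \<phi>''="\<lambda>t. ?h \<bullet> (hess (?p t) *v ?h)"])
    fix t :: real assume t: "0 \<le> t" "t \<le> 1"
    show "((\<lambda>t. E (?p t)) has_real_derivative grad (?p t) \<bullet> ?h) (at t)" by (rule E_deriv[OF segD t])
    show "((\<lambda>t. grad (?p t) \<bullet> ?h) has_real_derivative ?h \<bullet> (hess (?p t) *v ?h)) (at t)" by (rule grad_deriv[OF segD t])
    let ?S = "\<kappa> * \<Lambda>"
    have "\<bar>(slope (?p t) \<bullet> ?h) * (slope (?p t) \<bullet> ?h)\<bar> \<le> (?S * norm ?h) * (?S * norm ?h)"
      unfolding abs_mult using slope_le[OF segQ[OF t], of ?h] S_ge_1 by (intro mult_mono) auto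
    moreover have "\<bar>?h \<bullet> (curv (?p t) *v ?h)\<bar> \<le> ?S * (norm ?h * norm ?h)" by (rule curv_le[OF segQ[OF t]])
    ultimately have "\<bar>(slope (?p t) \<bullet> ?h) * (slope (?p t) \<bullet> ?h) + ?h \<bullet> (curv (?p t) *v ?h)\<bar> \<le>
        (?S * ?S + ?S) * (norm ?h)\<^sup>2"
      by (simp add: power2_eq_square algebra_simps)
    then have "\<bar>?h \<bullet> (hess (?p t) *v ?h)\<bar> \<le> E (?p t) * ((?S * ?S + ?S) * (norm ?h)\<^sup>2)"
      unfolding hess_form abs_mult using E_pos[of "?p t"] by (simp add: abs_of_pos)
    also have "\<dots> = (E (?p t) * (?S * ?S + ?S)) * (norm ?h)\<^sup>2" by simp
    also have "\<dots> \<le> envelope \<Lambda> * (norm ?h)\<^sup>2"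
      using S_powers S_ge_1 by (intro mult_right_mono envelope_absorbs segQ[OF t]) auto
    finally show "\<bar>?h \<bullet> (hess (?p t) *v ?h)\<bar> \<le> envelope \<Lambda> * (norm ?h)\<^sup>2" .
  qed
  then show ?thesis by simp
qed

lemma third_le:
  assumes t: "0 \<le> t" "t \<le> 1"
  shows "\<bar>third x (y - x) t w\<bar> \<le> envelope \<Lambda> * ((norm (y - x))\<^sup>2 * norm w)"
proof -
  let ?p = "x + t *\<^sub>R (y - x)" and ?h = "y - x" and ?S = "\<kappa> * \<Lambda>"
  let ?n = "norm ?h * norm ?h * norm w"
  have p: "?p \<in> Q" by (rule segQ[OF t])
  note sh = slope_le[OF p, of ?h] and sw = slope_le[OF p, of w]
    and chw = curv_le[OF p, of w ?h] and chh = curv_le[OF p, of ?h ?h]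
  have S0: "0 \<le> ?S" using S_ge_1 by linarith
  have n0: "0 \<le> ?n" by simp
  have 1: "\<bar>(slope ?p \<bullet> ?h) * ((slope ?p \<bullet> ?h) * (slope ?p \<bullet> w))\<bar> \<le> ?S * ?S * ?S * ?n"
  proof -
    have "\<bar>slope ?p \<bullet> ?h\<bar> * (\<bar>slope ?p \<bullet> ?h\<bar> * \<bar>slope ?p \<bullet> w\<bar>) \<le> (?S * norm ?h) * ((?S * norm ?h) * (?S * norm w))"
      by (intro mult_mono sh sw mult_nonneg_nonneg S0) auto
    also have "\<dots> = ?S * ?S * ?S * ?n" by (simp only: mult_ac)
    finally show ?thesis by (simp only: abs_mult)
  qed
  have 2: "\<bar>(slope ?p \<bullet> ?h) * (w \<bullet> (curv ?p *v ?h))\<bar> \<le> ?S * ?S * ?n"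
  proof -
    have "\<bar>slope ?p \<bullet> ?h\<bar> * \<bar>w \<bullet> (curv ?p *v ?h)\<bar> \<le> (?S * norm ?h) * (?S * (norm ?h * norm w))"
      by (intro mult_mono sh chw mult_nonneg_nonneg S0) auto
    also have "\<dots> = ?S * ?S * ?n" by (simp only: mult_ac)
    finally show ?thesis by (simp only: abs_mult)
  qed
  have 3: "\<bar>(?h \<bullet> (curv ?p *v ?h)) * (slope ?p \<bullet> w)\<bar> \<le> ?S * ?S * ?n"
  proof -
    have "\<bar>?h \<bullet> (curv ?p *v ?h)\<bar> * \<bar>slope ?p \<bullet> w\<bar> \<le> (?S * (norm ?h * norm ?h)) * (?S * norm w)"
      by (intro mult_mono chh sw mult_nonneg_nonneg S0) auto
    also have "\<dots> = ?S * ?S * ?n" by (simp only: mult_ac)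
    finally show ?thesis by (simp only: abs_mult)
  qed
  have 4: "\<bar>\<Sum>i\<in>UNIV. \<rho>3 i (c i \<bullet> ?p) * (c i \<bullet> ?h) * (c i \<bullet> ?h) * (c i \<bullet> w)\<bar> \<le> ?S * ?n"
    by (rule third_sum_le[OF p])
  let ?T = "(slope ?p \<bullet> ?h) * ((slope ?p \<bullet> ?h) * (slope ?p \<bullet> w) + w \<bullet> (curv ?p *v ?h))
     + ((?h \<bullet> (curv ?p *v ?h)) * (slope ?p \<bullet> w) + (slope ?p \<bullet> ?h) * (w \<bullet> (curv ?p *v ?h)))
     + (\<Sum>i\<in>UNIV. \<rho>3 i (c i \<bullet> ?p) * (c i \<bullet> ?h) * (c i \<bullet> ?h) * (c i \<bullet> w))"
  have "\<bar>?T\<bar> \<le> ?S * ?S * ?S * ?n + 3 * (?S * ?S * ?n) + ?S * ?n"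
    using 1 2 3 4 unfolding distrib_left by linarith
  also have "\<dots> = (?S * ?S * ?S + 3 * (?S * ?S) + ?S) * ?n" by (simp only: distrib_right mult.assoc)
  finally have T: "\<bar>?T\<bar> \<le> (?S * ?S * ?S + 3 * (?S * ?S) + ?S) * ?n" .
  have "\<bar>third x ?h t w\<bar> = E ?p * \<bar>?T\<bar>"
  proof -
    have "third x ?h t w = E ?p * ?T" by (rule third_def) (rule segD)
    then show ?thesis using E_pos[of ?p] by (simp only: abs_mult abs_of_pos)
  qed
  also have "\<dots> \<le> E ?p * ((?S * ?S * ?S + 3 * (?S * ?S) + ?S) * ?n)"
    using T E_pos[of ?p] by (intro mult_left_mono) auto
  also have "\<dots> = (E ?p * (?S * ?S * ?S + 3 * (?S * ?S) + ?S)) * ?n" by simp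
  also have "\<dots> \<le> envelope \<Lambda> * ?n"
  proof (intro mult_right_mono envelope_absorbs p n0)
    show "0 \<le> ?S * ?S * ?S + 3 * (?S * ?S) + ?S" using S0 by simp
    have "?S * ?S * ?S = ?S ^ 3" by (simp only: power3_eq_cube)
    then show "?S * ?S * ?S + 3 * (?S * ?S) + ?S \<le> 5 * ?S ^ 3" using S_powers by linarith
  qed
  finally show ?thesis by (simp only: power2_eq_square)
qed

text \<open>The remainder vector \<open>v\<close> is tested against itself: along the segment, \<open>v \<bullet> v\<close> is the second order
Taylor remainder of the scalar function \<open>t \<mapsto> grad (x + t h) \<bullet> v\<close>.\<close>

lemma grad_expansion: "norm (grad y - grad x - hess x *v (y - x)) \<le> envelope \<Lambda> * (norm (y - x))\<^sup>2"
proof -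
  let ?p = "\<lambda>t. x + t *\<^sub>R (y - x)" and ?h = "y - x"
  define v where "v = grad y - grad x - hess x *v ?h"
  have "\<bar>grad (?p 1) \<bullet> v - grad (?p 0) \<bullet> v - v \<bullet> (hess (?p 0) *v ?h)\<bar> \<le> envelope \<Lambda> * ((norm ?h)\<^sup>2 * norm v)"
  proof (rule second_order_remainder[where \<phi>="\<lambda>t. grad (?p t) \<bullet> v" and \<phi>'="\<lambda>t. v \<bullet> (hess (?p t) *v ?h)"
        and \<phi>''="\<lambda>t. third x ?h t v"])
    fix t :: real assume t: "0 \<le> t" "t \<le> 1"
    show "((\<lambda>t. grad (?p t) \<bullet> v) has_real_derivative v \<bullet> (hess (?p t) *v ?h)) (at t)" by (rule grad_deriv[OF segD t])
    show "((\<lambda>t. v \<bullet> (hess (?p t) *v ?h)) has_real_derivative third x ?h t v) (at t)" by (rule hess_deriv[OF segD t])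
    show "\<bar>third x ?h t v\<bar> \<le> envelope \<Lambda> * ((norm ?h)\<^sup>2 * norm v)" by (rule third_le[OF t])
  qed
  moreover have "grad (?p 1) \<bullet> v - grad (?p 0) \<bullet> v - v \<bullet> (hess (?p 0) *v ?h) = v \<bullet> v"
    by (simp add: v_def inner_diff_left inner_diff_right inner_commute)
  ultimately have "norm v * norm v \<le> (envelope \<Lambda> * (norm ?h)\<^sup>2) * norm v"
    by (simp add: power2_norm_eq_inner[symmetric] power2_eq_square mult_ac)
  moreover have "0 \<le> envelope \<Lambda>" using \<kappa>_ge_1 by (simp add: envelope_def)
  ultimately show ?thesis unfolding v_def[symmetric]
    by (cases "norm v = 0") (auto simp: mult_le_cancel_right)
qed

end

end

end

section \<open>Exponential moments\<close>

text \<open>The sum is at most the number of terms times the largest one. This reduces exponential moments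
of a sum to those of its terms, whatever their joint law.\<close>

lemma exp_sum_le_sum_exp:
  fixes u :: "'i::finite \<Rightarrow> real"
  assumes "\<And>i. 0 \<le> u i"
  shows "exp (\<Sum>i\<in>UNIV. u i) \<le> (\<Sum>i\<in>UNIV. exp (real CARD('i) * u i))"
proof -
  have "Max (range u) \<in> range u" by (rule Max_in) auto
  then obtain i where "Max (range u) = u i" by blast
  then have i: "u j \<le> u i" for j using Max_ge[of "range u" "u j"] by simp
  have "(\<Sum>j\<in>UNIV. u j) \<le> real CARD('i) * u i"
    using sum_bounded_above[of UNIV u "u i"] i by simp
  then have "exp (\<Sum>j\<in>UNIV. u j) \<le> exp (real CARD('i) * u i)" by simp
  also have "\<dots> \<le> (\<Sum>j\<in>UNIV. exp (real CARD('i) * u j))"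
    by (rule member_le_sum) auto
  finally show ?thesis .
qed

text \<open>A substitute for Hoelder's inequality: if \<open>E \<le> p\<^sup>\<gamma>\<close> the first term dominates, otherwise the second
one does.\<close>

lemma power_exp_young:
  fixes p E \<gamma> :: real
  assumes "0 \<le> p" "0 < E" "0 < \<gamma>" "0 < a"
  shows "p ^ a * E \<le> p powr (real a + \<gamma>) + E powr (1 + real a / \<gamma>)"
proof (cases "p = 0")
  case True then show ?thesis using \<open>0 < a\<close> by (simp add: power_0_left)
next
  case False
  with \<open>0 \<le> p\<close> have p: "0 < p" by simp
  have pa: "p ^ a = p powr real a" using p by (simp add: powr_realpow)
  show ?thesis
  proof (cases "E \<le> p powr \<gamma>")
    case True
    have "p ^ a * E \<le> p powr a * p powr \<gamma>" unfolding pa using True p by (intro mult_left_mono) auto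
    also have "\<dots> = p powr (real a + \<gamma>)" by (simp add: powr_add)
    also have "\<dots> \<le> p powr (real a + \<gamma>) + E powr (1 + real a / \<gamma>)" by simp
    finally show ?thesis .
  next
    case False
    have "p powr real a = (p powr \<gamma>) powr (real a / \<gamma>)" using \<open>0 < \<gamma>\<close> by (simp add: powr_powr)
    also have "\<dots> \<le> E powr (real a / \<gamma>)" using False assms by (intro powr_mono2) auto
    finally have "p ^ a * E \<le> E powr (real a / \<gamma>) * E powr 1"
      unfolding pa using \<open>0 < E\<close> by (intro mult_mono) auto
    also have "\<dots> = E powr (1 + real a / \<gamma>)" by (simp add: powr_add)
    also have "\<dots> \<le> p powr (real a + \<gamma>) + E powr (1 + real a / \<gamma>)" by simp
    finally show ?thesis .
  qed
qed

lemma std_normal_exp_moment: "integrable std_normal_distribution (\<lambda>x. exp (c * \<bar>x\<bar>))"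
proof (rule Bochner_Integration.integrable_bound)
  have 1: "integrable std_normal_distribution (\<lambda>x. exp (b * x))" for b :: real
  proof -
    \<comment> \<open>Completing the square turns the tilted density into a shifted one.\<close>
    have "integrable lborel (\<lambda>x. exp (b\<^sup>2 / 2) * normal_density b 1 x)" by simp
    also have "(\<lambda>x. exp (b\<^sup>2 / 2) * normal_density b 1 x) = (\<lambda>x. std_normal_density x *\<^sub>R exp (b * x))"
    proof
      fix x :: real
      have "exp (b\<^sup>2 / 2) * exp (- (x - b)\<^sup>2 / 2) = exp (- x\<^sup>2 / 2) * exp (b * x)"
        unfolding exp_add[symmetric] by (rule arg_cong[of _ _ exp]) (simp add: power2_eq_square field_simps)
      then show "exp (b\<^sup>2 / 2) * normal_density b 1 x = std_normal_density x *\<^sub>R exp (b * x)"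
        by (simp add: normal_density_def)
    qed
    finally show ?thesis by (subst integrable_density) auto
  qed
  show "integrable std_normal_distribution (\<lambda>x. exp (c * x) + exp ((-c) * x))"
    by (intro Bochner_Integration.integrable_add 1)
  show "AE x in std_normal_distribution. norm (exp (c * \<bar>x\<bar>)) \<le> norm (exp (c * x) + exp ((-c) * x))"
  proof (rule AE_I2)
    fix x :: real
    have "exp (c * \<bar>x\<bar>) \<le> exp (c * x) + exp ((-c) * x)" by (simp add: abs_if)
    then show "norm (exp (c * \<bar>x\<bar>)) \<le> norm (exp (c * x) + exp ((-c) * x))" by (simp add: add_pos_pos)
  qed
qed simp

lemma poisson_exp_moment:
  assumes "0 < m"
  shows "integrable (measure_pmf (poisson_pmf m)) (\<lambda>n. exp (c * real n))"
proof -
  have "summable (\<lambda>n. exp (- m) * (inverse (fact n) * (m * exp c) ^ n))"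
    by (intro summable_mult summable_exp)
  also have "(\<lambda>n. exp (- m) * (inverse (fact n) * (m * exp c) ^ n)) = (\<lambda>n. norm (pmf (poisson_pmf m) n *\<^sub>R exp (c * real n)))"
    using assms by (auto simp: pmf_poisson power_mult_distrib exp_of_nat_mult[symmetric] field_simps mult.commute)
  finally have "integrable (count_space UNIV) (\<lambda>n. pmf (poisson_pmf m) n *\<^sub>R exp (c * real n))"
    by (simp add: integrable_count_space_nat_iff)
  then show ?thesis
    unfolding measure_pmf_eq_density by (subst integrable_density) auto
qed

text \<open>The size of an observation that governs the exponent.\<close>

definition load :: "real^'d \<Rightarrow> nat^'p \<Rightarrow> real" where
  "load g n = (\<Sum>i\<in>UNIV. \<bar>g $ i\<bar>) + (\<Sum>i\<in>UNIV. real (n $ i))"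

lemma load_nonneg: "0 \<le> load g n"
  by (simp add: load_def sum_nonneg)

lemma abs_le_load: "\<bar>g $ i\<bar> \<le> load g n" and count_le_load: "real (n $ j) \<le> load g n"
proof -
  have "\<bar>g $ i\<bar> \<le> (\<Sum>i\<in>UNIV. \<bar>g $ i\<bar>)" by (rule member_le_sum) auto
  then show "\<bar>g $ i\<bar> \<le> load g n" by (simp add: load_def sum_nonneg add_increasing2)
  have "real (n $ j) \<le> (\<Sum>i\<in>UNIV. real (n $ i))" by (rule member_le_sum) auto
  then show "real (n $ j) \<le> load g n" by (simp add: load_def sum_nonneg add_increasing)
qed

lemma measurable_count_nth [measurable]:
  "(\<lambda>z. real (snd z $ i)) \<in> borel_measurable (N \<Otimes>\<^sub>M count_space (UNIV :: (nat^'p) set))"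
  by (rule measurable_compose[OF measurable_snd]) simp

lemma load_measurable [measurable]:
  "(\<lambda>z. load (fst z) (snd z)) \<in> borel_measurable (borel \<Otimes>\<^sub>M count_space UNIV)"
  unfolding load_def by measurable

lemma (in prob_space) exp_load_integrable:
  fixes G :: "'a \<Rightarrow> real^'d" and N :: "'a \<Rightarrow> nat^'p"
  assumes G [measurable]: "G \<in> borel_measurable M" and G_law: "distr M borel G = std_normal_vec"
    and N [measurable]: "N \<in> measurable M (count_space UNIV)"
    and N_law: "\<And>i. distr M (count_space UNIV) (\<lambda>\<omega>. N \<omega> $ i) = measure_pmf (poisson_pmf (\<mu> $ i))"
    and \<mu>: "\<And>i. 0 < \<mu> $ i" and "0 \<le> c"
  shows "integrable M (\<lambda>\<omega>. exp (c * load (G \<omega>) (N \<omega>)))"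
proof -
  have Nm [measurable]: "(\<lambda>\<omega>. N \<omega> $ i) \<in> measurable M (count_space UNIV)" for i
    by (rule measurable_compose[OF N]) simp
  have Nr [measurable]: "(\<lambda>\<omega>. real (N \<omega> $ i)) \<in> borel_measurable M" for i
    by (rule measurable_compose[OF N]) simp
  have gi: "integrable M (\<lambda>\<omega>. exp (b * \<bar>G \<omega> $ i\<bar>))" for b i
  proof -
    have "distr M borel (\<lambda>\<omega>. G \<omega> $ i) = distr (distr M borel G) borel (\<lambda>x. x $ i)"
      by (subst distr_distr) (auto simp: comp_def)
    then have "distr M borel (\<lambda>\<omega>. G \<omega> $ i) = std_normal_distribution"
      by (simp add: G_law distr_std_normal_vec_component)
    with std_normal_exp_moment[of b] have "integrable (distr M borel (\<lambda>\<omega>. G \<omega> $ i)) (\<lambda>x. exp (b * \<bar>x\<bar>))" by simp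
    then show ?thesis by (subst (asm) integrable_distr_eq) auto
  qed
  have ni: "integrable M (\<lambda>\<omega>. exp (b * real (N \<omega> $ i)))" for b i
  proof -
    have "integrable (distr M (count_space UNIV) (\<lambda>\<omega>. N \<omega> $ i)) (\<lambda>n. exp (b * real n))"
      unfolding N_law by (rule poisson_exp_moment[OF \<mu>])
    then show ?thesis by (subst (asm) integrable_distr_eq) auto
  qed
  let ?u = "\<lambda>\<omega> i. case i of Inl a \<Rightarrow> c * \<bar>G \<omega> $ a\<bar> | Inr b \<Rightarrow> c * real (N \<omega> $ b)"
  have eq: "c * load (G \<omega>) (N \<omega>) = (\<Sum>i\<in>UNIV. ?u \<omega> i)" for \<omega>
    unfolding load_def UNIV_Plus_UNIV[symmetric] by (subst sum.Plus) (simp_all add: sum_distrib_left distrib_left)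
  have meas: "(\<lambda>\<omega>. exp (c * load (G \<omega>) (N \<omega>))) \<in> borel_measurable M"
    unfolding load_def by measurable
  show ?thesis
  proof (rule Bochner_Integration.integrable_bound[OF _ meas])
    let ?m = "real CARD('d + 'p)"
    show "integrable M (\<lambda>\<omega>. \<Sum>i\<in>UNIV. exp (?m * ?u \<omega> i))"
    proof (rule Bochner_Integration.integrable_sum)
      fix i :: "'d + 'p"
      show "integrable M (\<lambda>\<omega>. exp (?m * ?u \<omega> i))"
        using gi[of "?m * c"] ni[of "?m * c"] by (cases i) (simp_all add: mult.assoc)
    qed
    show "AE \<omega> in M. norm (exp (c * load (G \<omega>) (N \<omega>))) \<le> norm (\<Sum>i\<in>UNIV. exp (?m * ?u \<omega> i))"
    proof (rule AE_I2)
      fix \<omega>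
      have "exp (c * load (G \<omega>) (N \<omega>)) \<le> (\<Sum>i\<in>UNIV. exp (?m * ?u \<omega> i))"
        unfolding eq by (rule exp_sum_le_sum_exp) (use \<open>0 \<le> c\<close> in \<open>auto split: sum.split\<close>)
      then show "norm (exp (c * load (G \<omega>) (N \<omega>))) \<le> norm (\<Sum>i\<in>UNIV. exp (?m * ?u \<omega> i))" by simp
    qed
  qed
qed

lemma (in prob_space) power_exp_integrable:
  fixes X L :: "'a \<Rightarrow> real"
  assumes [measurable]: "X \<in> borel_measurable M" "L \<in> borel_measurable M"
    and L: "\<And>c. 0 \<le> c \<Longrightarrow> integrable M (\<lambda>\<omega>. exp (c * L \<omega>))"
    and "0 < \<gamma>" "0 < a" and X: "integrable M (\<lambda>\<omega>. \<bar>X \<omega>\<bar> powr (real a + \<gamma>))" and "0 \<le> c"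
  shows "integrable M (\<lambda>\<omega>. \<bar>X \<omega>\<bar> ^ a * exp (c * L \<omega>))"
proof (rule Bochner_Integration.integrable_bound)
  show "integrable M (\<lambda>\<omega>. \<bar>X \<omega>\<bar> powr (real a + \<gamma>) + exp ((c * (1 + real a / \<gamma>)) * L \<omega>))"
    using assms by (intro Bochner_Integration.integrable_add X L) auto
  show "AE \<omega> in M. norm (\<bar>X \<omega>\<bar> ^ a * exp (c * L \<omega>)) \<le> norm (\<bar>X \<omega>\<bar> powr (real a + \<gamma>) + exp ((c * (1 + real a / \<gamma>)) * L \<omega>))"
  proof (rule AE_I2)
    fix \<omega>
    have "\<bar>X \<omega>\<bar> ^ a * exp (c * L \<omega>) \<le> \<bar>X \<omega>\<bar> powr (real a + \<gamma>) + exp (c * L \<omega>) powr (1 + real a / \<gamma>)"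
      by (rule power_exp_young) (use assms in auto)
    also have "exp (c * L \<omega>) powr (1 + real a / \<gamma>) = exp ((c * (1 + real a / \<gamma>)) * L \<omega>)"
      by (simp add: exp_powr_real mult_ac)
    finally show "norm (\<bar>X \<omega>\<bar> ^ a * exp (c * L \<omega>)) \<le> norm (\<bar>X \<omega>\<bar> powr (real a + \<gamma>) + exp ((c * (1 + real a / \<gamma>)) * L \<omega>))"
      by (simp add: abs_mult)
  qed
qed simp

text \<open>\<open>G\<close> and \<open>N\<close> are independent and every value of \<open>N\<close> has positive probability.\<close>

lemma (in prob_space) positive_sample_probability:
  fixes G :: "'a \<Rightarrow> real^'d" and N :: "'a \<Rightarrow> nat^'p"
  assumes G [measurable]: "G \<in> borel_measurable M"
    and N [measurable]: "N \<in> measurable M (count_space UNIV)"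
    and N_law: "\<And>i. distr M (count_space UNIV) (\<lambda>\<omega>. N \<omega> $ i) = measure_pmf (poisson_pmf (\<mu> $ i))"
    and \<mu>: "\<And>i. 0 < \<mu> $ i"
    and N_indep: "indep_vars (\<lambda>_. count_space UNIV) (\<lambda>i \<omega>. N \<omega> $ i) UNIV"
    and G_N_indep: "indep_set (sets (vimage_algebra (space M) G borel))
      (sets (vimage_algebra (space M) N (count_space UNIV)))"
    and h [measurable]: "h \<in> borel_measurable borel"
    and pos: "0 < prob {\<omega> \<in> space M. h (G \<omega>) \<noteq> (0::real)}"
  shows "0 < prob {\<omega> \<in> space M. h (G \<omega>) \<noteq> 0 \<and> N \<omega> = n}"
proof -
  have "prob {\<omega> \<in> space M. N \<omega> = n} = prob (\<Inter>i\<in>UNIV. (\<lambda>\<omega>. N \<omega> $ i) -` {n $ i} \<inter> space M)"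
    by (rule arg_cong[of _ _ prob]) (auto simp: vec_eq_iff)
  also have "\<dots> = (\<Prod>i\<in>UNIV. prob ((\<lambda>\<omega>. N \<omega> $ i) -` {n $ i} \<inter> space M))"
    by (rule indep_varsD_finite[OF N_indep]) auto
  also have "\<dots> = (\<Prod>i\<in>UNIV. pmf (poisson_pmf (\<mu> $ i)) (n $ i))"
  proof (rule prod.cong[OF refl])
    fix i
    have "(\<lambda>\<omega>. N \<omega> $ i) \<in> measurable M (count_space UNIV)"
      by (rule measurable_compose[OF N]) simp
    then have "prob ((\<lambda>\<omega>. N \<omega> $ i) -` {n $ i} \<inter> space M) = measure (distr M (count_space UNIV) (\<lambda>\<omega>. N \<omega> $ i)) {n $ i}"
      by (subst measure_distr) auto
    then show "prob ((\<lambda>\<omega>. N \<omega> $ i) -` {n $ i} \<inter> space M) = pmf (poisson_pmf (\<mu> $ i)) (n $ i)"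
      by (simp add: N_law measure_pmf_single)
  qed
  also have "\<dots> > 0" using \<mu> by (intro prod_pos) (simp add: pmf_poisson)
  finally have N_pos: "0 < prob {\<omega> \<in> space M. N \<omega> = n}" .
  have "{\<omega> \<in> space M. h (G \<omega>) \<noteq> 0} = G -` {x. h x \<noteq> 0} \<inter> space M" by auto
  moreover have "{x. h x \<noteq> 0} \<in> sets borel" by measurable
  ultimately have 1: "{\<omega> \<in> space M. h (G \<omega>) \<noteq> 0} \<in> sets (vimage_algebra (space M) G borel)"
    using in_vimage_algebra[of "{x. h x \<noteq> 0}" borel G "space M"] by (simp only:)
  have "{\<omega> \<in> space M. N \<omega> = n} = N -` {n} \<inter> space M" by auto
  then have 2: "{\<omega> \<in> space M. N \<omega> = n} \<in> sets (vimage_algebra (space M) N (count_space UNIV))"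
    by (simp add: in_vimage_algebra)
  have "prob ({\<omega> \<in> space M. h (G \<omega>) \<noteq> 0} \<inter> {\<omega> \<in> space M. N \<omega> = n}) =
      prob {\<omega> \<in> space M. h (G \<omega>) \<noteq> 0} * prob {\<omega> \<in> space M. N \<omega> = n}"
    by (rule indep_setD[OF G_N_indep 1 2])
  also have "\<dots> > 0" using N_pos pos by simp
  also have "{\<omega> \<in> space M. h (G \<omega>) \<noteq> 0} \<inter> {\<omega> \<in> space M. N \<omega> = n} = {\<omega> \<in> space M. h (G \<omega>) \<noteq> 0 \<and> N \<omega> = n}"
    by auto
  finally show ?thesis .
qed

section \<open>The reweighted squared payoff\<close>

lemma stack_unstack [simp]: "stack (unstack y) = y"
  by (auto simp: stack_def unstack_def vec_eq_iff split: sum.split)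

lemma unstack_stack [simp]: "unstack (stack x) = x"
  by (cases x) (simp add: stack_def unstack_def vec_eq_iff)

lemma stack_inner: "stack x \<bullet> stack y = fst x \<bullet> fst y + snd x \<bullet> snd y"
  unfolding inner_vec_def UNIV_Plus_UNIV[symmetric] by (subst sum.Plus) (simp_all add: stack_def)

lemma stack_linear: "linear stack"
  by (rule linearI) (auto simp: stack_def vec_eq_iff split: sum.split)

lemma unstack_linear: "linear unstack"
  by (rule linearI) (auto simp: unstack_def vec_eq_iff)

lemma continuous_stack: "continuous_on UNIV stack" and continuous_unstack: "continuous_on UNIV unstack"
  using stack_linear unstack_linear by (auto intro: linear_continuous_on simp: linear_conv_bounded_linear)

text \<open>The rows of the block diagonal matrix with blocks \<open>A\<close> and \<open>B\<close>.\<close>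

definition weight_row :: "real^'d1^'d \<Rightarrow> real^'p1^'p \<Rightarrow> 'd + 'p \<Rightarrow> real^('d1 + 'p1)" where
  "weight_row A B i = (case i of Inl a \<Rightarrow> stack (A $ a, 0) | Inr b \<Rightarrow> stack (0, B $ b))"

lemma weight_row_inner:
  "weight_row A B (Inl a) \<bullet> y = (A *v fst (unstack y)) $ a"
  "weight_row A B (Inr b) \<bullet> y = (B *v snd (unstack y)) $ b"
  using stack_inner[of "(A $ a, 0)" "unstack y"] stack_inner[of "(0, B $ b)" "unstack y"]
  by (simp_all add: weight_row_def matrix_vector_mul_component)

text \<open>The contribution of one linear form to the logarithm of the likelihood ratio: a Gaussian term for
a coordinate of \<open>g\<close>, a Poisson term for a coordinate of \<open>n\<close>. The functions below are its first
three derivatives in \<open>u\<close>.\<close>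

definition log_weight :: "real^'p \<Rightarrow> real^'d \<Rightarrow> nat^'p \<Rightarrow> 'd + 'p \<Rightarrow> real \<Rightarrow> real" where
  "log_weight \<mu> g n i u = (case i of Inl a \<Rightarrow> u\<^sup>2 / 2 - u * g $ a
     | Inr b \<Rightarrow> u - \<mu> $ b + real (n $ b) * (ln (\<mu> $ b) - ln u))"

definition log_weight1 :: "real^'d \<Rightarrow> nat^'p \<Rightarrow> 'd + 'p \<Rightarrow> real \<Rightarrow> real" where
  "log_weight1 g n i u = (case i of Inl a \<Rightarrow> u - g $ a | Inr b \<Rightarrow> 1 - real (n $ b) / u)"

definition log_weight2 :: "nat^'p \<Rightarrow> 'd + 'p \<Rightarrow> real \<Rightarrow> real" where
  "log_weight2 n i u = (case i of Inl a \<Rightarrow> 1 | Inr b \<Rightarrow> real (n $ b) / u\<^sup>2)"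

definition log_weight3 :: "nat^'p \<Rightarrow> 'd + 'p \<Rightarrow> real \<Rightarrow> real" where
  "log_weight3 n i u = (case i of Inl a \<Rightarrow> 0 | Inr b \<Rightarrow> - 2 * real (n $ b) / u ^ 3)"

lemma log_weight_Inl:
    "log_weight \<mu> g n (Inl a) = (\<lambda>u. u\<^sup>2 / 2 - u * g $ a)" "log_weight1 g n (Inl a) = (\<lambda>u. u - g $ a)"
    "log_weight2 n (Inl a) = (\<lambda>u. 1)" "log_weight3 n (Inl a) = (\<lambda>u. 0)"
  and log_weight_Inr:
    "log_weight \<mu> g n (Inr b) = (\<lambda>u. u - \<mu> $ b + real (n $ b) * (ln (\<mu> $ b) - ln u))"
    "log_weight1 g n (Inr b) = (\<lambda>u. 1 - real (n $ b) / u)"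
    "log_weight2 n (Inr b) = (\<lambda>u. real (n $ b) / u\<^sup>2)" "log_weight3 n (Inr b) = (\<lambda>u. - 2 * real (n $ b) / u ^ 3)"
  by (simp_all add: fun_eq_iff log_weight_def log_weight1_def log_weight2_def log_weight3_def)

definition stacked_domain :: "(real^('d1::finite + 'p1::finite)) set" where
  "stacked_domain = {y. \<forall>b. 0 < y $ Inr b}"

lemma mem_stacked_domain: "y \<in> stacked_domain \<longleftrightarrow> unstack y \<in> param_domain"
  by (simp add: stacked_domain_def param_domain_def unstack_def)

lemma convex_stacked_domain: "convex (stacked_domain :: (real^('d1::finite + 'p1::finite)) set)"
proof (rule convexI)
  fix x y :: "real^('d1 + 'p1)" and u v :: real
  assume xy: "x \<in> stacked_domain" "y \<in> stacked_domain" and uv: "0 \<le> u" "0 \<le> v" "u + v = 1"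
  have "0 < u * x $ Inr b + v * y $ Inr b" for b
  proof (cases "u = 0")
    case False
    with xy uv have "0 < u * x $ Inr b" "0 \<le> v * y $ Inr b" by (auto simp: stacked_domain_def less_imp_le)
    then show ?thesis by linarith
  qed (use xy uv in \<open>simp add: stacked_domain_def\<close>)
  then show "u *\<^sub>R x + v *\<^sub>R y \<in> stacked_domain" by (simp add: stacked_domain_def)
qed

lemma open_stacked_domain: "open (stacked_domain :: (real^('d1::finite + 'p1::finite)) set)"
proof -
  have eq: "(stacked_domain :: (real^('d1 + 'p1)) set) = (\<Inter>b. {y :: real^('d1 + 'p1). 0 < y $ Inr b})" by (auto simp: stacked_domain_def)
  have "open {y :: real^('d1 + 'p1). 0 < y $ i}" for i
    by (intro open_Collect_less continuous_intros)
  then show ?thesis unfolding eq by (intro open_INT) auto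
qed

locale weight_geometry =
  fixes A :: "real^'d1^'d" and B :: "real^'p1^'p" and \<mu> :: "real^'p"
  assumes \<mu>: "\<And>i. 0 < \<mu> $ i"
    and A_rank: "rank A = CARD('d1)" and B_rank: "rank B = CARD('p1)"
    and B_pos: "\<And>l. (\<And>k. 0 < l $ k) \<Longrightarrow> (\<And>i. 0 < (B *v l) $ i)"
begin

abbreviation "lin \<equiv> weight_row A B"

lemma row_inner_pos: "y \<in> stacked_domain \<Longrightarrow> 0 < lin (Inr b) \<bullet> y"
  unfolding weight_row_inner by (rule B_pos) (simp add: stacked_domain_def unstack_def)

text \<open>Full column rank of both blocks.\<close>

lemma row_injective:
  assumes "\<And>i. lin i \<bullet> h = 0"
  shows "h = 0"
proof -
  have "A *v fst (unstack h) = 0" "B *v snd (unstack h) = 0"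
    using assms[of "Inl _"] assms[of "Inr _"] by (auto simp: vec_eq_iff weight_row_inner)
  moreover have "inj ((*v) A)" "inj ((*v) B)"
    using A_rank B_rank by (simp_all add: full_rank_injective)
  ultimately have "fst (unstack h) = 0" "snd (unstack h) = 0"
    by (metis injD matrix_vector_mult_0_right)+
  then have "unstack h = 0" by (simp add: prod_eq_iff)
  then show ?thesis using linear_0[OF stack_linear] by (metis stack_unstack)
qed

sublocale ridge: ridge_exponential lin "log_weight \<mu> g n" "log_weight1 g n" "log_weight2 n" "log_weight3 n" stacked_domain
  for g n
proof
  show "convex (stacked_domain :: (real^('d1 + 'p1)) set)" by (rule convex_stacked_domain)
  fix i and y :: "real^('d1 + 'p1)" assume y: "y \<in> stacked_domain"
  show "(log_weight \<mu> g n i has_real_derivative log_weight1 g n i (lin i \<bullet> y)) (at (lin i \<bullet> y))"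
  proof (cases i)
    case (Inl a) then show ?thesis
      by (auto simp: log_weight_Inl intro!: derivative_eq_intros)
  next
    case (Inr b) with row_inner_pos[OF y, of b] show ?thesis
      by (auto simp: log_weight_Inr intro!: derivative_eq_intros)
  qed
  show "(log_weight1 g n i has_real_derivative log_weight2 n i (lin i \<bullet> y)) (at (lin i \<bullet> y))"
  proof (cases i)
    case (Inl a) then show ?thesis
      by (auto simp: log_weight_Inl intro!: derivative_eq_intros)
  next
    case (Inr b) with row_inner_pos[OF y, of b] show ?thesis
      by (auto simp: log_weight_Inr power2_eq_square intro!: derivative_eq_intros)
  qed
  show "(log_weight2 n i has_real_derivative log_weight3 n i (lin i \<bullet> y)) (at (lin i \<bullet> y))"
  proof (cases i)
    case (Inl a) then show ?thesis
      by (auto simp: log_weight_Inl intro!: derivative_eq_intros)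
  next
    case (Inr b) with row_inner_pos[OF y, of b] show ?thesis
      by (auto simp: log_weight_Inr field_simps power2_eq_square power3_eq_cube intro!: derivative_eq_intros)
  qed
  show "0 \<le> log_weight2 n i (lin i \<bullet> y)"
    by (simp add: log_weight2_def split: sum.split)
qed

lemma log_weight2_pos:
  assumes "\<And>b. n $ b \<noteq> 0" "y \<in> stacked_domain"
  shows "0 < log_weight2 n i (lin i \<bullet> y)"
  using assms(1) row_inner_pos[OF assms(2)] 
  by (auto simp: log_weight2_def split: sum.split intro!: divide_pos_pos zero_less_power)

lemma reduced_weighted_square_eq:
  assumes y: "y \<in> stacked_domain"
  shows "reduced_weighted_square f \<mu> A B g n (unstack y) = (f g n)\<^sup>2 * ridge.E g n y"
proof -
  let ?\<theta> = "A *v fst (unstack y)" and ?l = "B *v snd (unstack y)"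
  have l: "0 < ?l $ b" for b using row_inner_pos[OF y, of b] by (simp add: weight_row_inner)
  have "(\<Sum>i\<in>UNIV. log_weight \<mu> g n i (lin i \<bullet> y)) =
      (\<Sum>a\<in>UNIV. (?\<theta> $ a)\<^sup>2 / 2 - ?\<theta> $ a * g $ a) +
      (\<Sum>b\<in>UNIV. ?l $ b - \<mu> $ b + real (n $ b) * (ln (\<mu> $ b) - ln (?l $ b)))"
    unfolding UNIV_Plus_UNIV[symmetric]
    by (subst sum.Plus) (simp_all add: log_weight_def weight_row_inner)
  also have "(\<Sum>a\<in>UNIV. (?\<theta> $ a)\<^sup>2 / 2 - ?\<theta> $ a * g $ a) = - (?\<theta> \<bullet> g) + (norm ?\<theta>)\<^sup>2 / 2"
    by (simp add: sum_subtractf inner_vec_def norm_vec_def L2_set_def sum_nonneg sum_divide_distrib)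
  finally have "ridge.E g n y = exp (- (?\<theta> \<bullet> g) + (norm ?\<theta>)\<^sup>2 / 2) *
      (\<Prod>b\<in>UNIV. exp (?l $ b - \<mu> $ b + real (n $ b) * (ln (\<mu> $ b) - ln (?l $ b))))"
    unfolding ridge.E_def by (simp only: exp_add exp_sum[OF finite])
  also have "(\<Prod>b\<in>UNIV. exp (?l $ b - \<mu> $ b + real (n $ b) * (ln (\<mu> $ b) - ln (?l $ b)))) =
      (\<Prod>b\<in>UNIV. exp (?l $ b - \<mu> $ b) * (\<mu> $ b / ?l $ b) ^ (n $ b))"
  proof (rule prod.cong[OF refl])
    fix b
    have "exp (real (n $ b) * (ln (\<mu> $ b) - ln (?l $ b))) = (\<mu> $ b / ?l $ b) ^ (n $ b)"
      using \<mu>[of b] l[of b] by (simp add: exp_of_nat_mult exp_diff)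
    then show "exp (?l $ b - \<mu> $ b + real (n $ b) * (ln (\<mu> $ b) - ln (?l $ b))) =
        exp (?l $ b - \<mu> $ b) * (\<mu> $ b / ?l $ b) ^ (n $ b)"
      by (simp only: exp_add)
  qed
  finally show ?thesis
    by (simp add: reduced_weighted_square_def weighted_square_def case_prod_beta mult.assoc)
qed

text \<open>For fixed \<open>i\<close> the function and its derivatives are affine in a single coordinate of the observation,
with coefficients that are continuous in \<open>y\<close> on \<open>Q\<close>: there the Poisson arguments stay away from
\<open>0\<close>.\<close>

lemma log_weight_bounds:
  assumes Q: "compact Q" "Q \<subseteq> stacked_domain"
  shows "\<exists>C\<ge>1. \<forall>g n i. \<forall>y\<in>Q.
    \<bar>log_weight \<mu> g n i (lin i \<bullet> y)\<bar> \<le> C * (1 + load g n) \<and> \<bar>log_weight1 g n i (lin i \<bullet> y)\<bar> \<le> C * (1 + load g n) \<and>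
    \<bar>log_weight2 n i (lin i \<bullet> y)\<bar> \<le> C * (1 + load g n) \<and> \<bar>log_weight3 n i (lin i \<bullet> y)\<bar> \<le> C * (1 + load g n)"
proof -
  have aff: "\<bar>p + q * v\<bar> \<le> max \<bar>p\<bar> \<bar>q\<bar> * (1 + w)" if "\<bar>v\<bar> \<le> w" for p q v w :: real
  proof -
    have "\<bar>p + q * v\<bar> \<le> \<bar>p\<bar> + \<bar>q\<bar> * \<bar>v\<bar>" using abs_triangle_ineq[of p "q * v"] by (simp add: abs_mult)
    also have "\<dots> \<le> max \<bar>p\<bar> \<bar>q\<bar> + max \<bar>p\<bar> \<bar>q\<bar> * w" using that by (intro add_mono mult_mono) auto
    finally show ?thesis by (simp add: distrib_left)
  qed
  have bnd: "\<exists>C\<ge>0. \<forall>y\<in>Q. \<bar>k y\<bar> \<le> C" if "continuous_on Q k" for k :: "real^('d1 + 'p1) \<Rightarrow> real"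
  proof -
    have "bounded (k ` Q)" using compact_continuous_image[OF that Q(1)] by (rule compact_imp_bounded)
    then obtain C where "\<forall>y\<in>Q. \<bar>k y\<bar> \<le> C" by (auto simp: bounded_iff)
    then show ?thesis by (intro exI[of _ "max C 0"]) (auto simp: le_max_iff_disj)
  qed
  have aff_bnd: "\<exists>C\<ge>0. \<forall>y\<in>Q. \<forall>v w. \<bar>v\<bar> \<le> w \<longrightarrow> \<bar>p y + q y * v\<bar> \<le> C * (1 + w)"
    if pq: "continuous_on Q p" "continuous_on Q q" for p q :: "real^('d1 + 'p1) \<Rightarrow> real"
  proof -
    have "continuous_on Q (\<lambda>y. max \<bar>p y\<bar> \<bar>q y\<bar>)" by (intro continuous_intros pq)
    from bnd[OF this] obtain C where C: "C \<ge> 0" "\<And>y. y \<in> Q \<Longrightarrow> \<bar>max \<bar>p y\<bar> \<bar>q y\<bar>\<bar> \<le> C" by blast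
    show ?thesis
    proof (intro exI[of _ C] conjI ballI allI impI C(1))
      fix y and v w :: real assume y: "y \<in> Q" and vw: "\<bar>v\<bar> \<le> w"
      have "\<bar>p y + q y * v\<bar> \<le> max \<bar>p y\<bar> \<bar>q y\<bar> * (1 + w)" by (rule aff[OF vw])
      also have "\<dots> \<le> C * (1 + w)" using C(2)[OF y] vw by (intro mult_right_mono) auto
      finally show "\<bar>p y + q y * v\<bar> \<le> C * (1 + w)" .
    qed
  qed
  define good where "good i C \<longleftrightarrow> (\<forall>g n. \<forall>y\<in>Q.
    \<bar>log_weight \<mu> g n i (lin i \<bullet> y)\<bar> \<le> C * (1 + load g n) \<and> \<bar>log_weight1 g n i (lin i \<bullet> y)\<bar> \<le> C * (1 + load g n) \<and>
    \<bar>log_weight2 n i (lin i \<bullet> y)\<bar> \<le> C * (1 + load g n) \<and> \<bar>log_weight3 n i (lin i \<bullet> y)\<bar> \<le> C * (1 + load g n))" for i C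
  have "\<exists>C\<ge>0. good i C" for i
  proof -
    \<comment> \<open>each of the four functions is affine in a single coordinate of the sample\<close>
    obtain v :: "real^'d \<Rightarrow> nat^'p \<Rightarrow> real" and p q p1 q1 p2 q2 p3 q3 :: "real^('d1 + 'p1) \<Rightarrow> real"
      where v: "\<And>g n. \<bar>v g n\<bar> \<le> load g n"
        and c: "continuous_on Q p" "continuous_on Q q" "continuous_on Q p1" "continuous_on Q q1"
          "continuous_on Q p2" "continuous_on Q q2" "continuous_on Q p3" "continuous_on Q q3"
        and e: "\<And>g n y. log_weight \<mu> g n i (lin i \<bullet> y) = p y + q y * v g n"
          "\<And>g n y. log_weight1 g n i (lin i \<bullet> y) = p1 y + q1 y * v g n"
          "\<And>g n y. log_weight2 n i (lin i \<bullet> y) = p2 y + q2 y * v g n"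
          "\<And>g n y. log_weight3 n i (lin i \<bullet> y) = p3 y + q3 y * v g n"
    proof (cases i)
      case (Inl a)
      show ?thesis
        by (rule that[of "\<lambda>g n. g $ a" "\<lambda>y. (lin i \<bullet> y)\<^sup>2 / 2" "\<lambda>y. - (lin i \<bullet> y)" "\<lambda>y. lin i \<bullet> y" "\<lambda>_. -1"
            "\<lambda>_. 1" "\<lambda>_. 0" "\<lambda>_. 0" "\<lambda>_. 0"])
          (auto simp: Inl log_weight_Inl abs_le_load intro!: continuous_intros)
    next
      case (Inr b)
      have nz: "lin i \<bullet> y \<noteq> 0" "\<not> lin i \<bullet> y \<le> 0" if "y \<in> Q" for y
        using row_inner_pos[of y b] Q(2) that Inr by auto
      show ?thesis
        by (rule that[of "\<lambda>g n. real (n $ b)" "\<lambda>y. lin i \<bullet> y - \<mu> $ b" "\<lambda>y. ln (\<mu> $ b) - ln (lin i \<bullet> y)" "\<lambda>_. 1"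
            "\<lambda>y. - (1 / (lin i \<bullet> y))" "\<lambda>_. 0" "\<lambda>y. 1 / (lin i \<bullet> y)\<^sup>2" "\<lambda>_. 0" "\<lambda>y. - 2 / (lin i \<bullet> y) ^ 3"])
          (use nz in \<open>auto simp: Inr log_weight_Inr count_le_load intro!: continuous_intros\<close>)
    qed
    obtain C0 where C0: "C0 \<ge> 0" "\<And>y v w. y \<in> Q \<Longrightarrow> \<bar>v\<bar> \<le> w \<Longrightarrow> \<bar>p y + q y * v\<bar> \<le> C0 * (1 + w)" using aff_bnd[OF c(1,2)] by blast
    obtain C1 where C1: "C1 \<ge> 0" "\<And>y v w. y \<in> Q \<Longrightarrow> \<bar>v\<bar> \<le> w \<Longrightarrow> \<bar>p1 y + q1 y * v\<bar> \<le> C1 * (1 + w)" using aff_bnd[OF c(3,4)] by blast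
    obtain C2 where C2: "C2 \<ge> 0" "\<And>y v w. y \<in> Q \<Longrightarrow> \<bar>v\<bar> \<le> w \<Longrightarrow> \<bar>p2 y + q2 y * v\<bar> \<le> C2 * (1 + w)" using aff_bnd[OF c(5,6)] by blast
    obtain C3 where C3: "C3 \<ge> 0" "\<And>y v w. y \<in> Q \<Longrightarrow> \<bar>v\<bar> \<le> w \<Longrightarrow> \<bar>p3 y + q3 y * v\<bar> \<le> C3 * (1 + w)" using aff_bnd[OF c(7,8)] by blast
    have up: "x \<le> (C0 + C1 + C2 + C3) * (1 + load g n)" if "x \<le> C' * (1 + load g n)" "C' \<le> C0 + C1 + C2 + C3" for x C' and g :: "real^'d" and n :: "nat^'p"
      using that(1) mult_right_mono[OF that(2), of "1 + load g n"] load_nonneg[of g n] by linarith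
    have "good i (C0 + C1 + C2 + C3)"
      unfolding good_def
    proof (intro allI ballI conjI)
      fix g :: "real^'d" and n :: "nat^'p" and y assume y: "y \<in> Q"
      let ?b = "(C0 + C1 + C2 + C3) * (1 + load g n)"
      have "\<bar>p y + q y * v g n\<bar> \<le> ?b"
        by (rule up[OF C0(2)[OF y v]]) (use C0(1) C1(1) C2(1) C3(1) in linarith)
      then show "\<bar>log_weight \<mu> g n i (lin i \<bullet> y)\<bar> \<le> ?b" by (simp only: e)
      have "\<bar>p1 y + q1 y * v g n\<bar> \<le> ?b"
        by (rule up[OF C1(2)[OF y v]]) (use C0(1) C1(1) C2(1) C3(1) in linarith)
      then show "\<bar>log_weight1 g n i (lin i \<bullet> y)\<bar> \<le> ?b" by (simp only: e)
      have "\<bar>p2 y + q2 y * v g n\<bar> \<le> ?b"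
        by (rule up[OF C2(2)[OF y v]]) (use C0(1) C1(1) C2(1) C3(1) in linarith)
      moreover have "log_weight2 n i (lin i \<bullet> y) = p2 y + q2 y * v g n" by (rule e)
      ultimately show "\<bar>log_weight2 n i (lin i \<bullet> y)\<bar> \<le> ?b" by simp
      have "\<bar>p3 y + q3 y * v g n\<bar> \<le> ?b"
        by (rule up[OF C3(2)[OF y v]]) (use C0(1) C1(1) C2(1) C3(1) in linarith)
      moreover have "log_weight3 n i (lin i \<bullet> y) = p3 y + q3 y * v g n" by (rule e)
      ultimately show "\<bar>log_weight3 n i (lin i \<bullet> y)\<bar> \<le> ?b" by simp
    qed
    moreover have "0 \<le> C0 + C1 + C2 + C3" using C0 C1 C2 C3 by simp
    ultimately show ?thesis by blast
  qed
  then obtain C where C: "\<And>i. 0 \<le> C i" "\<And>i. good i (C i)" by metis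
  define C' where "C' = 1 + (\<Sum>i\<in>UNIV. C i)"
  have up: "x \<le> C' * (1 + load g n)" if "x \<le> C i * (1 + load g n)" for x i and g :: "real^'d" and n :: "nat^'p"
  proof -
    have "C i \<le> (\<Sum>i\<in>UNIV. C i)" by (rule member_le_sum) (use C in auto)
    then have "C i \<le> C'" by (simp add: C'_def)
    moreover have "0 \<le> 1 + load g n" using load_nonneg[of g n] by simp
    ultimately have "C i * (1 + load g n) \<le> C' * (1 + load g n)" by (rule mult_right_mono)
    with that show ?thesis by (rule order_trans)
  qed
  show ?thesis
  proof (intro exI[of _ C'] conjI allI ballI)
    show "1 \<le> C'" using C(1) by (simp add: C'_def sum_nonneg)
    fix g :: "real^'d" and n :: "nat^'p" and i :: "'d + 'p" and y assume y: "y \<in> Q"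
    let ?b = "C' * (1 + load g n)"
    note b = C(2)[of i, unfolded good_def, rule_format, OF y, of g n]
    show "\<bar>log_weight \<mu> g n i (lin i \<bullet> y)\<bar> \<le> ?b" using b by (intro up) blast
    show "\<bar>log_weight1 g n i (lin i \<bullet> y)\<bar> \<le> ?b" using b by (intro up) blast
    show "\<bar>log_weight2 n i (lin i \<bullet> y)\<bar> \<le> ?b" using b by (intro up) blast
    show "\<bar>log_weight3 n i (lin i \<bullet> y)\<bar> \<le> ?b" using b by (intro up) blast
  qed
qed

end

lemma outer_measurable [measurable]: "outer \<in> borel_measurable borel"
proof (rule borel_measurable_continuous_onI)
  show "continuous_on UNIV (outer :: real^'k \<Rightarrow> real^'k^'k)"
    unfolding outer_def by (intro continuous_intros)
qed

context weight_geometry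
begin

definition loss :: "(real^'d \<Rightarrow> nat^'p \<Rightarrow> real) \<Rightarrow> (real^'d) \<times> (nat^'p) \<Rightarrow> real^('d1 + 'p1) \<Rightarrow> real" where
  "loss f z y = reduced_weighted_square f \<mu> A B (fst z) (snd z) (unstack y)"

definition loss_grad :: "(real^'d \<Rightarrow> nat^'p \<Rightarrow> real) \<Rightarrow> (real^'d) \<times> (nat^'p) \<Rightarrow> real^('d1 + 'p1) \<Rightarrow> real^('d1 + 'p1)" where
  "loss_grad f z y = (f (fst z) (snd z))\<^sup>2 *\<^sub>R ridge.grad (fst z) (snd z) y"

definition loss_hess :: "(real^'d \<Rightarrow> nat^'p \<Rightarrow> real) \<Rightarrow> (real^'d) \<times> (nat^'p) \<Rightarrow> real^('d1 + 'p1) \<Rightarrow> real^('d1 + 'p1)^('d1 + 'p1)" where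
  "loss_hess f z y = (f (fst z) (snd z))\<^sup>2 *\<^sub>R ridge.hess (fst z) (snd z) y"

definition loss_bound :: "(real^'d \<Rightarrow> nat^'p \<Rightarrow> real) \<Rightarrow> real \<Rightarrow> real \<Rightarrow> (real^'d) \<times> (nat^'p) \<Rightarrow> real" where
  "loss_bound f C c z = (f (fst z) (snd z))\<^sup>2 * (C * exp (c * load (fst z) (snd z)))"

lemma loss_eq: "y \<in> stacked_domain \<Longrightarrow> loss f z y = (f (fst z) (snd z))\<^sup>2 * ridge.E (fst z) (snd z) y"
  by (simp add: loss_def reduced_weighted_square_eq)

lemma convex_loss: "convex_on stacked_domain (loss f z)"
proof -
  have "convex_on stacked_domain (\<lambda>y. (f (fst z) (snd z))\<^sup>2 * ridge.E (fst z) (snd z) y)"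
    by (intro convex_on_cmul ridge.convex_E) simp
  note E = convex_onD[OF this]
  show ?thesis
  proof (rule convex_onI[OF _ convex_stacked_domain])
    fix t :: real and x y :: "real^('d1 + 'p1)"
    assume t: "0 < t" "t < 1" and xy: "x \<in> stacked_domain" "y \<in> stacked_domain"
    moreover have "(1 - t) *\<^sub>R x + t *\<^sub>R y \<in> stacked_domain"
      using convexD_alt[OF convex_stacked_domain xy, of t] t by simp
    ultimately show "loss f z ((1 - t) *\<^sub>R x + t *\<^sub>R y) \<le> (1 - t) * loss f z x + t * loss f z y"
      using E[of t x y] by (simp only: loss_eq less_imp_le)
  qed
qed

lemma strict_loss:
  assumes "f (fst z) (snd z) \<noteq> 0" "\<And>b. snd z $ b \<noteq> 0"
    and xy: "x \<in> stacked_domain" "y \<in> stacked_domain" "x \<noteq> y"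
  shows "loss f z ((1/2) *\<^sub>R (x + y)) < (loss f z x + loss f z y) / 2"
proof -
  have "(1/2) *\<^sub>R (x + y) \<in> stacked_domain"
    using convexD[OF convex_stacked_domain xy(1,2), of "1/2" "1/2"] by (simp add: scaleR_add_right)
  moreover have "ridge.E (fst z) (snd z) ((1/2) *\<^sub>R (x + y)) < (ridge.E (fst z) (snd z) x + ridge.E (fst z) (snd z) y) / 2"
    by (rule ridge.strict_E[OF xy]) (use assms log_weight2_pos row_injective in auto)
  then have "(f (fst z) (snd z))\<^sup>2 * ridge.E (fst z) (snd z) ((1/2) *\<^sub>R (x + y)) <
      (f (fst z) (snd z))\<^sup>2 * ((ridge.E (fst z) (snd z) x + ridge.E (fst z) (snd z) y) / 2)"
    using assms(1) by (intro mult_strict_left_mono) auto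
  ultimately show ?thesis using xy by (simp add: loss_eq distrib_left)
qed

lemma loss_hess_form_nonneg: "y \<in> stacked_domain \<Longrightarrow> 0 \<le> h \<bullet> (loss_hess f z y *v h)"
proof -
  assume "y \<in> stacked_domain"
  then have "0 \<le> ridge.E (fst z) (snd z) y *
      ((ridge.slope (fst z) (snd z) y \<bullet> h) * (ridge.slope (fst z) (snd z) y \<bullet> h) + h \<bullet> (ridge.curv (snd z) y *v h))"
    by (intro mult_nonneg_nonneg[OF less_imp_le[OF ridge.E_pos]] add_nonneg_nonneg[OF zero_le_square] ridge.curv_nonneg)
  then show ?thesis
    unfolding loss_hess_def scaleR_matrix_vector_assoc[symmetric] inner_scaleR_right ridge.hess_form
    by (rule mult_nonneg_nonneg[OF zero_le_power2])
qed

text \<open>The squared slope only adds to the curvature term, and that term is positive since the linear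
forms separate points.\<close>

lemma loss_hess_form_pos:
  assumes "f (fst z) (snd z) \<noteq> 0" "\<And>b. snd z $ b \<noteq> 0" "y \<in> stacked_domain" "h \<noteq> 0"
  shows "0 < h \<bullet> (loss_hess f z y *v h)"
proof -
  obtain i where "lin i \<bullet> h \<noteq> 0" using row_injective[of h] assms(4) by auto
  then have "0 < h \<bullet> (ridge.curv (snd z) y *v h)"
    by (intro ridge.curv_pos[of y "snd z" i]) (use assms log_weight2_pos in auto)
  then have "0 < ridge.E (fst z) (snd z) y *
      ((ridge.slope (fst z) (snd z) y \<bullet> h) * (ridge.slope (fst z) (snd z) y \<bullet> h) + h \<bullet> (ridge.curv (snd z) y *v h))"
    by (intro mult_pos_pos[OF ridge.E_pos] add_nonneg_pos[OF zero_le_square])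
  then show ?thesis
    unfolding loss_hess_def scaleR_matrix_vector_assoc[symmetric] inner_scaleR_right ridge.hess_form
    by (rule mult_pos_pos[rotated]) (use assms(1) in simp)
qed

lemma loss_measurable:
  assumes f: "(\<lambda>z. f (fst z) (snd z)) \<in> borel_measurable sample_space" and y: "y \<in> stacked_domain"
  shows "(\<lambda>z. loss f z y) \<in> borel_measurable sample_space"
    and "(\<lambda>z. loss_grad f z y) \<in> borel_measurable sample_space"
    and "(\<lambda>z. loss_hess f z y) \<in> borel_measurable sample_space"
proof -
  note f [measurable]
  have [measurable]: "(\<lambda>z. log_weight \<mu> (fst z) (snd z) i u) \<in> borel_measurable sample_space"
    "(\<lambda>z. log_weight1 (fst z) (snd z) i u) \<in> borel_measurable sample_space"
    "(\<lambda>z :: (real^'d) \<times> (nat^'p). log_weight2 (snd z) i u) \<in> borel_measurable sample_space" for i u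
    by (cases i; simp add: log_weight_Inl log_weight_Inr; measurable)+
  show "(\<lambda>z. loss f z y) \<in> borel_measurable sample_space"
    unfolding loss_eq[OF y] ridge.E_def by measurable
  have [measurable]: "(\<lambda>z. ridge.slope (fst z) (snd z) y) \<in> borel_measurable sample_space"
    unfolding ridge.slope_def by measurable
  show "(\<lambda>z. loss_grad f z y) \<in> borel_measurable sample_space"
    unfolding loss_grad_def ridge.grad_def ridge.E_def by measurable
  show "(\<lambda>z. loss_hess f z y) \<in> borel_measurable sample_space"
    unfolding loss_hess_def ridge.hess_def ridge.E_def ridge.curv_def by measurable
qed

lemma loss_envelope:
  assumes Q: "compact Q" "convex Q" "Q \<subseteq> stacked_domain"
  obtains C c where "0 \<le> C" "0 \<le> c"
    and "\<And>f z y. y \<in> Q \<Longrightarrow> \<bar>loss f z y\<bar> \<le> loss_bound f C c z"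
    and "\<And>f z y. y \<in> Q \<Longrightarrow> norm (loss_grad f z y) \<le> loss_bound f C c z"
    and "\<And>f z y. y \<in> Q \<Longrightarrow> norm (loss_hess f z y) \<le> loss_bound f C c z"
    and "\<And>f z x y. x \<in> Q \<Longrightarrow> y \<in> Q \<Longrightarrow> \<bar>loss f z y - loss f z x\<bar>
      \<le> loss_bound f C c z * norm (y - x)"
    and "\<And>f z x y. x \<in> Q \<Longrightarrow> y \<in> Q \<Longrightarrow> \<bar>loss f z y - loss f z x - loss_grad f z x \<bullet> (y - x)\<bar>
      \<le> loss_bound f C c z * (norm (y - x))\<^sup>2"
    and "\<And>f z x y. x \<in> Q \<Longrightarrow> y \<in> Q \<Longrightarrow> norm (loss_grad f z y - loss_grad f z x - loss_hess f z x *v (y - x))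
      \<le> loss_bound f C c z * (norm (y - x))\<^sup>2"
proof -
  obtain C0 where C0: "1 \<le> C0" and bnd: "\<And>g n i y. y \<in> Q \<Longrightarrow> \<bar>log_weight \<mu> g n i (lin i \<bullet> y)\<bar> \<le> C0 * (1 + load g n)"
    "\<And>g n i y. y \<in> Q \<Longrightarrow> \<bar>log_weight1 g n i (lin i \<bullet> y)\<bar> \<le> C0 * (1 + load g n)"
    "\<And>g :: real^'d. \<And>n i y. y \<in> Q \<Longrightarrow> \<bar>log_weight2 n i (lin i \<bullet> y)\<bar> \<le> C0 * (1 + load g n)"
    "\<And>g :: real^'d. \<And>n i y. y \<in> Q \<Longrightarrow> \<bar>log_weight3 n i (lin i \<bullet> y)\<bar> \<le> C0 * (1 + load g n)"
    using log_weight_bounds[OF Q(1,3)] by blast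
  define m where "m = real CARD('d + 'p) + 3"
  define C where "C = 5 * ridge.\<kappa> ^ 3 * exp (m * C0)"
  define c where "c = m * C0"
  have env: "ridge.envelope (C0 * (1 + load g n)) = C * exp (c * load g n)" for g :: "real^'d" and n :: "nat^'p"
    by (simp add: ridge.envelope_def C_def c_def m_def distrib_left exp_add mult_ac)
  have \<Lambda>: "1 \<le> C0 * (1 + load g n)" for g :: "real^'d" and n :: "nat^'p"
    using mult_mono[OF C0, of 1 "1 + load g n"] load_nonneg[of g n] C0 by simp
  note hyps = Q(2,3) \<Lambda> bnd
  show ?thesis
  proof (rule that[of C c, unfolded loss_bound_def])
    have "0 \<le> ridge.\<kappa>" using ridge.\<kappa>_ge_1 by linarith
    then show "0 \<le> C" by (simp add: C_def)
    show "0 \<le> c" using C0 by (simp add: c_def m_def)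
    fix f :: "real^'d \<Rightarrow> nat^'p \<Rightarrow> real" and z :: "(real^'d) \<times> (nat^'p)"
    let ?f = "f (fst z) (snd z)" and ?L = "C * exp (c * load (fst z) (snd z))"
    {
      fix y assume y: "y \<in> Q"
      have "\<bar>ridge.E (fst z) (snd z) y\<bar> \<le> ?L"
        unfolding env[symmetric] by (rule ridge.E_le_envelope[OF hyps y])
      moreover have "\<bar>loss f z y\<bar> = ?f\<^sup>2 * \<bar>ridge.E (fst z) (snd z) y\<bar>"
        using y Q(3) by (simp add: loss_eq abs_mult subset_iff)
      ultimately show "\<bar>loss f z y\<bar> \<le> ?f\<^sup>2 * ?L"
        by (simp only: mult_left_mono zero_le_power2)
      have "norm (ridge.grad (fst z) (snd z) y) \<le> ?L"
        unfolding env[symmetric] by (rule ridge.grad_le_envelope[OF hyps y])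
      then show "norm (loss_grad f z y) \<le> ?f\<^sup>2 * ?L"
        unfolding loss_grad_def norm_scaleR abs_power2 by (rule mult_left_mono) simp
      have "norm (ridge.hess (fst z) (snd z) y) \<le> ?L"
        unfolding env[symmetric] by (rule ridge.hess_le_envelope[OF hyps y])
      then show "norm (loss_hess f z y) \<le> ?f\<^sup>2 * ?L"
        unfolding loss_hess_def norm_scaleR abs_power2 by (rule mult_left_mono) simp
    }
    fix x y assume xy: "x \<in> Q" "y \<in> Q"
    then have D: "x \<in> stacked_domain" "y \<in> stacked_domain" using Q(3) by auto
    have scale: "\<bar>?f\<^sup>2 * u\<bar> \<le> ?f\<^sup>2 * ?L * w" if "\<bar>u\<bar> \<le> ?L * w" for u w
      using mult_left_mono[OF that, of "?f\<^sup>2"] by (simp add: abs_mult mult.assoc)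
    have "\<bar>ridge.E (fst z) (snd z) y - ridge.E (fst z) (snd z) x\<bar> \<le> ?L * norm (y - x)"
      unfolding env[symmetric] by (rule ridge.E_lipschitz[OF hyps xy])
    from scale[OF this] show "\<bar>loss f z y - loss f z x\<bar> \<le> ?f\<^sup>2 * ?L * norm (y - x)"
      by (simp only: loss_eq[OF D(1)] loss_eq[OF D(2)] right_diff_distrib)
    have "\<bar>ridge.E (fst z) (snd z) y - ridge.E (fst z) (snd z) x - ridge.grad (fst z) (snd z) x \<bullet> (y - x)\<bar> \<le> ?L * (norm (y - x))\<^sup>2"
      unfolding env[symmetric] by (rule ridge.E_expansion[OF hyps xy])
    from scale[OF this] show "\<bar>loss f z y - loss f z x - loss_grad f z x \<bullet> (y - x)\<bar> \<le> ?f\<^sup>2 * ?L * (norm (y - x))\<^sup>2"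
      by (simp only: loss_eq[OF D(1)] loss_eq[OF D(2)] loss_grad_def inner_scaleR_left right_diff_distrib)
    let ?d = "ridge.grad (fst z) (snd z) y - ridge.grad (fst z) (snd z) x - ridge.hess (fst z) (snd z) x *v (y - x)"
    have "norm ?d \<le> ?L * (norm (y - x))\<^sup>2"
      unfolding env[symmetric] by (rule ridge.grad_expansion[OF hyps xy])
    then have "\<bar>norm ?d\<bar> \<le> ?L * (norm (y - x))\<^sup>2" by simp
    from scale[OF this] have "?f\<^sup>2 * norm ?d \<le> ?f\<^sup>2 * ?L * (norm (y - x))\<^sup>2" by simp
    moreover have "loss_grad f z y - loss_grad f z x - loss_hess f z x *v (y - x) = ?f\<^sup>2 *\<^sub>R ?d"
      by (simp add: loss_grad_def loss_hess_def scaleR_diff_right scaleR_matrix_vector_assoc[symmetric])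
    ultimately show "norm (loss_grad f z y - loss_grad f z x - loss_hess f z x *v (y - x)) \<le> ?f\<^sup>2 * ?L * (norm (y - x))\<^sup>2"
      by simp
  qed
qed

end

section \<open>The estimator\<close>

lemma unique_minimizer_iff:
  fixes h :: "'b \<Rightarrow> real"
  shows "unique_minimizer h D x \<longleftrightarrow> x \<in> D \<and> (\<forall>y\<in>D. y \<noteq> x \<longrightarrow> h x < h y)"
proof
  assume u: "unique_minimizer h D x"
  then have x: "x \<in> D" "\<And>y. y \<in> D \<Longrightarrow> h x \<le> h y"
    by (auto simp: unique_minimizer_def is_arg_min_def not_less)
  have "h x < h y" if y: "y \<in> D" "y \<noteq> x" for y
  proof (rule ccontr)
    assume "\<not> h x < h y"
    then have "is_arg_min h (\<lambda>y. y \<in> D) y"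
      using x(2) y(1) by (fastforce simp: is_arg_min_def not_less)
    with u y(2) show False by (simp add: unique_minimizer_def)
  qed
  with x(1) show "x \<in> D \<and> (\<forall>y\<in>D. y \<noteq> x \<longrightarrow> h x < h y)" by blast
next
  assume "x \<in> D \<and> (\<forall>y\<in>D. y \<noteq> x \<longrightarrow> h x < h y)"
  then show "unique_minimizer h D x"
    unfolding unique_minimizer_def is_arg_min_def by (metis less_asym order_less_irrefl)
qed

theorem proposition2p4:
  fixes M :: "'a measure"
    and G :: "'a \<Rightarrow> real ^ 'd" and N :: "'a \<Rightarrow> nat ^ 'p"
    and Gs :: "nat \<Rightarrow> 'a \<Rightarrow> real ^ 'd" and Ns :: "nat \<Rightarrow> 'a \<Rightarrow> nat ^ 'p"
    and \<mu> :: "real ^ 'p"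
    and f :: "real ^ 'd \<Rightarrow> nat ^ 'p \<Rightarrow> real"
    and A :: "real ^ 'd1 ^ 'd" and B :: "real ^ 'p1 ^ 'p"
    and xstar :: "(real ^ 'd1) \<times> (real ^ 'p1)"
    and est :: "nat \<Rightarrow> 'a \<Rightarrow> (real ^ 'd1) \<times> (real ^ 'p1)"
  assumes M: "prob_space M"
    and \<mu>_pos: "\<And>i. 0 < \<mu> $ i"
    and G_measurable: "G \<in> borel_measurable M"
    and G_law: "distr M borel G = std_normal_vec"
    and N_measurable: "N \<in> measurable M (count_space UNIV)"
    and N_law: "\<And>i. distr M (count_space UNIV) (\<lambda>\<omega>. N \<omega> $ i) = measure_pmf (poisson_pmf (\<mu> $ i))"
    and N_indep: "prob_space.indep_vars M (\<lambda>_. count_space UNIV) (\<lambda>i \<omega>. N \<omega> $ i) UNIV"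
    and G_N_indep: "prob_space.indep_set M (sets (vimage_algebra (space M) G borel))
      (sets (vimage_algebra (space M) N (count_space UNIV)))"
    and f_measurable: "(\<lambda>(g, n). f g n) \<in> borel_measurable sample_space"
    and f_integrable: "integrable M (\<lambda>\<omega>. \<bar>f (G \<omega>) (N \<omega>)\<bar>)"
    and dims: "CARD('d1) \<le> CARD('d)" "CARD('p1) \<le> CARD('p)"
    and A_rank: "rank A = CARD('d1)"
    and B_rank: "rank B = CARD('p1)"
    and B_nonneg: "\<And>i k. 0 \<le> B $ i $ k"
    and B_pos: "\<And>l. (\<And>k. 0 < l $ k) \<Longrightarrow> (\<And>i. 0 < (B *v l) $ i)"
    and xstar: "unique_minimizer (reduced_variance M G N f \<mu> A B) param_domain xstar"
    and samples_indep: "prob_space.indep_vars M (\<lambda>_. sample_space) (\<lambda>j \<omega>. (Gs j \<omega>, Ns j \<omega>)) {1..}"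
    and samples_law: "\<And>j. 1 \<le> j \<Longrightarrow>
      distr M sample_space (\<lambda>\<omega>. (Gs j \<omega>, Ns j \<omega>)) = distr M sample_space (\<lambda>\<omega>. (G \<omega>, N \<omega>))"
    and est_domain: "\<And>n \<omega>. 1 \<le> n \<Longrightarrow> \<omega> \<in> space M \<Longrightarrow> est n \<omega> \<in> param_domain"
    and est_measurable: "\<And>n. 1 \<le> n \<Longrightarrow>
      \<exists>\<tau> \<in> borel_measurable (PiM {1..n} (\<lambda>_. sample_space)).
        \<forall>\<omega> \<in> space M. est n \<omega> = \<tau> (\<lambda>j\<in>{1..n}. (Gs j \<omega>, Ns j \<omega>))"
    and est_minimizer: "\<And>n \<omega> x. 1 \<le> n \<Longrightarrow> \<omega> \<in> space M \<Longrightarrow>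
      unique_minimizer (empirical_variance Gs Ns f \<mu> A B n \<omega>) param_domain x \<Longrightarrow> est n \<omega> = x"
    and i: "\<exists>n :: nat ^ 'p. (\<forall>i. n $ i \<noteq> 0) \<and> measure M {\<omega> \<in> space M. \<bar>f (G \<omega>) n\<bar> > 0} > 0"
    and ii: "\<exists>\<gamma>>0. integrable M (\<lambda>\<omega>. \<bar>f (G \<omega>) (N \<omega>)\<bar> powr (2 + \<gamma>))"
  shows "(AE \<omega> in M. (\<lambda>n. est n \<omega>) \<longlonglongrightarrow> xstar) \<and>
    ((\<exists>\<delta>>0. integrable M (\<lambda>\<omega>. \<bar>f (G \<omega>) (N \<omega>)\<bar> powr (4 + \<delta>))) \<longrightarrow>
      (let v = (\<lambda>y. reduced_variance M G N f \<mu> A B (unstack y));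
           H = hessian v (stack xstar);
           DF = (\<lambda>\<omega>. gradient (\<lambda>y. reduced_weighted_square f \<mu> A B (G \<omega>) (N \<omega>) (unstack y)) (stack xstar));
           \<Gamma> = matrix_inv H ** covariance_matrix M DF ** matrix_inv H
       in twice_differentiable_at v (stack xstar) \<and> invertible H \<and>
          integrable M (\<lambda>\<omega>. (norm (DF \<omega>))\<^sup>2) \<and>
          (\<exists>\<nu>. normal_law 0 \<Gamma> \<nu> \<and>
            converges_weakly
              (\<lambda>n. distr M borel (\<lambda>\<omega>. sqrt (real n) *\<^sub>R (stack (est n \<omega>) - stack xstar))) \<nu>)))"
proof -
  interpret prob_space M by (rule M)
  interpret weight_geometry A B \<mu>
    by unfold_locales (use \<mu>_pos A_rank B_rank B_pos in auto)
  note G_measurable [measurable] N_measurable [measurable]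
  have f_meas [measurable]: "(\<lambda>z. f (fst z) (snd z)) \<in> borel_measurable sample_space"
    using f_measurable by (simp add: case_prod_beta)
  define P where "P = distr M sample_space (\<lambda>\<omega>. (G \<omega>, N \<omega>))"
  have GN [measurable]: "(\<lambda>\<omega>. (G \<omega>, N \<omega>)) \<in> measurable M sample_space" by measurable
  have sets_P: "sets P = sets sample_space" by (simp add: P_def)
  interpret PP: prob_space P unfolding P_def by (rule prob_space_distr) simp
  define x0 where "x0 = stack xstar"
  have x0D: "x0 \<in> stacked_domain"
    using xstar by (simp add: mem_stacked_domain x0_def unique_minimizer_iff)
  obtain r where r: "0 < r" "cball x0 r \<subseteq> stacked_domain"
    using open_stacked_domain x0D by (metis open_contains_cball)
  \<comment> \<open>One envelope \<open>K\<close> for all expansions on a ball inside the domain.\<close>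
  obtain C c where C: "0 \<le> C" and c: "0 \<le> c"
    and loss_le: "\<And>f z y. y \<in> cball x0 r \<Longrightarrow> \<bar>loss f z y\<bar> \<le> loss_bound f C c z"
    and grad_le: "\<And>f z y. y \<in> cball x0 r \<Longrightarrow> norm (loss_grad f z y) \<le> loss_bound f C c z"
    and hess_le: "\<And>f z y. y \<in> cball x0 r \<Longrightarrow> norm (loss_hess f z y) \<le> loss_bound f C c z"
    and lip: "\<And>f z x y. x \<in> cball x0 r \<Longrightarrow> y \<in> cball x0 r \<Longrightarrow> \<bar>loss f z y - loss f z x\<bar>
      \<le> loss_bound f C c z * norm (y - x)"
    and expn: "\<And>f z x y. x \<in> cball x0 r \<Longrightarrow> y \<in> cball x0 r \<Longrightarrow> \<bar>loss f z y - loss f z x - loss_grad f z x \<bullet> (y - x)\<bar>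
      \<le> loss_bound f C c z * (norm (y - x))\<^sup>2"
    and gexpn: "\<And>f z x y. x \<in> cball x0 r \<Longrightarrow> y \<in> cball x0 r \<Longrightarrow> norm (loss_grad f z y - loss_grad f z x - loss_hess f z x *v (y - x))
      \<le> loss_bound f C c z * (norm (y - x))\<^sup>2"
    by (rule loss_envelope[OF compact_cball convex_cball r(2)]) (rule that; assumption)
  define K where "K = loss_bound f C c"
  have K_nonneg: "0 \<le> K z" for z using C by (simp add: K_def loss_bound_def)
  have K_meas [measurable]: "K \<in> borel_measurable sample_space"
    unfolding K_def loss_bound_def by measurable
  have f_GN [measurable]: "(\<lambda>\<omega>. f (G \<omega>) (N \<omega>)) \<in> borel_measurable M"
    using measurable_compose[OF GN f_meas] by simp
  have load_GN [measurable]: "(\<lambda>\<omega>. load (G \<omega>) (N \<omega>)) \<in> borel_measurable M"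
    using measurable_compose[OF GN load_measurable] by simp
  note exp_load = exp_load_integrable[OF G_measurable G_law N_measurable N_law \<mu>_pos]
  have moment: "integrable M (\<lambda>\<omega>. \<bar>f (G \<omega>) (N \<omega>)\<bar> ^ a * exp (b * load (G \<omega>) (N \<omega>)))"
    if "\<exists>\<gamma>>0. integrable M (\<lambda>\<omega>. \<bar>f (G \<omega>) (N \<omega>)\<bar> powr (real a + \<gamma>))" "0 < a" "0 \<le> b" for a b
    using that by (auto intro!: power_exp_integrable[OF f_GN load_GN exp_load])
  have K_int: "integrable P K"
  proof -
    have "integrable M (\<lambda>\<omega>. C * (\<bar>f (G \<omega>) (N \<omega>)\<bar> ^ 2 * exp (c * load (G \<omega>) (N \<omega>))))"
      by (rule integrable_mult_right) (rule moment, use ii c in auto)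
    also have "(\<lambda>\<omega>. C * (\<bar>f (G \<omega>) (N \<omega>)\<bar> ^ 2 * exp (c * load (G \<omega>) (N \<omega>)))) = (\<lambda>\<omega>. K (G \<omega>, N \<omega>))"
      by (simp add: K_def loss_bound_def mult_ac)
    finally show ?thesis unfolding P_def by (subst integrable_distr_eq) auto
  qed
  note meas = loss_measurable[OF f_meas]
  have dom: "x \<in> cball x0 r \<Longrightarrow> x \<in> stacked_domain" for x using r(2) by auto
  have x0r: "x0 \<in> cball x0 r" using r(1) by simp
  have limit_v: "reduced_variance M G N f \<mu> A B (unstack y) = (\<integral>z. loss f z y \<partial>P)" if "y \<in> stacked_domain" for y
    unfolding P_def reduced_variance_def using meas(1)[OF that] by (subst integral_distr) (auto simp: loss_def)
  \<comment> \<open>The observations with strictly convex loss have positive probability.\<close>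
  obtain U where U: "U \<in> sets P" "0 < measure P U" "\<And>z. z \<in> U \<Longrightarrow> f (fst z) (snd z) \<noteq> 0"
    "\<And>z i. z \<in> U \<Longrightarrow> snd z $ i \<noteq> 0"
  proof -
    obtain n0 where n0: "\<And>i. n0 $ i \<noteq> 0" and pos: "0 < measure M {\<omega> \<in> space M. \<bar>f (G \<omega>) n0\<bar> > 0}"
      using i by blast
    have "(\<lambda>g. (g, n0)) \<in> measurable borel sample_space" by (intro measurable_Pair) auto
    from measurable_compose[OF this f_meas] have fn: "(\<lambda>g. f g n0) \<in> borel_measurable borel" by simp
    have "0 < prob {\<omega> \<in> space M. f (G \<omega>) n0 \<noteq> 0 \<and> N \<omega> = n0}"
      by (rule positive_sample_probability[OF G_measurable N_measurable N_law \<mu>_pos N_indep G_N_indep fn]) (use pos in simp)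
    also have "{\<omega> \<in> space M. f (G \<omega>) n0 \<noteq> 0 \<and> N \<omega> = n0} =
        (\<lambda>\<omega>. (G \<omega>, N \<omega>)) -` {z \<in> space sample_space. f (fst z) (snd z) \<noteq> 0 \<and> snd z = n0} \<inter> space M"
      by (auto simp: space_pair_measure)
    also have "prob \<dots> = measure P {z \<in> space sample_space. f (fst z) (snd z) \<noteq> 0 \<and> snd z = n0}"
      unfolding P_def by (subst measure_distr) auto
    finally have "0 < measure P {z \<in> space sample_space. f (fst z) (snd z) \<noteq> 0 \<and> snd z = n0}" .
    then show ?thesis
      using n0 by (intro that[of "{z \<in> space sample_space. f (fst z) (snd z) \<noteq> 0 \<and> snd z = n0}"]) (auto simp: sets_P)
  qed
  have cme: "convex_m_estimation M sample_space P (\<lambda>j \<omega>. (Gs j \<omega>, Ns j \<omega>)) (loss f) stacked_domain x0 r (loss_grad f)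
      (\<lambda>z. loss_hess f z x0) K"
  proof (unfold_locales)
    show "indep_vars (\<lambda>_. sample_space) (\<lambda>j \<omega>. (Gs j \<omega>, Ns j \<omega>)) {1..}" by (rule samples_indep)
    show "distr M sample_space (\<lambda>\<omega>. (Gs j \<omega>, Ns j \<omega>)) = P" if "1 \<le> j" for j
      unfolding P_def by (rule samples_law[OF that])
    show "convex (stacked_domain :: (real^('d1 + 'p1)) set)" by (rule convex_stacked_domain)
    show "0 < r" "cball x0 r \<subseteq> stacked_domain" by (rule r)+
    show "integrable P (\<lambda>z. loss f z x)" if "x \<in> cball x0 r" for x
      by (rule Bochner_Integration.integrable_bound[OF K_int])
        (use loss_le[OF that, of f] K_nonneg meas(1)[OF dom[OF that]] in \<open>auto simp: K_def P_def\<close>)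
    show "integrable P (\<lambda>z. loss_grad f z x)" if "x \<in> cball x0 r" for x
      by (rule Bochner_Integration.integrable_bound[OF K_int])
        (use grad_le[OF that, of f] K_nonneg meas(2)[OF dom[OF that]] in \<open>auto simp: K_def P_def\<close>)
    show "integrable P (\<lambda>z. loss_hess f z x0)"
      by (rule Bochner_Integration.integrable_bound[OF K_int])
        (use hess_le[OF x0r, of f] K_nonneg meas(3)[OF x0D] in \<open>auto simp: K_def P_def\<close>)
    show "integrable P K" by (rule K_int)
    fix z
    show "convex_on stacked_domain (loss f z)" by (rule convex_loss)
    fix x y assume xy: "x \<in> cball x0 r" "y \<in> cball x0 r"
    show "\<bar>loss f z y - loss f z x\<bar> \<le> K z * norm (y - x)" unfolding K_def by (rule lip[OF xy])
    show "\<bar>loss f z y - loss f z x - loss_grad f z x \<bullet> (y - x)\<bar> \<le> K z * (norm (y - x))\<^sup>2"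
      unfolding K_def by (rule expn[OF xy])
  next
    fix z y assume "y \<in> cball x0 r"
    then show "norm (loss_grad f z y - loss_grad f z x0 - loss_hess f z x0 *v (y - x0)) \<le> K z * (norm (y - x0))\<^sup>2"
      unfolding K_def by (rule gexpn[OF x0r])
  next
    show "\<exists>A\<in>sets P. 0 < measure P A \<and> (\<forall>z\<in>A. \<forall>x\<in>stacked_domain. \<forall>y\<in>stacked_domain. x \<noteq> y \<longrightarrow>
        loss f z ((1 / 2) *\<^sub>R (x + y)) < (loss f z x + loss f z y) / 2)"
      using U strict_loss[of f] by (intro bexI[of _ U]) auto
  next
    fix y :: "real^('d1 + 'p1)" assume y: "y \<in> stacked_domain" "y \<noteq> x0"
    have "unstack y \<noteq> xstar" using y(2) by (metis stack_unstack x0_def)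
    moreover have "unstack y \<in> param_domain" using y(1) by (simp add: mem_stacked_domain)
    ultimately have "reduced_variance M G N f \<mu> A B xstar < reduced_variance M G N f \<mu> A B (unstack y)"
      using xstar unfolding unique_minimizer_iff by blast
    then show "(\<integral>z. loss f z x0 \<partial>P) < (\<integral>z. loss f z y \<partial>P)"
      using limit_v[OF y(1)] limit_v[OF x0D] by (simp add: x0_def)
  qed
  interpret ME: convex_m_estimation M sample_space P "\<lambda>j \<omega>. (Gs j \<omega>, Ns j \<omega>)" "loss f" stacked_domain x0 r "loss_grad f"
      "\<lambda>z. loss_hess f z x0" K by (rule cme)
  have mean_eq: "ME.mean_F n \<omega> y = empirical_variance Gs Ns f \<mu> A B n \<omega> (unstack y)" for n \<omega> y
    by (simp add: ME.mean_F_def empirical_variance_def loss_def)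
  have est: "stack (est n \<omega>) = y" if "1 \<le> n" "\<omega> \<in> space M" "unique_minimizer (ME.mean_F n \<omega>) stacked_domain y" for n \<omega> y
  proof -
    have "unique_minimizer (empirical_variance Gs Ns f \<mu> A B n \<omega>) param_domain (unstack y)"
      unfolding unique_minimizer_iff
    proof (intro conjI ballI impI)
      show "unstack y \<in> param_domain"
        using that(3) by (simp add: unique_minimizer_iff mem_stacked_domain)
      fix x :: "(real^'d1) \<times> (real^'p1)" assume x: "x \<in> param_domain" "x \<noteq> unstack y"
      then have "stack x \<in> stacked_domain" "stack x \<noteq> y" by (auto simp: mem_stacked_domain)
      with that(3) have "ME.mean_F n \<omega> y < ME.mean_F n \<omega> (stack x)" unfolding unique_minimizer_iff by blast
      then show "empirical_variance Gs Ns f \<mu> A B n \<omega> (unstack y) < empirical_variance Gs Ns f \<mu> A B n \<omega> x"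
        by (simp add: mean_eq)
    qed
    from est_minimizer[OF that(1,2) this] show ?thesis by simp
  qed
  have consistent: "AE \<omega> in M. (\<lambda>n. stack (est n \<omega>)) \<longlonglongrightarrow> x0"
    using ME.minimizer_consistent AE_space
  proof eventually_elim
    case (elim \<omega>)
    show ?case
    proof (rule tendstoI)
      fix e :: real assume "0 < e"
      from elim(1)[rule_format, OF this] eventually_ge_at_top[of 1]
      show "\<forall>\<^sub>F n in sequentially. dist (stack (est n \<omega>)) x0 < e"
        by eventually_elim (use est elim(2) in \<open>auto simp: dist_norm\<close>)
    qed
  qed
  have part1: "AE \<omega> in M. (\<lambda>n. est n \<omega>) \<longlonglongrightarrow> xstar"
    using consistent
  proof eventually_elim
    case (elim \<omega>)
    have "continuous_on UNIV (unstack :: real^('d1 + 'p1) \<Rightarrow> _)" by (rule continuous_unstack)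
    then have "isCont unstack x0" by (simp add: continuous_on_eq_continuous_at)
    from isCont_tendsto_compose[OF this elim] show ?case by (simp add: x0_def)
  qed
  define v where "v = (\<lambda>y. reduced_variance M G N f \<mu> A B (unstack y))"
  define DF where "DF = (\<lambda>\<omega>. gradient (\<lambda>y. reduced_weighted_square f \<mu> A B (G \<omega>) (N \<omega>) (unstack y)) (stack xstar))"
  have DF_eq: "DF \<omega> = loss_grad f (G \<omega>, N \<omega>) x0" for \<omega>
  proof -
    have "(loss f (G \<omega>, N \<omega>) has_derivative (\<lambda>d. loss_grad f (G \<omega>, N \<omega>) x0 \<bullet> d)) (at x0)"
      by (rule has_derivative_quadratic_error[where e=r and C="K (G \<omega>, N \<omega>)", OF bounded_linear_inner_right r(1)])
        (use expn[OF x0r, of _ f "(G \<omega>, N \<omega>)"] in \<open>simp add: K_def\<close>)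
    from gradient_eqI[OF this] show ?thesis by (simp add: DF_def loss_def[abs_def] x0_def)
  qed
  \<comment> \<open>The objective \<open>v\<close> agrees with the expected loss on the domain only, which is a neighbourhood
    of \<open>x0\<close>; its derivatives are transferred from there.\<close>
  have v_deriv: "(v has_derivative (\<lambda>d. ME.limit_DF y \<bullet> d)) (at y)" if "y \<in> ball x0 r" for y
  proof (rule has_derivative_transform_within_open[OF ME.limit_F_has_derivative[OF that] open_ball that])
    fix x assume "x \<in> ball x0 r"
    then have "x \<in> stacked_domain" by (intro dom) simp
    then show "ME.limit_F x = v x" by (simp add: v_def limit_v ME.limit_F_def)
  qed
  have v_grad: "gradient v y = ME.limit_DF y" if "y \<in> ball x0 r" for y
    by (rule gradient_eqI[OF v_deriv[OF that]])
  have v_hess_deriv: "(gradient v has_derivative (\<lambda>d. ME.limit_HF *v d)) (at x0)"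
    by (rule has_derivative_transform_within_open[OF ME.gradient_limit_F_has_derivative open_ball[of x0 r]])
      (use r(1) in \<open>auto simp: v_grad ME.gradient_limit_F\<close>)
  have hess_v: "hessian v x0 = ME.limit_HF"
    by (rule hessian_eqI[OF v_hess_deriv])
  have twice: "twice_differentiable_at v x0"
    unfolding twice_differentiable_at_def
  proof
    have "\<forall>\<^sub>F y in nhds x0. y \<in> ball x0 r"
      using r(1) by (intro eventually_nhds_in_open) auto
    then show "\<forall>\<^sub>F y in nhds x0. v differentiable at y"
      by eventually_elim (use v_deriv in \<open>auto simp: differentiable_def\<close>)
    show "gradient v differentiable at x0"
      using v_hess_deriv by (auto simp: differentiable_def)
  qed
  have H_form: "h \<bullet> (ME.limit_HF *v h) = (\<integral>z. h \<bullet> (loss_hess f z x0 *v h) \<partial>P)"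
    and H_form_int: "integrable P (\<lambda>z. h \<bullet> (loss_hess f z x0 *v h))" for h
  proof -
    have L: "bounded_linear (\<lambda>A :: real^('d1 + 'p1)^('d1 + 'p1). h \<bullet> (A *v h))"
      by (rule bounded_linear_compose[OF bounded_linear_inner_right bounded_linear_matrix_vector_left])
    show "integrable P (\<lambda>z. h \<bullet> (loss_hess f z x0 *v h))"
      by (rule integrable_bounded_linear[OF L ME.HF_integrable])
    show "h \<bullet> (ME.limit_HF *v h) = (\<integral>z. h \<bullet> (loss_hess f z x0 *v h) \<partial>P)"
      unfolding ME.limit_HF_def by (rule integral_bounded_linear[OF L ME.HF_integrable, symmetric])
  qed
  \<comment> \<open>The Hessian of the loss is semidefinite, and definite on \<open>U\<close>.\<close>
  have H_pos: "0 < h \<bullet> (ME.limit_HF *v h)" if "h \<noteq> 0" for h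
  proof -
    have nonneg: "AE z in P. 0 \<le> h \<bullet> (loss_hess f z x0 *v h)"
      by (intro AE_I2 loss_hess_form_nonneg x0D)
    have "(\<integral>z. h \<bullet> (loss_hess f z x0 *v h) \<partial>P) \<noteq> 0"
    proof
      assume "(\<integral>z. h \<bullet> (loss_hess f z x0 *v h) \<partial>P) = 0"
      then have "AE z in P. h \<bullet> (loss_hess f z x0 *v h) = 0"
        using integral_nonneg_eq_0_iff_AE[OF H_form_int nonneg] by simp
      then have "AE z in P. z \<notin> U"
      proof eventually_elim
        case (elim z)
        show ?case
        proof
          assume "z \<in> U"
          from loss_hess_form_pos[of f z, OF U(3)[OF this] U(4)[OF this] x0D that] elim show False by simp
        qed
      qed
      then have "measure P U = 0"
        using PP.prob_eq_0[OF U(1)] by simp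
      with U(2) show False by simp
    qed
    moreover have "0 \<le> (\<integral>z. h \<bullet> (loss_hess f z x0 *v h) \<partial>P)"
      using nonneg by (rule integral_nonneg_AE)
    ultimately show ?thesis unfolding H_form by simp
  qed
  have H_inv: "invertible ME.limit_HF"
  proof -
    have "inj ((*v) ME.limit_HF)"
    proof (rule injI)
      fix x y assume "ME.limit_HF *v x = ME.limit_HF *v y"
      then have "ME.limit_HF *v (x - y) = 0" by (simp add: matrix_vector_mult_diff_distrib)
      then show "x = y" using H_pos[of "x - y"] by (cases "x = y") auto
    qed
    then show ?thesis
      by (simp add: invertible_left_inverse matrix_left_invertible_injective)
  qed
  have H_sym: "transpose ME.limit_HF = ME.limit_HF"
  proof -
    have T: "bounded_linear (transpose :: real^('d1 + 'p1)^('d1 + 'p1) \<Rightarrow> _)"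
      unfolding linear_conv_bounded_linear[symmetric] by (rule linearI) (simp_all add: transpose_def vec_eq_iff)
    have "transpose (loss_hess f z x0) = loss_hess f z x0" for z
      using ridge.hess_symmetric by (simp add: loss_hess_def transpose_def vec_eq_iff)
    then show ?thesis
      unfolding ME.limit_HF_def integral_bounded_linear[OF T ME.HF_integrable, symmetric] by simp
  qed
  have est_meas: "(\<lambda>\<omega>. stack (est n \<omega>)) \<in> borel_measurable M" if n: "1 \<le> n" for n
  proof -
    obtain \<tau> where \<tau>: "\<tau> \<in> borel_measurable (PiM {1..n} (\<lambda>_. sample_space))"
      and eq: "\<And>\<omega>. \<omega> \<in> space M \<Longrightarrow> est n \<omega> = \<tau> (\<lambda>j\<in>{1..n}. (Gs j \<omega>, Ns j \<omega>))"
      using est_measurable[OF n] by blast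
    have "(\<lambda>\<omega>. \<lambda>j\<in>{1..n}. (Gs j \<omega>, Ns j \<omega>)) \<in> measurable M (PiM {1..n} (\<lambda>_. sample_space))"
      by (rule measurable_restrict) (use ME.Z_measurable in auto)
    from measurable_compose[OF this \<tau>] have "est n \<in> borel_measurable M"
      using eq by (simp cong: measurable_cong)
    then show ?thesis
      by (rule measurable_compose) (rule borel_measurable_continuous_onI[OF continuous_stack])
  qed
  have part2: "let H = hessian v (stack xstar); \<Gamma> = matrix_inv H ** covariance_matrix M DF ** matrix_inv H
       in twice_differentiable_at v (stack xstar) \<and> invertible H \<and> integrable M (\<lambda>\<omega>. (norm (DF \<omega>))\<^sup>2) \<and>
          (\<exists>\<nu>. normal_law 0 \<Gamma> \<nu> \<and>
            converges_weakly (\<lambda>n. distr M borel (\<lambda>\<omega>. sqrt (real n) *\<^sub>R (stack (est n \<omega>) - stack xstar))) \<nu>)"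
    if iv: "\<exists>\<delta>>0. integrable M (\<lambda>\<omega>. \<bar>f (G \<omega>) (N \<omega>)\<bar> powr (4 + \<delta>))"
  proof -
    have K2: "integrable M (\<lambda>\<omega>. (K (G \<omega>, N \<omega>))\<^sup>2)"
    proof -
      have "integrable M (\<lambda>\<omega>. C\<^sup>2 * (\<bar>f (G \<omega>) (N \<omega>)\<bar> ^ 4 * exp ((2 * c) * load (G \<omega>) (N \<omega>))))"
        by (rule integrable_mult_right) (rule moment, use iv c in auto)
      also have "(\<lambda>\<omega>. C\<^sup>2 * (\<bar>f (G \<omega>) (N \<omega>)\<bar> ^ 4 * exp ((2 * c) * load (G \<omega>) (N \<omega>)))) = (\<lambda>\<omega>. (K (G \<omega>, N \<omega>))\<^sup>2)"
      proof
        fix \<omega>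
        have "exp ((2 * c) * load (G \<omega>) (N \<omega>)) = (exp (c * load (G \<omega>) (N \<omega>)))\<^sup>2"
          by (simp add: exp_double[symmetric] mult.assoc)
        then show "C\<^sup>2 * (\<bar>f (G \<omega>) (N \<omega>)\<bar> ^ 4 * exp ((2 * c) * load (G \<omega>) (N \<omega>))) = (K (G \<omega>, N \<omega>))\<^sup>2"
          by (simp add: K_def loss_bound_def power_mult_distrib power_even_abs)
      qed
      finally show ?thesis .
    qed
    have DF_meas: "DF \<in> borel_measurable M"
      unfolding DF_eq[abs_def] by (rule measurable_compose[OF GN meas(2)[OF x0D]])
    have DF_sq: "integrable M (\<lambda>\<omega>. (norm (DF \<omega>))\<^sup>2)"
    proof (rule Bochner_Integration.integrable_bound[OF K2])
      have "(norm (DF \<omega>))\<^sup>2 \<le> (K (G \<omega>, N \<omega>))\<^sup>2" for \<omega>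
        unfolding DF_eq K_def by (intro power_mono grad_le x0r) simp
      then show "AE \<omega> in M. norm ((norm (DF \<omega>))\<^sup>2) \<le> norm ((K (G \<omega>, N \<omega>))\<^sup>2)" by simp
    qed (use DF_meas in measurable)
    then have P_sq: "integrable P (\<lambda>z. (norm (loss_grad f z x0))\<^sup>2)"
      unfolding P_def using meas(2)[OF x0D] by (subst integrable_distr_eq) (auto simp: DF_eq)
    have cov: "covariance_matrix M DF = covariance_matrix P (\<lambda>z. loss_grad f z x0)"
    proof -
      have gm: "(\<lambda>z. loss_grad f z x0 $ i) \<in> borel_measurable sample_space" for i
        using borel_measurable_vec_nth_comp[OF meas(2)[OF x0D]] .
      have tr: "(\<integral>z. k z \<partial>P) = (\<integral>\<omega>. k (G \<omega>, N \<omega>) \<partial>M)" if "k \<in> borel_measurable sample_space" for k :: "_ \<Rightarrow> real"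
        unfolding P_def using that by (subst integral_distr) auto
      show ?thesis
        unfolding covariance_matrix_def using gm by (simp add: tr DF_eq)
    qed
    from ME.minimizer_asymptotically_normal[OF H_inv H_sym P_sq est_meas est]
    show ?thesis
      using twice H_inv DF_sq by (simp add: Let_def x0_def[symmetric] hess_v cov)
  qed
  show ?thesis
    using part1 part2 unfolding v_def DF_def Let_def by blast
qed

end
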